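(* Let $S=\mathbb{T}^2_{a,b}\setminus\mathcal{O}$ be a Sinai billiard, and let $V$ be any open neighbourhood in $S$ of the convex boundary $\partial\mathcal{O}$. Let $\Delta$ be the Dirichlet or the Neumann Laplace operator on $S$ (boundary condition imposed on $\partial\mathcal{O}$). Then there exists a constant $C=C(V)>0$ such that for any $h>0$, any real number $E(h)$ with $|E(h)-1|<\frac12$, and any $u$ in the domain of $\Delta$, $$-h^2\Delta u=E(h)u\ \Longrightarrow\ \int_V|u(x)|^2\,dx\ \ge\ \frac1C\int_S|u(x)|^2\,dx .$$
   Context: For $a,b>0$, $\mathbb{T}^2_{a,b}=(a\mathbb{S}^1)\times(b\mathbb{S}^1)$ is the flat two-dimensional torus, the product of two circles scaled by $a$ and $b$ respectively. A Sinai billiard is $S=\mathbb{T}^2_{a,b}\setminus\mathcal{O}$, where $\mathcal{O}\subset\mathbb{T}^2_{a,b}$ is a nonempty strictly convex open set (with respect to the flat metric) with $C^\infty$ boundary. The constant $C$ does not depend on $h$, $E(h)$ or $u$. *)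

theory Defs
  imports "HOL-Analysis.Analysis"
begin

section \<open>Smooth functions and smooth boundaries\<close>

primrec Ck :: "nat \<Rightarrow> ('a::euclidean_space \<Rightarrow> 'b::real_normed_vector) \<Rightarrow> bool" where
  "Ck 0 f \<longleftrightarrow> continuous_on UNIV f"
| "Ck (Suc k) f \<longleftrightarrow>
     (\<exists>f'. (\<forall>x. (f has_derivative f' x) (at x)) \<and> (\<forall>v. Ck k (\<lambda>x. f' x v)))"

definition smooth :: "('a::euclidean_space \<Rightarrow> 'b::real_normed_vector) \<Rightarrow> bool" where
  "smooth f \<longleftrightarrow> (\<forall>k. Ck k f)"

text \<open>Local defining functions; near each boundary point the set lies on one side of its boundary.\<close>

definition smooth_boundary :: "'a::euclidean_space set \<Rightarrow> bool" where
  "smooth_boundary D \<longleftrightarrow>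
     (\<forall>x\<in>frontier D. \<exists>W (g :: 'a \<Rightarrow> real). open W \<and> x \<in> W \<and> smooth g \<and>
        (\<forall>y\<in>W. frechet_derivative g (at y) \<noteq> (\<lambda>v. 0)) \<and>
        D \<inter> W = {y\<in>W. g y < 0} \<and> frontier D \<inter> W = {y\<in>W. g y = 0})"

definition strictly_convex :: "'a::real_normed_vector set \<Rightarrow> bool" where
  "strictly_convex U \<longleftrightarrow>
     (\<forall>x\<in>closure U. \<forall>y\<in>closure U. x \<noteq> y \<longrightarrow> open_segment x y \<subseteq> interior U)"


section \<open>The flat torus\<close>

text \<open>
  The product of the circles of radii \<open>a\<close> and \<open>b\<close>, inside the plane \<open>\<complex> \<times> \<complex>\<close>. The map
  \<open>torus_proj a b\<close> is the locally isometric universal covering by the Euclidean plane.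
  Functions on the torus are functions on \<open>\<complex> \<times> \<complex>\<close> whose values off the torus are irrelevant.
\<close>

definition flat_torus :: "real \<Rightarrow> real \<Rightarrow> (complex \<times> complex) set" where
  "flat_torus a b = sphere 0 a \<times> sphere 0 b"

definition torus_proj :: "real \<Rightarrow> real \<Rightarrow> real \<times> real \<Rightarrow> complex \<times> complex" where
  "torus_proj a b p = (of_real a * cis (fst p / a), of_real b * cis (snd p / b))"

definition torus_measure :: "real \<Rightarrow> real \<Rightarrow> (complex \<times> complex) measure" where
  "torus_measure a b =
     distr (restrict_space lborel ({0..<2 * pi * a} \<times> {0..<2 * pi * b})) borel (torus_proj a b)"

text \<open>Derivatives along the two unit-speed coordinate geodesics.\<close>

definition torus_d1 :: "real \<Rightarrow> (complex \<times> complex \<Rightarrow> complex) \<Rightarrow> complex \<times> complex \<Rightarrow> complex" where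
  "torus_d1 a f z = vector_derivative (\<lambda>t. f (fst z * cis (t / a), snd z)) (at 0)"

definition torus_d2 :: "real \<Rightarrow> (complex \<times> complex \<Rightarrow> complex) \<Rightarrow> complex \<times> complex \<Rightarrow> complex" where
  "torus_d2 b f z = vector_derivative (\<lambda>t. f (fst z, snd z * cis (t / b))) (at 0)"


section \<open>Sinai billiards\<close>

text \<open>
  Convexity with respect to the flat metric: the set lifts injectively to a strictly convex
  set of the Euclidean plane, so that any two of its points are joined by exactly one geodesic
  segment inside the set.
\<close>

definition torus_strictly_convex :: "real \<Rightarrow> real \<Rightarrow> (complex \<times> complex) set \<Rightarrow> bool" where
  "torus_strictly_convex a b Q \<longleftrightarrow>
     (\<exists>U. open U \<and> strictly_convex U \<and> inj_on (torus_proj a b) U \<and> Q = torus_proj a b ` U)"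

text \<open>
  Smoothness of the boundary is tested on the full (periodic) preimage. As that preimage must
  lie locally on one side of its boundary, the closures of distinct lifts of the obstacle are
  disjoint.
\<close>

definition sinai_obstacle :: "real \<Rightarrow> real \<Rightarrow> (complex \<times> complex) set \<Rightarrow> bool" where
  "sinai_obstacle a b Q \<longleftrightarrow>
     Q \<noteq> {} \<and> openin (top_of_set (flat_torus a b)) Q \<and>
     torus_strictly_convex a b Q \<and> smooth_boundary (torus_proj a b -` Q)"


section \<open>The Dirichlet and Neumann Laplacians\<close>

text \<open>
  Below, \<open>S\<close> is a closed subset of the torus whose boundary is a null set, so that \<open>L\<^sup>2\<close> of \<open>S\<close>
  and of its interior agree; Sobolev spaces are those of the interior. Elements of \<open>L\<^sup>2\<close> are given by
  Borel representatives.
\<close>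

definition L2_on ::
  "real \<Rightarrow> real \<Rightarrow> (complex \<times> complex) set \<Rightarrow> (complex \<times> complex \<Rightarrow> complex) \<Rightarrow> bool" where
  "L2_on a b S u \<longleftrightarrow>
     set_borel_measurable (torus_measure a b) S u \<and>
     set_integrable (torus_measure a b) S (\<lambda>x. (cmod (u x))\<^sup>2)"

text \<open>The torus being compact, a closed support is a compact one.\<close>

definition test_function ::
  "real \<Rightarrow> real \<Rightarrow> (complex \<times> complex) set \<Rightarrow> (complex \<times> complex \<Rightarrow> complex) \<Rightarrow> bool" where
  "test_function a b S \<phi> \<longleftrightarrow>
     smooth (\<phi> \<circ> torus_proj a b) \<and>
     closure {x \<in> flat_torus a b. \<phi> x \<noteq> 0} \<subseteq> (top_of_set (flat_torus a b)) interior_of S"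

text \<open>\<open>u\<close> belongs to the Sobolev space \<open>H\<^sup>1\<close> and has the weak gradient \<open>(g1, g2)\<close>.\<close>

definition H1_grad ::
  "real \<Rightarrow> real \<Rightarrow> (complex \<times> complex) set \<Rightarrow> (complex \<times> complex \<Rightarrow> complex) \<Rightarrow>
   (complex \<times> complex \<Rightarrow> complex) \<Rightarrow> (complex \<times> complex \<Rightarrow> complex) \<Rightarrow> bool" where
  "H1_grad a b S u g1 g2 \<longleftrightarrow>
     L2_on a b S u \<and> L2_on a b S g1 \<and> L2_on a b S g2 \<and>
     (\<forall>\<phi>. test_function a b S \<phi> \<longrightarrow>
        (LINT x:S|torus_measure a b. u x * torus_d1 a \<phi> x) =
          - (LINT x:S|torus_measure a b. g1 x * \<phi> x) \<and>
        (LINT x:S|torus_measure a b. u x * torus_d2 b \<phi> x) =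
          - (LINT x:S|torus_measure a b. g2 x * \<phi> x))"

text \<open>\<open>H\<^sup>1\<^sub>0\<close> is the closure of the test functions in \<open>H\<^sup>1\<close>.\<close>

definition H10_grad ::
  "real \<Rightarrow> real \<Rightarrow> (complex \<times> complex) set \<Rightarrow> (complex \<times> complex \<Rightarrow> complex) \<Rightarrow>
   (complex \<times> complex \<Rightarrow> complex) \<Rightarrow> (complex \<times> complex \<Rightarrow> complex) \<Rightarrow> bool" where
  "H10_grad a b S u g1 g2 \<longleftrightarrow>
     H1_grad a b S u g1 g2 \<and>
     (\<exists>\<phi>. (\<forall>n::nat. test_function a b S (\<phi> n)) \<and>
        (\<lambda>n. LINT x:S|torus_measure a b. (cmod (u x - \<phi> n x))\<^sup>2) \<longlonglongrightarrow> 0 \<and>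
        (\<lambda>n. LINT x:S|torus_measure a b. (cmod (g1 x - torus_d1 a (\<phi> n) x))\<^sup>2) \<longlonglongrightarrow> 0 \<and>
        (\<lambda>n. LINT x:S|torus_measure a b. (cmod (g2 x - torus_d2 b (\<phi> n) x))\<^sup>2) \<longlonglongrightarrow> 0)"

datatype boundary_condition = Dirichlet | Neumann

fun form_domain_grad ::
  "boundary_condition \<Rightarrow> real \<Rightarrow> real \<Rightarrow> (complex \<times> complex) set \<Rightarrow>
   (complex \<times> complex \<Rightarrow> complex) \<Rightarrow> (complex \<times> complex \<Rightarrow> complex) \<Rightarrow>
   (complex \<times> complex \<Rightarrow> complex) \<Rightarrow> bool" where
  "form_domain_grad Dirichlet = H10_grad"
| "form_domain_grad Neumann = H1_grad"

text \<open>
  \<open>u\<close> is in the domain of the Laplacian and its image is \<open>f\<close>: this is the self-adjoint operator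
  associated with the Dirichlet form on \<open>H\<^sup>1\<^sub>0\<close> or \<open>H\<^sup>1\<close>. For Neumann the boundary condition is the
  natural one, encoded by testing against all of \<open>H\<^sup>1\<close>.
\<close>

definition has_laplacian ::
  "boundary_condition \<Rightarrow> real \<Rightarrow> real \<Rightarrow> (complex \<times> complex) set \<Rightarrow>
   (complex \<times> complex \<Rightarrow> complex) \<Rightarrow> (complex \<times> complex \<Rightarrow> complex) \<Rightarrow> bool" where
  "has_laplacian bc a b S u f \<longleftrightarrow>
     L2_on a b S f \<and>
     (\<exists>g1 g2. form_domain_grad bc a b S u g1 g2 \<and>
        (\<forall>v k1 k2. form_domain_grad bc a b S v k1 k2 \<longrightarrow>
           (LINT x:S|torus_measure a b. g1 x * cnj (k1 x) + g2 x * cnj (k2 x)) =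
             - (LINT x:S|torus_measure a b. f x * cnj (v x))))"

end

theory Submission imports Defs
begin

text \<open>
  Multiplying an eigenfunction by a cut-off that vanishes near the obstacle gives a function \<open>w\<close> on the whole
  torus, vanishing on the obstacle, with \<open>(\<Delta> + R\<^sup>2) w\<close> supported in \<open>V\<close>, whatever the boundary condition.
  Let \<open>\<phi>\<close> be a smooth weight that vanishes outside \<open>V\<close> and the obstacle and equals 1 on both the obstacle and
  the support of \<open>(\<Delta> + R\<^sup>2) w\<close>.

  For large \<open>R\<close> the function \<open>w\<close> lives near the circle of frequencies of radius \<open>R\<close>; cut it into pieces with
  frequencies close to \<open>R \<theta>\<close>, for finitely many directions \<open>\<theta>\<close>. On such a piece the equation makes \<open>\<bar>w\<bar>\<^sup>2\<close>
  nearly invariant under translation along \<open>\<theta>\<close>, so the weight \<open>\<phi>\<^sup>2\<close> may be replaced by its average along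
  \<open>\<theta>\<close>. For irrational \<open>\<theta>\<close> that average is a positive constant. For rational \<open>\<theta>\<close> it is positive on the closed
  geodesics that meet \<open>{\<phi> = 1}\<close>; cutting off to the remaining ones leaves an equation without source in the
  variable orthogonal to \<open>\<theta>\<close>, and a line of frequencies orthogonal to \<open>\<theta>\<close> meets the circle in at most two
  points. Two frequencies cannot concentrate away from the weight, because the Fourier coefficients of
  \<open>\<phi>\<^sup>2\<close> other than the zeroth are bounded away from it in modulus.

  For bounded \<open>R\<close>, the equation controls all but finitely many frequencies, and a trigonometric polynomial
  cannot vanish on the obstacle.
\<close>

text \<open>The gradient of an eigenfunction on \<open>V\<close> is not bounded by its size on
  \<open>V\<close> uniformly in \<open>R\<close>. The source produced by the cut-off is therefore
  kept in divergence form, div (F1, F2) + G, with F1, F2 and G bounded by the eigenfunction on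
  \<open>V\<close>, and every estimate has to afford one derivative. Transport along \<theta>
  affords it because it sees the source divided by R. The transverse step for rational \<theta> has
  no such gain; there the derivative disappears because the weight equals 1 on the support of F1 and
  F2, where the transverse cut-off vanishes, so that only a bounded commutator is left.

  The constants for one direction involve the small divisors \<open>fr j \<bullet> \<theta>\<close>
  and are not uniform in \<theta>. This does no harm: each direction controls a sector around
  itself, of a width of its own, and compactness of the circle then selects finitely many
  directions.\<close>

section \<open>Calculus of smooth functions\<close>

lemma Ck_Suc: "Ck (Suc k) f \<longleftrightarrow> (\<forall>x. f differentiable at x) \<and> (\<forall>v. Ck k (\<lambda>x. frechet_derivative f (at x) v))"
proof
  assume "Ck (Suc k) f"
  then obtain f' where f': "\<And>x. (f has_derivative f' x) (at x)" "\<And>v. Ck k (\<lambda>x. f' x v)" by auto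
  have "f' = (\<lambda>x. frechet_derivative f (at x))"
    using f'(1) by (auto intro!: ext simp: frechet_derivative_at[OF f'(1)])
  with f' show "(\<forall>x. f differentiable at x) \<and> (\<forall>v. Ck k (\<lambda>x. frechet_derivative f (at x) v))"
    by (auto simp: differentiable_def)
next
  assume "(\<forall>x. f differentiable at x) \<and> (\<forall>v. Ck k (\<lambda>x. frechet_derivative f (at x) v))"
  then show "Ck (Suc k) f"
    by (auto simp: frechet_derivative_works intro!: exI[of _ "\<lambda>x. frechet_derivative f (at x)"])
qed

lemma Ck_SucI:
  assumes "\<And>x. (f has_derivative f' x) (at x)" "\<And>v. Ck k (\<lambda>x. f' x v)"
  shows "Ck (Suc k) f"
  unfolding Ck.simps by (intro exI[of _ f'] conjI allI assms)

lemma Ck_SucD: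
  "Ck (Suc k) f \<Longrightarrow> \<exists>f'. (\<forall>x. (f has_derivative f' x) (at x)) \<and> (\<forall>v. Ck k (\<lambda>x. f' x v))"
  by simp

declare Ck.simps(2) [simp del]

lemma Ck_continuous: "Ck k f \<Longrightarrow> continuous_on UNIV f"
  by (cases k) (auto dest!: Ck_SucD intro!: continuous_at_imp_continuous_on dest: has_derivative_continuous)

lemma Ck_lower: "Ck (Suc k) f \<Longrightarrow> Ck k f"
proof (induction k arbitrary: f)
  case 0 then show ?case using Ck_continuous by auto
next
  case (Suc k)
  obtain f' where f': "\<And>x. (f has_derivative f' x) (at x)" "\<And>v. Ck (Suc k) (\<lambda>x. f' x v)"
    using Ck_SucD[OF Suc.prems] by blast
  show ?case by (rule Ck_SucI[OF f'(1) Suc.IH[OF f'(2)]])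
qed

lemma Ck_const: "Ck k (\<lambda>x. c)"
proof (induction k arbitrary: c)
  case (Suc k)
  show ?case by (rule Ck_SucI[where f'="\<lambda>x v. 0"]) (auto simp: Suc)
qed auto

lemma Ck_add: "Ck k f \<Longrightarrow> Ck k g \<Longrightarrow> Ck k (\<lambda>x. f x + g x)"
proof (induction k arbitrary: f g)
  case (Suc k)
  obtain f' where f': "\<And>x. (f has_derivative f' x) (at x)" "\<And>v. Ck k (\<lambda>x. f' x v)"
    using Ck_SucD[OF Suc.prems(1)] by blast
  obtain g' where g': "\<And>x. (g has_derivative g' x) (at x)" "\<And>v. Ck k (\<lambda>x. g' x v)"
    using Ck_SucD[OF Suc.prems(2)] by blast
  show ?case
    by (rule Ck_SucI[where f'="\<lambda>x v. f' x v + g' x v"])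
      (rule has_derivative_add[OF f'(1) g'(1)], rule Suc.IH[OF f'(2) g'(2)])
qed (auto intro: continuous_on_add)

lemma Ck_linear: 
  assumes L: "bounded_linear L" shows "Ck k f \<Longrightarrow> Ck k (\<lambda>x. L (f x))"
proof (induction k arbitrary: f)
  case 0
  then show ?case using bounded_linear.continuous_on[OF L] by auto
next
  case (Suc k)
  obtain f' where f': "\<And>x. (f has_derivative f' x) (at x)" "\<And>v. Ck k (\<lambda>x. f' x v)"
    using Ck_SucD[OF Suc.prems] by blast
  show ?case using f' Suc.IH
    by (intro Ck_SucI[where f'="\<lambda>x v. L (f' x v)"]) (auto intro!: bounded_linear.has_derivative[OF L])
qed

lemma Ck_mult:
  fixes f g :: "'a::euclidean_space \<Rightarrow> 'b::real_normed_algebra"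
  shows "Ck k f \<Longrightarrow> Ck k g \<Longrightarrow> Ck k (\<lambda>x. f x * g x)"
proof (induction k arbitrary: f g)
  case (Suc k)
  obtain f' where f': "\<And>x. (f has_derivative f' x) (at x)" "\<And>v. Ck k (\<lambda>x. f' x v)"
    using Ck_SucD[OF Suc.prems(1)] by blast
  obtain g' where g': "\<And>x. (g has_derivative g' x) (at x)" "\<And>v. Ck k (\<lambda>x. g' x v)"
    using Ck_SucD[OF Suc.prems(2)] by blast
  show ?case
  proof (rule Ck_SucI[where f'="\<lambda>x v. f x * g' x v + f' x v * g x"])
    show "((\<lambda>x. f x * g x) has_derivative (\<lambda>v. f x * g' x v + f' x v * g x)) (at x)" for x
      by (rule has_derivative_mult[OF f'(1) g'(1)])
    show "Ck k (\<lambda>x. f x * g' x v + f' x v * g x)" for v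
      by (rule Ck_add[OF Suc.IH[OF Ck_lower[OF Suc.prems(1)] g'(2)] Suc.IH[OF f'(2) Ck_lower[OF Suc.prems(2)]]])
  qed
qed (auto intro: continuous_on_mult)

lemma Ck_compose_real:
  fixes g :: "real \<Rightarrow> real" and q :: "'a::euclidean_space \<Rightarrow> real"
  shows "Ck k g \<Longrightarrow> Ck k q \<Longrightarrow> Ck k (\<lambda>x. g (q x))"
proof (induction k arbitrary: g)
  case 0 then show ?case by (auto intro: continuous_on_compose2)
next
  case (Suc k)
  obtain g' where g': "\<And>x. (g has_derivative g' x) (at x)" "\<And>v. Ck k (\<lambda>x. g' x v)"
    using Ck_SucD[OF Suc.prems(1)] by blast
  obtain q' where q': "\<And>x. (q has_derivative q' x) (at x)" "\<And>v. Ck k (\<lambda>x. q' x v)"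
    using Ck_SucD[OF Suc.prems(2)] by blast
  have lin: "g' x t = t * g' x 1" for x t
  proof -
    interpret bounded_linear "g' x" by (rule has_derivative_bounded_linear[OF g'(1)])
    show ?thesis using scaleR[of t 1] by simp
  qed
  show ?case
  proof (rule Ck_SucI[where f'="\<lambda>x v. q' x v * g' (q x) 1"])
    show "((\<lambda>x. g (q x)) has_derivative (\<lambda>v. q' x v * g' (q x) 1)) (at x)" for x
      using has_derivative_compose[OF q'(1) g'(1)] by (rule has_derivative_eq_rhs) (intro ext lin)
    show "Ck k (\<lambda>x. q' x v * g' (q x) 1)" for v
      by (rule Ck_mult[OF q'(2) Suc.IH[OF g'(2) Ck_lower[OF Suc.prems(2)]]])
  qed
qed

lemma smoothI: "(\<And>k. Ck k f) \<Longrightarrow> smooth f" by (auto simp: smooth_def)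
lemma smoothD: "smooth f \<Longrightarrow> Ck k f" by (auto simp: smooth_def)

lemma smooth_const [simp, intro]: "smooth (\<lambda>x. c)"
  by (simp add: smooth_def Ck_const)

lemma smooth_add [intro]: "smooth f \<Longrightarrow> smooth g \<Longrightarrow> smooth (\<lambda>x. f x + g x)"
  by (simp add: smooth_def Ck_add)

lemma smooth_linear: "bounded_linear L \<Longrightarrow> smooth f \<Longrightarrow> smooth (\<lambda>x. L (f x))"
  by (simp add: smooth_def Ck_linear)

lemma smooth_mult [intro]:
  fixes f g :: "'a::euclidean_space \<Rightarrow> 'b::real_normed_algebra"
  shows "smooth f \<Longrightarrow> smooth g \<Longrightarrow> smooth (\<lambda>x. f x * g x)"
  by (simp add: smooth_def Ck_mult)

lemma smooth_compose_real:
  fixes g :: "real \<Rightarrow> real" and q :: "'a::euclidean_space \<Rightarrow> real"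
  shows "smooth g \<Longrightarrow> smooth q \<Longrightarrow> smooth (\<lambda>x. g (q x))"
  by (simp add: smooth_def Ck_compose_real)

lemma smooth_uminus [intro]: "smooth f \<Longrightarrow> smooth (\<lambda>x. - f x)"
  by (rule smooth_linear[where L=uminus, OF bounded_linear_minus[OF bounded_linear_ident]])

lemma smooth_diff [intro]: "smooth f \<Longrightarrow> smooth g \<Longrightarrow> smooth (\<lambda>x. f x - g x)"
  using smooth_add[OF _ smooth_uminus, of f g] by simp

lemma smooth_sum [intro]: "(\<And>i. i \<in> I \<Longrightarrow> smooth (f i)) \<Longrightarrow> smooth (\<lambda>x. \<Sum>i\<in>I. f i x)"
proof (induction I rule: infinite_finite_induct)
  case (insert i I)
  have "smooth (\<lambda>x. f i x + (\<Sum>i\<in>I. f i x))"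
    using insert by (intro smooth_add) auto
  then show ?case using insert.hyps by simp
qed simp_all

lemma smooth_of_real [intro]: "smooth f \<Longrightarrow> smooth (\<lambda>x. complex_of_real (f x))"
  by (rule smooth_linear[where L=complex_of_real, OF bounded_linear_of_real])

lemma smooth_ident [simp, intro]: "smooth (\<lambda>x. x)"
proof (rule smoothI)
  fix k show "Ck k (\<lambda>x::'a. x)"
  proof (cases k)
    case (Suc n)
    show ?thesis unfolding Suc
      by (rule Ck_SucI[where f'="\<lambda>x v. v", OF has_derivative_ident Ck_const])
  qed simp
qed

lemma smooth_continuous: "smooth f \<Longrightarrow> continuous_on UNIV f"
  by (rule Ck_continuous[OF smoothD[of f 0]])

lemma smooth_differentiable: "smooth f \<Longrightarrow> f differentiable at x"
  using smoothD[of f "Suc 0"] by (simp add: Ck_Suc del: Ck.simps)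

lemma smooth_derivative:
  assumes "smooth f" shows "smooth (\<lambda>x. frechet_derivative f (at x) v)"
proof (rule smoothI)
  fix k
  from smoothD[OF assms, of "Suc k"] show "Ck k (\<lambda>x. frechet_derivative f (at x) v)"
    by (simp add: Ck_Suc del: Ck.simps)
qed

subsection \<open>A smooth step\<close>

text \<open>The powers of \<open>inverse t\<close> make the family closed under differentiation up
  to linear combinations, so that smoothness of exp(-1/t) at 0 becomes one induction over all
  \<open>n\<close>.\<close>

definition flat_exp :: "nat \<Rightarrow> real \<Rightarrow> real" where
  "flat_exp n t = (if t > 0 then exp (- inverse t) * inverse t ^ n else 0)"

text \<open>With y = 1/t, the quantity y^n / n! is a single term of the series of exp y.\<close>

lemma flat_exp_bound: "\<bar>flat_exp n t\<bar> \<le> fact n"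
proof (cases "t > 0")
  case True
  let ?y = "inverse t"
  have "(\<Sum>i\<in>{n}. ?y ^ i /\<^sub>R fact i) \<le> (\<Sum>i. ?y ^ i /\<^sub>R fact i)"
    using True by (intro sum_le_suminf summable_exp_generic) auto
  then have "?y ^ n / fact n \<le> exp ?y"
    by (simp add: exp_def divide_inverse mult.commute)
  then show ?thesis using True
    by (simp add: flat_exp_def exp_minus field_simps)
qed (simp add: flat_exp_def)

lemma flat_exp_has_derivative:
  "(flat_exp n has_real_derivative (flat_exp (n+2) t - n * flat_exp (n+1) t)) (at t)"
proof -
  consider "t > 0" | "t < 0" | "t = 0" by linarith
  then show ?thesis
  proof cases
    case 1
    define y where "y = inverse t"
    have "((\<lambda>t. exp (- inverse t) * inverse t ^ n) has_real_derivative
        exp (- y) * y\<^sup>2 * y ^ n + exp (- y) * (n * y ^ (n - 1) * (- y\<^sup>2))) (at t)"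
      using 1 unfolding y_def
      by (auto intro!: derivative_eq_intros simp: power2_eq_square)
    also have "exp (- y) * y\<^sup>2 * y ^ n + exp (- y) * (n * y ^ (n - 1) * (- y\<^sup>2)) =
        flat_exp (n+2) t - n * flat_exp (n+1) t"
      using 1 by (cases n) (simp_all add: flat_exp_def y_def[symmetric] power2_eq_square algebra_simps)
    finally have "((\<lambda>t. exp (- inverse t) * inverse t ^ n) has_real_derivative
        (flat_exp (n+2) t - n * flat_exp (n+1) t)) (at t)" .
    then show ?thesis
      by (rule has_field_derivative_transform_within_open[of _ _ _ "{0<..}"]) (use 1 in \<open>auto simp: flat_exp_def\<close>)
  next
    case 2
    have "((\<lambda>t. 0) has_real_derivative (flat_exp (n+2) t - n * flat_exp (n+1) t)) (at t)"
      using 2 by (simp add: flat_exp_def)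
    then show ?thesis
      by (rule has_field_derivative_transform_within_open[of _ _ _ "{..<0}"]) (use 2 in \<open>auto simp: flat_exp_def\<close>)
  next
    case 3
    \<comment> \<open>For h > 0 the difference quotient at 0 is \<open>h\<close> times the member of
      index \<open>n + 2\<close>, which is bounded; hence it tends to 0.\<close>
    have bound: "\<bar>flat_exp n h / h\<bar> \<le> fact (n + 2) * \<bar>h\<bar>" for h
    proof (cases "h > 0")
      case True
      have "flat_exp n h / h = h * flat_exp (n+2) h"
        using True by (simp add: flat_exp_def field_simps power2_eq_square)
      then show ?thesis using flat_exp_bound[of "n+2" h] True
        by (simp add: abs_mult mult.commute mult_right_mono)
    next
      case False
      have "0 \<le> fact (n + 2) * \<bar>h\<bar>" by (intro mult_nonneg_nonneg) auto
      then show ?thesis using False by (simp add: flat_exp_def del: fact_Suc)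
    qed
    have "(\<lambda>h. flat_exp n h / h) \<midarrow>0\<rightarrow> 0"
    proof (rule Lim_null_comparison)
      show "\<forall>\<^sub>F h in at 0. norm (flat_exp n h / h) \<le> fact (n + 2) * \<bar>h\<bar>"
        using bound by auto
      show "(\<lambda>h::real. fact (n + 2) * \<bar>h\<bar>) \<midarrow>0\<rightarrow> 0"
        by (auto intro!: tendsto_eq_intros)
    qed
    then show ?thesis using 3 by (simp add: DERIV_def flat_exp_def)
  qed
qed

lemma smooth_flat_exp: "smooth (flat_exp n)"
proof (rule smoothI)
  fix k show "Ck k (flat_exp n)"
  proof (induction k arbitrary: n)
    case 0
    show ?case
      using DERIV_isCont[OF flat_exp_has_derivative] by (simp add: continuous_at_imp_continuous_on)
  next
    case (Suc k)
    show ?case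
    proof (rule Ck_SucI)
      show "(flat_exp n has_derivative (\<lambda>v. (flat_exp (n+2) t - n * flat_exp (n+1) t) * v)) (at t)" for t
        using flat_exp_has_derivative[of n t] by (simp add: has_field_derivative_def)
      have "Ck k (\<lambda>t. flat_exp (n+2) t * v + (- n * v) * flat_exp (n+1) t)" for v :: real
        by (rule Ck_add[OF Ck_mult[OF Suc Ck_const] Ck_mult[OF Ck_const Suc]])
      then show "Ck k (\<lambda>t. (flat_exp (n+2) t - n * flat_exp (n+1) t) * v)" for v
        by (simp add: algebra_simps)
    qed
  qed
qed

text \<open>The flat function is composed with itself: \<open>flat_exp 0 (1 - t)\<close> is at least
  \<open>exp (-1)\<close> for t \<le> 0 and is 0 for t \<ge> 1. Only a constant is divided by, so
  smoothness follows from sums, products and compositions.\<close>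

definition step :: "real \<Rightarrow> real" where
  "step t = flat_exp 0 (exp (-1) - flat_exp 0 (1 - t)) / flat_exp 0 (exp (-1))"

lemma smooth_step: "smooth step"
proof -
  have 1: "smooth (\<lambda>t. flat_exp 0 (1 - t))"
    by (rule smooth_compose_real[OF smooth_flat_exp smooth_diff[OF smooth_const smooth_ident]])
  have "smooth (\<lambda>t. flat_exp 0 (exp (-1) - flat_exp 0 (1 - t)))"
    by (rule smooth_compose_real[OF smooth_flat_exp smooth_diff[OF smooth_const 1]])
  then have "smooth (\<lambda>t. flat_exp 0 (exp (-1) - flat_exp 0 (1 - t)) * inverse (flat_exp 0 (exp (-1))))"
    by (rule smooth_mult[OF _ smooth_const])
  then show ?thesis by (simp add: step_def[abs_def] divide_inverse)
qed

lemma flat_exp_0_mono: "s \<le> t \<Longrightarrow> flat_exp 0 s \<le> flat_exp 0 t"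
  by (auto simp: flat_exp_def le_imp_inverse_le)

lemma flat_exp_0_nonneg: "0 \<le> flat_exp 0 t" by (auto simp: flat_exp_def)

lemma step_0: "t \<le> 0 \<Longrightarrow> step t = 0"
proof -
  assume "t \<le> 0"
  then have "flat_exp 0 (1 - t) \<ge> flat_exp 0 1" by (intro flat_exp_0_mono) auto
  then show ?thesis by (auto simp: step_def flat_exp_def)
qed

lemma step_1: "t \<ge> 1 \<Longrightarrow> step t = 1"
  by (auto simp: step_def flat_exp_def)

lemma step_range: "0 \<le> step t" "step t \<le> 1"
proof -
  have "flat_exp 0 (exp (-1)) > 0" by (auto simp: flat_exp_def)
  moreover have "flat_exp 0 (exp (-1) - flat_exp 0 (1 - t)) \<le> flat_exp 0 (exp (-1))"
    by (intro flat_exp_0_mono) (simp add: flat_exp_0_nonneg)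
  ultimately show "0 \<le> step t" "step t \<le> 1" by (auto simp: step_def flat_exp_0_nonneg divide_simps)
qed

section \<open>Directional derivatives\<close>

definition D :: "'a::euclidean_space \<Rightarrow> ('a \<Rightarrow> 'b::real_normed_vector) \<Rightarrow> 'a \<Rightarrow> 'b" where
  "D v f x = frechet_derivative f (at x) v"

lemma D_eqI: "(f has_derivative f') (at x) \<Longrightarrow> D v f x = f' v"
  unfolding D_def by (metis frechet_derivative_at)

lemma smooth_D_eq: "smooth f \<Longrightarrow> (f has_derivative (\<lambda>v. D v f x)) (at x)"
  unfolding D_def using smooth_differentiable frechet_derivative_works by blast

lemma smooth_D: "smooth f \<Longrightarrow> smooth (D v f)"
  using smooth_derivative[of f v] by (simp add: D_def[abs_def])

lemma D_mult:
  fixes f g :: "'a::euclidean_space \<Rightarrow> complex"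
  assumes "smooth f" "smooth g"
  shows "D v (\<lambda>x. f x * g x) x = D v f x * g x + f x * D v g x"
  by (rule D_eqI[THEN trans, OF has_derivative_mult[OF smooth_D_eq smooth_D_eq]])
    (use assms in \<open>auto simp: algebra_simps\<close>)

lemma D_linear:
  assumes "bounded_linear L" "smooth f"
  shows "D v (\<lambda>x. L (f x)) x = L (D v f x)"
  by (rule D_eqI[OF bounded_linear.has_derivative[OF assms(1) smooth_D_eq[OF assms(2)]]])

lemma D_add:
  assumes "smooth f" "smooth g"
  shows "D v (\<lambda>x. f x + g x) x = D v f x + D v g x"
  by (rule D_eqI[OF has_derivative_add[OF smooth_D_eq smooth_D_eq]]) (use assms in auto)

lemma D_vec_linear: "smooth f \<Longrightarrow> linear (\<lambda>v. D v f x)"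
  using smooth_D_eq has_derivative_linear by blast

lemma D_zero_open:
  assumes "open U" "x \<in> U" "\<And>y. y \<in> U \<Longrightarrow> f y = c"
  shows "D v f x = 0"
proof -
  have "((\<lambda>_. c) has_derivative (\<lambda>_. 0)) (at x)" by simp
  then have "(f has_derivative (\<lambda>_. 0)) (at x)"
    by (rule has_derivative_transform_within_open[OF _ assms(1,2)]) (simp add: assms(3))
  then show ?thesis by (rule D_eqI)
qed

lemma has_vector_derivative_line:
  assumes "smooth f"
  shows "((\<lambda>t. f (x + t *\<^sub>R v)) has_vector_derivative D v f (x + t *\<^sub>R v)) (at t within T)"
proof -
  have 1: "((\<lambda>t. x + t *\<^sub>R v) has_derivative (\<lambda>t. t *\<^sub>R v)) (at t within T)"
    by (auto intro!: derivative_eq_intros)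
  have "((\<lambda>t. f (x + t *\<^sub>R v)) has_derivative (\<lambda>s. D (s *\<^sub>R v) f (x + t *\<^sub>R v))) (at t within T)"
    by (rule has_derivative_compose[OF 1 smooth_D_eq[OF assms]])
  moreover have "D (s *\<^sub>R v) f y = s *\<^sub>R D v f y" for s y
    by (rule linear_scale[OF D_vec_linear[OF assms]])
  ultimately show ?thesis by (simp add: has_vector_derivative_def)
qed

subsection \<open>Fourier coefficients on the torus\<close>

locale torus =
  fixes a b :: real
  assumes a_pos: "a > 0" and b_pos: "b > 0"
begin

abbreviation proj :: "real \<times> real \<Rightarrow> complex \<times> complex" where "proj \<equiv> torus_proj a b"

text \<open>Closed, so that integrals of continuous functions are Henstock-Kurzweil integrals over a
  \<open>cbox\<close>. The half-open cell, on which the covering is injective, differs from it by a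
  null set.\<close>

definition cell :: "(real \<times> real) set" where "cell = cbox (0, 0) (2 * pi * a, 2 * pi * b)"

definition area :: real where "area = (2 * pi * a) * (2 * pi * b)"

text \<open>Total mass one makes the characters \<open>e k\<close> orthonormal. The measure lives on
  the plane, so that functions on the torus are treated as periodic functions with the derivatives
  of the plane.\<close>

definition M :: "(real \<times> real) measure" where
  "M = density lborel (\<lambda>x. ennreal (indicator cell x / area))"

text \<open>Stated through the fibres of the covering, so that the periodic functions are exactly
  those that descend to the torus.\<close>

definition periodic :: "(real \<times> real \<Rightarrow> 'c) \<Rightarrow> bool" where
  "periodic f \<longleftrightarrow> (\<forall>p q. proj p = proj q \<longrightarrow> f p = f q)"

text \<open>The lattice dual to the periods: \<open>fr k\<close> is the frequency vector of the
  character \<open>e k\<close>, an eigenfunction of minus the Laplacian with eigenvalue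
  \<open>(norm (fr k))\<^sup>2\<close>.\<close>

definition fr :: "int \<times> int \<Rightarrow> real \<times> real" where
  "fr k = (of_int (fst k) / a, of_int (snd k) / b)"

definition e :: "int \<times> int \<Rightarrow> real \<times> real \<Rightarrow> complex" where
  "e k x = cis (fr k \<bullet> x)"

lemma periodicD: "periodic f \<Longrightarrow> proj p = proj q \<Longrightarrow> f p = f q"
  unfolding periodic_def by blast

lemma area_pos: "area > 0" using a_pos b_pos by (simp add: area_def)

lemma sets_M [simp, measurable_cong]: "sets M = sets borel" by (simp add: M_def)
lemma space_M [simp]: "space M = UNIV" by (simp add: M_def)

lemma cell_measurable [measurable]: "cell \<in> sets borel" by (simp add: cell_def)

lemma measure_cell: "emeasure lborel cell = ennreal area"
proof -
  have "measure lborel cell = area"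
    using a_pos b_pos by (simp add: cell_def area_def content_Pair)
  moreover have "emeasure lborel cell = ennreal (measure lborel cell)"
    by (rule emeasure_eq_ennreal_measure) (simp add: cell_def emeasure_lborel_cbox_eq)
  ultimately show ?thesis by simp
qed

lemma emeasure_M_UNIV: "emeasure M UNIV = 1"
proof -
  have "emeasure M UNIV = (\<integral>\<^sup>+x. ennreal (1 / area) * indicator cell x \<partial>lborel)"
    unfolding M_def by (subst emeasure_density)
      (auto intro!: nn_integral_cong split: split_indicator)
  also have "\<dots> = ennreal (1 / area) * ennreal area"
    by (subst nn_integral_cmult_indicator) (simp_all add: measure_cell)
  also have "\<dots> = 1" using area_pos by (simp add: ennreal_mult[symmetric])
  finally show ?thesis .
qed

lemma finite_measure_M: "finite_measure M"
  by (rule finite_measureI) (simp add: emeasure_M_UNIV)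

lemma measure_M_UNIV: "measure M UNIV = 1" by (simp add: measure_def emeasure_M_UNIV)

lemma integral_M:
  fixes f :: "real \<times> real \<Rightarrow> 'c :: {banach, second_countable_topology}"
  assumes "f \<in> borel_measurable borel"
  shows "(LINT x|M. f x) = (1 / area) *\<^sub>R (LINT x|lborel. indicator cell x *\<^sub>R f x)"
proof -
  have "(LINT x|M. f x) = (LINT x|lborel. (indicator cell x / area) *\<^sub>R f x)"
    unfolding M_def using assms area_pos by (intro integral_density) auto
  also have "\<dots> = (LINT x|lborel. (1 / area) *\<^sub>R (indicator cell x *\<^sub>R f x))"
    by (intro Bochner_Integration.integral_cong refl) (simp add: scaleR_scaleR)
  finally show ?thesis by (simp only: integral_scaleR_right)
qed

lemma integrable_M:
  fixes f :: "real \<times> real \<Rightarrow> 'c :: {banach, second_countable_topology}"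
  assumes "f \<in> borel_measurable borel"
  shows "integrable M f \<longleftrightarrow> integrable lborel (\<lambda>x. indicator cell x *\<^sub>R f x)"
proof -
  have "integrable M f \<longleftrightarrow> integrable lborel (\<lambda>x. (indicator cell x / area) *\<^sub>R f x)"
    unfolding M_def using assms area_pos by (intro integrable_density) auto
  also have "\<dots> \<longleftrightarrow> integrable lborel (\<lambda>x. (1 / area) *\<^sub>R (indicator cell x *\<^sub>R f x))"
    by (intro Bochner_Integration.integrable_cong refl) (simp add: scaleR_scaleR)
  also have "\<dots> \<longleftrightarrow> integrable lborel (\<lambda>x. indicator cell x *\<^sub>R f x)"
  proof
    assume "integrable lborel (\<lambda>x. (1 / area) *\<^sub>R (indicator cell x *\<^sub>R f x))"
    from integrable_scaleR_right[OF this, of area]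
    show "integrable lborel (\<lambda>x. indicator cell x *\<^sub>R f x)" using area_pos by simp
  qed (rule integrable_scaleR_right)
  finally show ?thesis .
qed

lemma integral_M_continuous:
  fixes f :: "real \<times> real \<Rightarrow> 'c :: euclidean_space"
  assumes "continuous_on UNIV f"
  shows "(LINT x|M. f x) = (1 / area) *\<^sub>R integral cell f"
proof -
  have "integrable lborel (\<lambda>x. indicator cell x *\<^sub>R f x)"
    unfolding cell_def
    by (rule borel_integrable_compact) (auto intro: continuous_on_subset[OF assms])
  then have "(LINT x|lborel. indicator cell x *\<^sub>R f x) = integral cell f"
    using set_borel_integral_eq_integral(2)[of cell f]
    by (simp add: set_integrable_def set_lebesgue_integral_def)
  moreover have "f \<in> borel_measurable borel"
    using assms by (simp add: borel_measurable_continuous_onI)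
  ultimately show ?thesis by (simp add: integral_M)
qed

lemma proj_shift: "proj (x + 2 * pi * a, y) = proj (x, y)" "proj (x, y + 2 * pi * b) = proj (x, y)"
proof -
  have "(x + 2 * pi * a) / a = x / a + 2 * pi" "(y + 2 * pi * b) / b = y / b + 2 * pi"
    using a_pos b_pos by (auto simp: field_simps)
  then show "proj (x + 2 * pi * a, y) = proj (x, y)" "proj (x, y + 2 * pi * b) = proj (x, y)"
    by (simp_all add: torus_proj_def cis_mult[symmetric])
qed

text \<open>Integrated first along the direction of differentiation, the derivative leaves only a
  boundary term, which periodicity cancels.\<close>

lemma integral_D_axis:
  fixes f :: "real \<times> real \<Rightarrow> complex"
  assumes f: "smooth f" "periodic f" and v: "v = (1, 0) \<or> v = (0, 1)"
  shows "(LINT x|M. D v f x) = 0"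
proof -
  have c: "continuous_on UNIV (D v f)" using smooth_continuous[OF smooth_D[OF f(1)]] .
  have c': "continuous_on S (\<lambda>(x, y). D v f (x, y))" for S
    using continuous_on_subset[OF c] by simp
  have split: "integral cell (D v f) =
      integral {0..2 * pi * a} (\<lambda>x. integral {0..2 * pi * b} (\<lambda>y. D v f (x, y)))"
    unfolding cell_def using integral_prod_continuous[of 0 0 "2 * pi * a" "2 * pi * b" "D v f"]
      continuous_on_subset[OF c] by simp
  have "integral cell (D v f) = 0"
    using v
  proof
    assume v: "v = (1, 0)"
    have "((\<lambda>x. D v f (x, y)) has_integral (f (2 * pi * a, y) - f (0, y))) {0..2 * pi * a}" for y
    proof (rule fundamental_theorem_of_calculus)
      fix t assume "t \<in> {0..2 * pi * a}"
      show "((\<lambda>x. f (x, y)) has_vector_derivative D v f (t, y)) (at t within {0..2 * pi * a})"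
        using has_vector_derivative_line[OF f(1), of "(0, y)" v t] v by simp
    qed (use a_pos in auto)
    moreover have "f (2 * pi * a, y) = f (0, y)" for y
      by (rule periodicD[OF f(2)]) (use proj_shift(1)[of 0 y] in simp)
    ultimately have 1: "integral {0..2 * pi * a} (\<lambda>x. D v f (x, y)) = 0" for y
      by (simp add: integral_unique)
    have "integral cell (D v f) =
        integral {0..2 * pi * b} (\<lambda>y. integral {0..2 * pi * a} (\<lambda>x. D v f (x, y)))"
      unfolding split
      using integral_swap_continuous[of 0 0 "2 * pi * a" "2 * pi * b" "\<lambda>x y. D v f (x, y)"] c' by simp
    then show ?thesis by (simp add: 1)
  next
    assume v: "v = (0, 1)"
    have "((\<lambda>y. D v f (x, y)) has_integral (f (x, 2 * pi * b) - f (x, 0))) {0..2 * pi * b}" for x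
    proof (rule fundamental_theorem_of_calculus)
      fix t assume "t \<in> {0..2 * pi * b}"
      show "((\<lambda>y. f (x, y)) has_vector_derivative D v f (x, t)) (at t within {0..2 * pi * b})"
        using has_vector_derivative_line[OF f(1), of "(x, 0)" v t] v by simp
    qed (use b_pos in auto)
    moreover have "f (x, 2 * pi * b) = f (x, 0)" for x
      by (rule periodicD[OF f(2)]) (use proj_shift(2)[of x 0] in simp)
    ultimately have 1: "integral {0..2 * pi * b} (\<lambda>y. D v f (x, y)) = 0" for x
      by (simp add: integral_unique)
    show ?thesis unfolding split by (simp add: 1)
  qed
  then show ?thesis by (simp add: integral_M_continuous[OF c])
qed

lemma integrable_smooth:
  fixes f :: "real \<times> real \<Rightarrow> 'c :: euclidean_space"
  assumes "continuous_on UNIV f" shows "integrable M f"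
proof -
  have "f \<in> borel_measurable borel" using assms by (simp add: borel_measurable_continuous_onI)
  moreover have "integrable lborel (\<lambda>x. indicator cell x *\<^sub>R f x)"
    unfolding cell_def
    by (rule borel_integrable_compact) (auto intro: continuous_on_subset[OF assms])
  ultimately show ?thesis by (simp add: integrable_M)
qed

lemma integral_D:
  fixes f :: "real \<times> real \<Rightarrow> complex"
  assumes f: "smooth f" "periodic f"
  shows "(LINT x|M. D v f x) = 0"
proof -
  have "D v f x = fst v *\<^sub>R D (1, 0) f x + snd v *\<^sub>R D (0, 1) f x" for x
  proof -
    interpret linear "\<lambda>v. D v f x" by (rule D_vec_linear[OF f(1)])
    have "fst v *\<^sub>R (1, 0) + snd v *\<^sub>R (0, 1) = v" by (cases v) simp
    from arg_cong[OF this, of "\<lambda>v. D v f x"] show ?thesis by (simp only: add scale)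
  qed
  moreover have "integrable M (D w f)" for w
    by (rule integrable_smooth[OF smooth_continuous[OF smooth_D[OF f(1)]]])
  ultimately show ?thesis
    by (simp add: integral_D_axis[OF f])
qed

lemma periodic_D:
  assumes "smooth f" "periodic f" shows "periodic (D v f)"
  unfolding periodic_def
proof (intro allI impI)
  fix p q assume pq: "proj p = proj q"
  have "proj (p + t *\<^sub>R v) = proj (q + t *\<^sub>R v)" for t
    using pq by (auto simp: torus_proj_def add_divide_distrib cis_mult[symmetric])
  then have "(\<lambda>t. f (p + t *\<^sub>R v)) = (\<lambda>t. f (q + t *\<^sub>R v))"
    by (intro ext periodicD[OF assms(2)])
  then show "D v f p = D v f q"
    using has_vector_derivative_line[OF assms(1), of p v 0 UNIV]
      has_vector_derivative_line[OF assms(1), of q v 0 UNIV]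
    by (simp add: vector_derivative_unique_at)
qed

lemma e_0 [simp]: "e 0 x = 1" by (simp add: e_def fr_def zero_prod_def[symmetric])
lemma fr_add: "fr (k + l) = fr k + fr l" by (simp add: fr_def add_divide_distrib)
lemma fr_diff: "fr (k - l) = fr k - fr l" by (simp add: fr_def diff_divide_distrib)
lemma fr_uminus: "fr (- k) = - fr k" by (simp add: fr_def)
lemma fr_0 [simp]: "fr 0 = 0" by (simp add: fr_def zero_prod_def)
lemma e_add: "e (k + l) x = e k x * e l x" by (simp add: e_def fr_add inner_add_left cis_mult)
lemma cnj_e: "cnj (e k x) = e (- k) x" by (simp add: e_def fr_uminus cis_cnj)
lemma norm_e [simp]: "cmod (e k x) = 1" by (simp add: e_def)

lemma e_powi: "e k p = cis (fst p / a) powi fst k * cis (snd p / b) powi snd k"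
  by (simp add: e_def fr_def cis_power_int cis_mult inner_prod_def mult.commute)

lemma periodic_e: "periodic (e k)"
  unfolding periodic_def
proof (intro allI impI)
  fix p q assume "proj p = proj q"
  then have "cis (fst p / a) = cis (fst q / a)" "cis (snd p / b) = cis (snd q / b)"
    using a_pos b_pos by (auto simp: torus_proj_def)
  then show "e k p = e k q" by (simp add: e_powi)
qed

lemma e_has_derivative: "(e k has_derivative (\<lambda>v. \<i> * of_real (fr k \<bullet> v) * e k x)) (at x)"
proof -
  have 1: "((\<lambda>x. fr k \<bullet> x) has_derivative (\<lambda>v. fr k \<bullet> v)) (at x)"
    by (intro derivative_intros)
  from has_derivative_cis[OF 1]
  show ?thesis by (simp add: e_def[abs_def] scaleR_conv_of_real mult_ac)
qed

lemma D_e: "D v (e k) x = \<i> * of_real (fr k \<bullet> v) * e k x"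
  by (rule D_eqI[OF e_has_derivative])

lemma smooth_e: "smooth (e k)"
proof (rule smoothI)
  fix n show "Ck n (e k)"
  proof (induction n)
    case 0
    show ?case by (simp add: e_def[abs_def]) (intro continuous_intros)
  next
    case (Suc n)
    show ?case by (rule Ck_SucI[OF e_has_derivative Ck_mult[OF Ck_const Suc]])
  qed
qed

lemma fr_eq_0_iff: "fr k = 0 \<longleftrightarrow> k = 0"
  using a_pos b_pos by (cases k) (auto simp: fr_def zero_prod_def)

lemma integral_e: "(LINT x|M. e k x) = (if k = 0 then 1 else 0)"
proof (cases "k = 0")
  case False
  then have "fr k \<noteq> 0" using fr_eq_0_iff by simp
  \<comment> \<open>Differentiation along its own frequency multiplies \<open>e k\<close> by i times
    \<open>fr k \<bullet> fr k\<close>, which is not 0.\<close>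
  have "(LINT x|M. D (fr k) (e k) x) = 0" by (rule integral_D[OF smooth_e periodic_e])
  then have "\<i> * of_real (fr k \<bullet> fr k) * (LINT x|M. e k x) = 0" by (simp only: D_e integral_mult_right_zero)
  then show ?thesis using \<open>fr k \<noteq> 0\<close> False by simp
qed (simp add: measure_M_UNIV)

definition fc :: "(real \<times> real \<Rightarrow> complex) \<Rightarrow> int \<times> int \<Rightarrow> complex" where
  "fc f k = (LINT x|M. f x * e (- k) x)"

lemma periodic_mult: "periodic f \<Longrightarrow> periodic g \<Longrightarrow> periodic (\<lambda>x. f x * g x)"
  unfolding periodic_def by (intro allI impI arg_cong2[where f=times]) blast+

lemma periodic_comp: "periodic f \<Longrightarrow> periodic (\<lambda>x. g (f x))"
  unfolding periodic_def by (intro allI impI arg_cong[where f=g]) blast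

lemma fc_D:
  assumes f: "smooth f" "periodic f"
  shows "fc (D v f) k = \<i> * of_real (fr k \<bullet> v) * fc f k"
proof -
  have "(LINT x|M. D v (\<lambda>x. f x * e (- k) x) x) = 0"
    by (rule integral_D[OF smooth_mult[OF f(1) smooth_e] periodic_mult[OF f(2) periodic_e]])
  then have "(LINT x|M. D v f x * e (-k) x - (\<i> * of_real (fr k \<bullet> v)) * (f x * e (- k) x)) = 0"
    by (simp add: D_mult[OF f(1) smooth_e] D_e fr_uminus mult_ac)
  moreover have "integrable M (\<lambda>x. D v f x * e (-k) x)" "integrable M (\<lambda>x. f x * e (- k) x)"
    by (rule integrable_smooth[OF smooth_continuous[OF smooth_mult[OF _ smooth_e]]], use f smooth_D in blast)+
  ultimately show ?thesis unfolding fc_def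
    by (simp add: Bochner_Integration.integral_diff)
qed

subsection \<open>Square-integrable functions\<close>

lemma measurable_M [simp]: "borel_measurable M = borel_measurable borel"
  by (rule measurable_cong_sets) simp_all

definition L2 :: "(real \<times> real \<Rightarrow> complex) \<Rightarrow> bool" where
  "L2 f \<longleftrightarrow> f \<in> borel_measurable borel \<and> integrable M (\<lambda>x. (cmod (f x))\<^sup>2)"

text \<open>The square of the L2 norm: Parseval and the final estimate are linear in it. Where the
  triangle inequality is wanted, \<open>sqrt (nrm f)\<close> is used.\<close>

definition nrm :: "(real \<times> real \<Rightarrow> complex) \<Rightarrow> real" where
  "nrm f = (LINT x|M. (cmod (f x))\<^sup>2)"

lemma L2_measurable: "L2 f \<Longrightarrow> f \<in> borel_measurable borel" by (simp add: L2_def)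
lemma L2_integrable: "L2 f \<Longrightarrow> integrable M (\<lambda>x. (cmod (f x))\<^sup>2)" by (simp add: L2_def)

lemma nrm_nonneg [simp]: "0 \<le> nrm f" by (simp add: nrm_def)

lemma L2_mono:
  assumes "integrable M g" "f \<in> borel_measurable borel" "\<And>x. (cmod (f x))\<^sup>2 \<le> g x"
  shows "L2 f" "nrm f \<le> (LINT x|M. g x)"
proof -
  have [measurable]: "f \<in> borel_measurable borel" by fact
  have "integrable M (\<lambda>x. (cmod (f x))\<^sup>2)"
    by (rule Bochner_Integration.integrable_bound[OF assms(1)])
      (simp, rule AE_I2, simp only: real_norm_def abs_power2 order_trans[OF assms(3) abs_ge_self])
  then show "L2 f" by (simp add: L2_def)
  then show "nrm f \<le> (LINT x|M. g x)"
    unfolding nrm_def by (intro integral_mono L2_integrable assms)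
qed

lemma L2_nrm_mono:
  assumes "L2 g" "f \<in> borel_measurable borel" "\<And>x. cmod (f x) \<le> B * cmod (g x)"
  shows "L2 f" "nrm f \<le> B\<^sup>2 * nrm g"
proof -
  have sq: "(cmod (f x))\<^sup>2 \<le> B\<^sup>2 * (cmod (g x))\<^sup>2" for x
    using power_mono[OF assms(3)[of x], of 2] by (simp add: power_mult_distrib)
  have i: "integrable M (\<lambda>x. B\<^sup>2 * (cmod (g x))\<^sup>2)" using L2_integrable[OF assms(1)] by simp
  show "L2 f" by (rule L2_mono(1)[OF i assms(2) sq])
  show "nrm f \<le> B\<^sup>2 * nrm g"
    using L2_mono(2)[OF i assms(2) sq] by (simp add: nrm_def)
qed

lemma L2_continuous: "continuous_on UNIV f \<Longrightarrow> L2 f"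
  unfolding L2_def by (auto intro!: integrable_smooth borel_measurable_continuous_onI continuous_intros)

lemma L2_smooth: "smooth f \<Longrightarrow> L2 f"
  by (rule L2_continuous[OF smooth_continuous])

lemma L2_e: "L2 (e k)" by (rule L2_smooth[OF smooth_e])

lemma e_measurable [measurable]: "e k \<in> borel_measurable borel" using L2_e L2_measurable by blast

lemma L2_mult_bounded:
  assumes "L2 f" "g \<in> borel_measurable borel" "\<And>x. cmod (g x) \<le> B"
  shows "L2 (\<lambda>x. g x * f x)" "nrm (\<lambda>x. g x * f x) \<le> B\<^sup>2 * nrm f"
proof -
  have [measurable]: "f \<in> borel_measurable borel" "g \<in> borel_measurable borel"
    using assms L2_measurable by auto
  have 1: "cmod (g x * f x) \<le> B * cmod (f x)" for x
    using assms(3) by (simp add: norm_mult mult_right_mono)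
  show "L2 (\<lambda>x. g x * f x)" "nrm (\<lambda>x. g x * f x) \<le> B\<^sup>2 * nrm f"
    by (rule L2_nrm_mono[OF assms(1) _ 1]; measurable)+
qed

lemma L2_e_mult: "L2 f \<Longrightarrow> L2 (\<lambda>x. e k x * f x)"
  using L2_mult_bounded(1)[of f "e k" 1] by simp

lemma nrm_e_mult: "nrm (\<lambda>x. e k x * f x) = nrm f"
  by (simp add: nrm_def norm_mult)

lemma L2_cmult: "L2 f \<Longrightarrow> L2 (\<lambda>x. c * f x)"
  using L2_mult_bounded(1)[of f "\<lambda>_. c" "cmod c"] by simp

lemma nrm_cmult: "nrm (\<lambda>x. c * f x) = (cmod c)\<^sup>2 * nrm f"
  by (simp add: nrm_def norm_mult power_mult_distrib)

text \<open>Expand the square and bound the cross term by Young's inequality with a free weight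
  \<open>t\<close>. Taking \<open>t = 1\<close> gives the crude bound with factors 2, and optimising
  \<open>t\<close> gives Minkowski's inequality.\<close>

lemma nrm_weighted:
  assumes "L2 f" "L2 g" "t > 0"
  shows "L2 (\<lambda>x. f x + g x)" "nrm (\<lambda>x. f x + g x) \<le> (1 + t) * nrm f + (1 + 1 / t) * nrm g"
proof -
  have [measurable]: "f \<in> borel_measurable borel" "g \<in> borel_measurable borel"
    using assms L2_measurable by auto
  have sq: "(cmod (f x + g x))\<^sup>2 \<le> (1 + t) * (cmod (f x))\<^sup>2 + (1 + 1 / t) * (cmod (g x))\<^sup>2" for x
  proof -
    let ?a = "cmod (f x)" and ?b = "cmod (g x)"
    have "(cmod (f x + g x))\<^sup>2 \<le> (?a + ?b)\<^sup>2" by (intro power_mono norm_triangle_ineq) auto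
    also have "\<dots> \<le> (1 + t) * ?a\<^sup>2 + (1 + 1 / t) * ?b\<^sup>2"
    proof -
      have "0 \<le> (t * ?a - ?b)\<^sup>2 / t" using assms(3) by simp
      also have "\<dots> = (1 + t) * ?a\<^sup>2 + (1 + 1 / t) * ?b\<^sup>2 - (?a + ?b)\<^sup>2"
        using assms(3) by (simp add: field_simps power2_eq_square)
      finally show ?thesis by simp
    qed
    finally show ?thesis .
  qed
  have i: "integrable M (\<lambda>x. (1 + t) * (cmod (f x))\<^sup>2 + (1 + 1 / t) * (cmod (g x))\<^sup>2)"
    using L2_integrable[OF assms(1)] L2_integrable[OF assms(2)] by simp
  show "L2 (\<lambda>x. f x + g x)" by (rule L2_mono(1)[OF i _ sq]) measurable
  have "nrm (\<lambda>x. f x + g x) \<le> (LINT x|M. (1 + t) * (cmod (f x))\<^sup>2 + (1 + 1 / t) * (cmod (g x))\<^sup>2)"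
    by (rule L2_mono(2)[OF i _ sq]) measurable
  also have "\<dots> = (1 + t) * nrm f + (1 + 1 / t) * nrm g"
    unfolding nrm_def using L2_integrable[OF assms(1)] L2_integrable[OF assms(2)] by simp
  finally show "nrm (\<lambda>x. f x + g x) \<le> (1 + t) * nrm f + (1 + 1 / t) * nrm g" .
qed

lemma L2_add: "L2 f \<Longrightarrow> L2 g \<Longrightarrow> L2 (\<lambda>x. f x + g x)"
  by (rule nrm_weighted(1)[of _ _ 1]) simp_all

lemma L2_uminus: "L2 f \<Longrightarrow> L2 (\<lambda>x. - f x)"
  using L2_cmult[of f "-1"] by simp

lemma L2_diff: "L2 f \<Longrightarrow> L2 g \<Longrightarrow> L2 (\<lambda>x. f x - g x)"
  using L2_add[OF _ L2_uminus, of f g] by simp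

lemma L2_0: "L2 (\<lambda>x. 0)" by (simp add: L2_def)

lemma L2_sum: "(\<And>i. i \<in> I \<Longrightarrow> L2 (f i)) \<Longrightarrow> L2 (\<lambda>x. \<Sum>i\<in>I. f i x)"
proof (induction I rule: infinite_finite_induct)
  case (insert i I)
  have "L2 (\<lambda>x. f i x + (\<Sum>i\<in>I. f i x))"
    using insert by (intro L2_add) auto
  then show ?case using insert.hyps by simp
qed (simp_all add: L2_0)

lemma nrm_add_le: "L2 f \<Longrightarrow> L2 g \<Longrightarrow> nrm (\<lambda>x. f x + g x) \<le> 2 * nrm f + 2 * nrm g"
  using nrm_weighted(2)[of f g 1] by simp

lemma nrm_uminus: "nrm (\<lambda>x. - f x) = nrm f" by (simp add: nrm_def)

lemma sqrt_nrm_add: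
  assumes "L2 f" "L2 g"
  shows "sqrt (nrm (\<lambda>x. f x + g x)) \<le> sqrt (nrm f) + sqrt (nrm g)"
proof (rule field_le_epsilon)
  fix d :: real assume d: "d > 0"
  \<comment> \<open>The norms are enlarged by d/2 to make them positive, so that the optimal weight
    B/A exists; with it the right side of \<open>nrm_weighted\<close> collapses to (A +
    B)^2.\<close>
  let ?A = "sqrt (nrm f) + d / 2" and ?B = "sqrt (nrm g) + d / 2"
  have pos: "?A > 0" "?B > 0" using d by (auto intro: add_nonneg_pos)
  have "nrm f \<le> ?A\<^sup>2" "nrm g \<le> ?B\<^sup>2"
    using d by (auto simp: power2_sum)
  moreover have "nrm (\<lambda>x. f x + g x) \<le> (1 + ?B / ?A) * nrm f + (1 + 1 / (?B / ?A)) * nrm g"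
    using pos by (intro nrm_weighted(2)[OF assms]) simp
  ultimately have "nrm (\<lambda>x. f x + g x) \<le> (1 + ?B / ?A) * ?A\<^sup>2 + (1 + 1 / (?B / ?A)) * ?B\<^sup>2"
    using pos by (smt (verit) divide_pos_pos mult_left_mono zero_less_divide_1_iff)
  also have "\<dots> = (?A + ?B)\<^sup>2"
  proof -
    have "(1 + B / A) * A\<^sup>2 + (1 + 1 / (B / A)) * B\<^sup>2 = (A + B)\<^sup>2" if "A > 0" "B > 0" for A B :: real
      using that by (simp add: field_simps power2_eq_square)
    from this[OF pos] show ?thesis .
  qed
  finally have "sqrt (nrm (\<lambda>x. f x + g x)) \<le> ?A + ?B"
    using pos by (intro real_le_lsqrt) auto
  then show "sqrt (nrm (\<lambda>x. f x + g x)) \<le> sqrt (nrm f) + sqrt (nrm g) + d" by simp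
qed

lemma sqrt_nrm_sum:
  "(\<And>i. i \<in> I \<Longrightarrow> L2 (f i)) \<Longrightarrow> sqrt (nrm (\<lambda>x. \<Sum>i\<in>I. f i x)) \<le> (\<Sum>i\<in>I. sqrt (nrm (f i)))"
proof (induction I rule: infinite_finite_induct)
  case (insert i I)
  have "sqrt (nrm (\<lambda>x. f i x + (\<Sum>i\<in>I. f i x))) \<le> sqrt (nrm (f i)) + sqrt (nrm (\<lambda>x. \<Sum>i\<in>I. f i x))"
    using insert by (intro sqrt_nrm_add L2_sum) auto
  with insert show ?case by force
qed (simp_all add: nrm_def)

lemma integrable_L2_mult:
  assumes "L2 f" "L2 g" shows "integrable M (\<lambda>x. f x * g x)"
proof (rule Bochner_Integration.integrable_bound)
  show "integrable M (\<lambda>x. (cmod (f x))\<^sup>2 + (cmod (g x))\<^sup>2)"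
    using assms L2_integrable by simp
  have [measurable]: "f \<in> borel_measurable borel" "g \<in> borel_measurable borel"
    using assms L2_measurable by auto
  show "(\<lambda>x. f x * g x) \<in> borel_measurable M" by simp
  have "cmod (f x * g x) \<le> (cmod (f x))\<^sup>2 + (cmod (g x))\<^sup>2" for x
  proof -
    have "0 \<le> cmod (f x) * cmod (g x)" by simp
    moreover have "2 * (cmod (f x) * cmod (g x)) \<le> (cmod (f x))\<^sup>2 + (cmod (g x))\<^sup>2"
      using sum_squares_bound[of "cmod (f x)" "cmod (g x)"] by (simp only: mult.assoc)
    ultimately show ?thesis unfolding norm_mult by linarith
  qed
  then show "AE x in M. cmod (f x * g x) \<le> norm ((cmod (f x))\<^sup>2 + (cmod (g x))\<^sup>2)" by simp
qed

lemma fc_add: "L2 f \<Longrightarrow> L2 g \<Longrightarrow> fc (\<lambda>x. f x + g x) k = fc f k + fc g k"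
  unfolding fc_def by (simp add: distrib_right integrable_L2_mult L2_e)

lemma fc_cmult: "fc (\<lambda>x. c * f x) k = c * fc f k"
  unfolding fc_def by (simp add: mult.assoc)

lemma fc_diff: "L2 f \<Longrightarrow> L2 g \<Longrightarrow> fc (\<lambda>x. f x - g x) k = fc f k - fc g k"
  unfolding fc_def by (simp add: left_diff_distrib integrable_L2_mult L2_e)

lemma fc_0 [simp]: "fc (\<lambda>x. 0) k = 0" by (simp add: fc_def)

lemma fc_sum: "(\<And>i. i \<in> I \<Longrightarrow> L2 (f i)) \<Longrightarrow> fc (\<lambda>x. \<Sum>i\<in>I. f i x) k = (\<Sum>i\<in>I. fc (f i) k)"
  unfolding fc_def by (simp add: sum_distrib_right integrable_L2_mult L2_e)

lemma fc_e_mult: "fc (\<lambda>x. e l x * f x) k = fc f (k - l)"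
  unfolding fc_def by (rule Bochner_Integration.integral_cong) (simp_all add: e_add[symmetric] e_add mult_ac flip: e_add)

lemma fc_e: "fc (e l) k = (if k = l then 1 else 0)"
  unfolding fc_def using integral_e[of "l - k"] by (simp flip: e_add)

definition tp :: "(int \<times> int) set \<Rightarrow> (int \<times> int \<Rightarrow> complex) \<Rightarrow> real \<times> real \<Rightarrow> complex" where
  "tp K c x = (\<Sum>k\<in>K. c k * e k x)"

lemma smooth_tp: "smooth (tp K c)"
  unfolding tp_def[abs_def] by (intro smooth_sum smooth_mult smooth_const smooth_e)

lemma L2_tp: "L2 (tp K c)" by (rule L2_smooth[OF smooth_tp])

lemma periodic_tp: "periodic (tp K c)"
  unfolding periodic_def tp_def by (metis (no_types, lifting) periodicD[OF periodic_e] sum.cong)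

lemma fc_tp: "finite K \<Longrightarrow> fc (tp K c) l = (if l \<in> K then c l else 0)"
  unfolding tp_def[abs_def] by (simp add: fc_sum L2_cmult L2_e fc_cmult fc_e if_distrib sum.delta' cong: if_cong)

text \<open>Completion of the square. Keeping \<open>c\<close> arbitrary, instead of the optimal
  \<open>fc g k\<close>, is what lets coefficients of any approximating polynomial be compared with
  the Fourier coefficients.\<close>

lemma nrm_diff_e:
  assumes "L2 g"
  shows "nrm (\<lambda>x. g x - c * e k x) = nrm g - (cmod (fc g k))\<^sup>2 + (cmod (fc g k - c))\<^sup>2"
proof -
  have pt: "(cmod (z - c * w))\<^sup>2 = (cmod z)\<^sup>2 - 2 * Re (cnj c * (z * cnj w)) + (cmod c)\<^sup>2" if "cmod w = 1" for z w
  proof -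
    have "w * cnj w = 1" using that complex_norm_square[of w] by simp
    then have "complex_of_real ((cmod (z - c * w))\<^sup>2) = z * cnj z - (cnj c * (z * cnj w) + cnj (cnj c * (z * cnj w))) + c * cnj c"
      unfolding complex_norm_square by (simp add: algebra_simps)
    also have "\<dots> = complex_of_real ((cmod z)\<^sup>2 - 2 * Re (cnj c * (z * cnj w)) + (cmod c)\<^sup>2)"
      by (simp only: complex_add_cnj of_real_add of_real_diff complex_norm_square)
    finally show ?thesis using of_real_eq_iff by blast
  qed
  have i: "integrable M (\<lambda>x. cnj c * (g x * e (- k) x))"
    using integrable_L2_mult[OF assms L2_e] by simp
  define r where "r x = Re (cnj c * (g x * e (- k) x))" for x
  have ir: "integrable M r" using integrable_Re[OF i] by (simp only: r_def[abs_def])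
  have "nrm (\<lambda>x. g x - c * e k x) = (LINT x|M. (cmod (g x))\<^sup>2 - 2 * r x + (cmod c)\<^sup>2)"
    unfolding nrm_def r_def by (simp only: pt[OF norm_e] cnj_e)
  also have "\<dots> = nrm g - 2 * (LINT x|M. r x) + (cmod c)\<^sup>2"
    using L2_integrable[OF assms] ir
      finite_measure.integrable_const[OF finite_measure_M, of "(cmod c)\<^sup>2"]
    by (simp add: nrm_def measure_M_UNIV)
  also have "(LINT x|M. r x) = Re (cnj c * fc g k)"
    using integral_Re[OF i] unfolding fc_def r_def by (simp only: integral_mult_right_zero)
  also have "nrm g - 2 * Re (cnj c * fc g k) + (cmod c)\<^sup>2 = nrm g - (cmod (fc g k))\<^sup>2 + (cmod (fc g k - c))\<^sup>2"
    using pt[of 1 "fc g k"] by simp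
  finally show ?thesis .
qed

text \<open>The identity contains Bessel's inequality (take \<open>c = fc f\<close>), the optimality
  of the Fourier coefficients (the last sum is nonnegative) and the norm of a trigonometric
  polynomial (take \<open>f = 0\<close>).\<close>

lemma nrm_diff_tp:
  assumes "L2 f" "finite K"
  shows "nrm (\<lambda>x. f x - tp K c x) = nrm f - (\<Sum>k\<in>K. (cmod (fc f k))\<^sup>2) + (\<Sum>k\<in>K. (cmod (fc f k - c k))\<^sup>2)"
  using assms(2)
proof (induction K)
  case empty then show ?case by (simp add: tp_def)
next
  case (insert k K)
  let ?g = "\<lambda>x. f x - tp K c x"
  have L: "L2 ?g" by (rule L2_diff[OF assms(1) L2_tp])
  have "fc ?g k = fc f k" using insert.hyps by (simp add: fc_diff assms(1) L2_tp fc_tp)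
  moreover have "(\<lambda>x. f x - tp (insert k K) c x) = (\<lambda>x. ?g x - c k * e k x)"
    using insert.hyps by (auto simp: tp_def)
  ultimately show ?case using nrm_diff_e[OF L, of "c k" k] insert by simp
qed

lemma nrm_tp: "finite K \<Longrightarrow> nrm (tp K c) = (\<Sum>k\<in>K. (cmod (c k))\<^sup>2)"
  using nrm_diff_tp[OF L2_0, of K c] by (simp add: nrm_uminus nrm_def)

subsection \<open>Density of trigonometric polynomials\<close>

text \<open>A Borel section of the covering with values in the half-open cell. It turns periodic
  functions into functions on the torus, and Borel sets of the plane into Borel sets
  downstairs.\<close>

definition proj_inv :: "complex \<times> complex \<Rightarrow> real \<times> real" where
  "proj_inv z = (a * Arg2pi (fst z), b * Arg2pi (snd z))"

text \<open>The argument jumps only across the nonnegative real axis, where it equals 0: it is a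
  continuous function on an open set, extended by a constant.\<close>

lemma measurable_Arg2pi [measurable]: "Arg2pi \<in> borel_measurable borel"
proof -
  let ?N = "{z. z \<in> \<real> \<and> 0 \<le> Re z}"
  have eq: "?N = {z. Im z = 0} \<inter> {z. 0 \<le> Re z}" by (auto simp: complex_is_Real_iff)
  have cl: "closed ?N" unfolding eq
    by (intro closed_Int closed_Collect_eq closed_Collect_le continuous_intros)
  have "continuous_on (- ?N) Arg2pi"
  proof (rule continuous_at_imp_continuous_on, rule ballI)
    fix z assume "z \<in> - ?N"
    then have "z \<notin> \<real>\<^sub>\<ge>\<^sub>0" by (auto simp: nonneg_Reals_def)
    then show "isCont Arg2pi z" by (rule continuous_at_Arg2pi)
  qed
  then have "(\<lambda>z. if z \<in> - ?N then Arg2pi z else 0) \<in> borel_measurable borel"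
    using cl by (intro borel_measurable_continuous_on_if) auto
  also have "(\<lambda>z. if z \<in> - ?N then Arg2pi z else 0) = Arg2pi"
    by (auto simp: Arg2pi_eq_0)
  finally show ?thesis .
qed

lemma measurable_proj_inv [measurable]: "proj_inv \<in> borel_measurable borel"
  unfolding proj_inv_def[abs_def] borel_prod[symmetric] by measurable

lemma continuous_proj: "continuous_on S proj"
  unfolding torus_proj_def[abs_def] using a_pos b_pos by (intro continuous_intros) auto

lemma measurable_proj [measurable]: "proj \<in> borel_measurable borel"
  by (rule borel_measurable_continuous_onI[OF continuous_proj])

lemma proj_in_torus: "proj p \<in> flat_torus a b"
  using a_pos b_pos by (simp add: torus_proj_def flat_torus_def norm_mult)

lemma proj_proj_inv: "z \<in> flat_torus a b \<Longrightarrow> proj (proj_inv z) = z"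
proof -
  assume z: "z \<in> flat_torus a b"
  then have n: "cmod (fst z) = a" "cmod (snd z) = b" by (auto simp: flat_torus_def)
  have c: "of_real (cmod w) * cis (Arg2pi w) = w" for w
    using Arg2pi_eq[of w] by (simp add: cis_conv_exp)
  show ?thesis
    using c[of "fst z"] c[of "snd z"] a_pos b_pos n
    by (simp add: torus_proj_def proj_inv_def prod_eq_iff)
qed

lemma proj_inv_proj:
  assumes "0 \<le> fst p" "fst p < 2 * pi * a" "0 \<le> snd p" "snd p < 2 * pi * b"
  shows "proj_inv (proj p) = p"
proof -
  have 1: "Arg2pi (of_real c * cis t) = t" if "c > 0" "0 \<le> t" "t < 2 * pi" for c t
    by (rule Arg2pi_unique[of c]) (use that in \<open>auto simp: cis_conv_exp\<close>)
  have "Arg2pi (of_real a * cis (fst p / a)) = fst p / a"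
    by (rule 1) (use assms a_pos in \<open>auto simp: field_simps\<close>)
  moreover have "Arg2pi (of_real b * cis (snd p / b)) = snd p / b"
    by (rule 1) (use assms b_pos in \<open>auto simp: field_simps\<close>)
  ultimately show ?thesis using a_pos b_pos by (simp add: torus_proj_def proj_inv_def)
qed

lemma AE_cell_interior:
  "AE p in lborel. p \<in> cell \<longrightarrow> p \<in> {0..<2 * pi * a} \<times> {0..<2 * pi * b}"
proof -
  let ?N1 = "cbox (2 * pi * a, 0) (2 * pi * a, 2 * pi * b)"
  let ?N2 = "cbox (0, 2 * pi * b) (2 * pi * a, 2 * pi * b)"
  have "emeasure lborel ?N1 = 0" "emeasure lborel ?N2 = 0"
    by (auto simp: emeasure_lborel_cbox_eq Basis_prod_def)
  then have "?N1 \<in> null_sets lborel" "?N2 \<in> null_sets lborel" by (auto simp: null_sets_def)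
  from AE_not_in[OF this(1)] AE_not_in[OF this(2)] show ?thesis
    by eventually_elim (auto simp: cell_def cbox_Pair_eq)
qed

lemma AE_M_I: "(AE p in lborel. p \<in> cell \<longrightarrow> P p) \<Longrightarrow> AE p in M. P p"
  unfolding M_def using area_pos
  by (subst AE_density) (auto simp: indicator_def elim!: eventually_mono split: if_splits)

lemma AE_proj_inv: "AE p in M. proj_inv (proj p) = p"
  by (rule AE_M_I, rule eventually_mono[OF AE_cell_interior]) (auto intro!: proj_inv_proj)

definition TP :: "(real \<times> real \<Rightarrow> complex) \<Rightarrow> bool" where
  "TP f \<longleftrightarrow> (\<exists>K c. finite K \<and> f = tp K c)"

lemma TP_tp: "finite K \<Longrightarrow> TP (tp K c)" by (auto simp: TP_def)

lemma tp_extend: "finite L \<Longrightarrow> K \<subseteq> L \<Longrightarrow> tp L (\<lambda>k. if k \<in> K then c k else 0) = tp K c"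
  unfolding tp_def by (intro ext sum.mono_neutral_cong_right) auto

lemma TP_add: assumes "TP f" "TP g" shows "TP (\<lambda>x. f x + g x)"
proof -
  obtain K c L d where "finite K" "f = tp K c" "finite L" "g = tp L d"
    using assms by (auto simp: TP_def)
  then have "(\<lambda>x. f x + g x) = tp (K \<union> L) (\<lambda>k. (if k \<in> K then c k else 0) + (if k \<in> L then d k else 0))"
    using tp_extend[of "K \<union> L" K c] tp_extend[of "K \<union> L" L d]
    by (auto simp: fun_eq_iff tp_def distrib_right sum.distrib)
  then show ?thesis using \<open>finite K\<close> \<open>finite L\<close> TP_tp by simp
qed

lemma TP_cmult: assumes "TP f" shows "TP (\<lambda>x. c * f x)"
proof -
  obtain K d where "finite K" "f = tp K d" using assms by (auto simp: TP_def)
  then have "(\<lambda>x. c * f x) = tp K (\<lambda>k. c * d k)" by (auto simp: tp_def sum_distrib_left mult.assoc)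
  then show ?thesis using \<open>finite K\<close> TP_tp by simp
qed

lemma TP_e: "TP (e k)"
proof -
  have "tp {k} (\<lambda>_. 1) = e k" by (auto simp: tp_def)
  then show ?thesis using TP_tp[of "{k}" "\<lambda>_. 1"] by simp
qed

lemma TP_0: "TP (\<lambda>x. 0)" using TP_cmult[OF TP_e, of 0 0] by simp

lemma TP_sum: "(\<And>i. i \<in> I \<Longrightarrow> TP (f i)) \<Longrightarrow> TP (\<lambda>x. \<Sum>i\<in>I. f i x)"
proof (induction I rule: infinite_finite_induct)
  case (insert i I)
  have "TP (\<lambda>x. f i x + (\<Sum>i\<in>I. f i x))" using insert by (intro TP_add) auto
  then show ?case using insert.hyps by simp
qed (simp_all add: TP_0)

lemma TP_mult: assumes "TP f" "TP g" shows "TP (\<lambda>x. f x * g x)"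
proof -
  obtain K c L d where fg: "finite K" "f = tp K c" "finite L" "g = tp L d"
    using assms by (auto simp: TP_def)
  have "TP (\<lambda>x. \<Sum>k\<in>K. \<Sum>l\<in>L. (c k * d l) * e (k + l) x)"
    by (intro TP_sum TP_cmult TP_e)
  also have "(\<lambda>x. \<Sum>k\<in>K. \<Sum>l\<in>L. (c k * d l) * e (k + l) x) = (\<lambda>x. f x * g x)"
    by (auto simp: fg tp_def sum_product e_add mult_ac)
  finally show ?thesis .
qed

lemma TP_const: "TP (\<lambda>x. c)" using TP_cmult[OF TP_e, of c 0] by simp

text \<open>On the torus the four real coordinates of the ambient space are cosines and sines, hence
  combinations of four characters. Polynomials from Stone-Weierstrass thus restrict to trigonometric
  polynomials.\<close>

lemma TP_real_polynomial:
  "real_polynomial_function g \<Longrightarrow> TP (\<lambda>p. of_real (g (proj p)))"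
proof (induction rule: real_polynomial_function.induct)
  case (linear L)
  interpret bounded_linear L by fact
  have ex: "L z = Re (fst z) * L (1, 0) + Im (fst z) * L (\<i>, 0) + Re (snd z) * L (0, 1) + Im (snd z) * L (0, \<i>)" for z
  proof -
    have "z = Re (fst z) *\<^sub>R (1, 0) + Im (fst z) *\<^sub>R (\<i>, 0) + Re (snd z) *\<^sub>R (0, 1) + Im (snd z) *\<^sub>R (0, \<i>)"
      by (simp add: prod_eq_iff complex_eq_iff)
    from arg_cong[OF this, of L] show ?thesis by (simp only: add scaleR) simp
  qed
  have cs: "complex_of_real (Re (of_real r * cis t)) = of_real r * (1/2) * (cis t + cis (- t))"
      "complex_of_real (Im (of_real r * cis t)) = of_real r * (- \<i>/2) * (cis t - cis (- t))" for r t
    by (auto simp: complex_eq_iff)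
  have e1: "e (1, 0) p = cis (fst p / a)" "e (-1, 0) p = cis (- (fst p / a))"
     "e (0, 1) p = cis (snd p / b)" "e (0, -1) p = cis (- (snd p / b))" for p
    by (auto simp: e_def fr_def inner_prod_def)
  have "TP (\<lambda>p. (of_real a * (1/2) * of_real (L (1, 0))) * (e (1, 0) p + e (-1, 0) p) +
      (of_real a * (- \<i>/2) * of_real (L (\<i>, 0))) * (e (1, 0) p + (-1) * e (-1, 0) p) +
      (of_real b * (1/2) * of_real (L (0, 1))) * (e (0, 1) p + e (0, -1) p) +
      (of_real b * (- \<i>/2) * of_real (L (0, \<i>))) * (e (0, 1) p + (-1) * e (0, -1) p))" (is "TP ?h")
    by (intro TP_add TP_cmult TP_e)
  also have "?h = (\<lambda>p. of_real (L (proj p)))"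
  proof
    fix p
    show "?h p = of_real (L (proj p))"
      unfolding ex[of "proj p"]
      by (simp only: torus_proj_def fst_conv snd_conv of_real_add of_real_mult cs e1)
        (simp add: algebra_simps add_divide_distrib diff_divide_distrib)
  qed
  finally show ?case .
next
  case (add f g) then show ?case using TP_add by simp
next
  case (mult f g) then show ?case using TP_mult by simp
qed (rule TP_const)

definition approximable :: "(real \<times> real \<Rightarrow> complex) \<Rightarrow> bool" where
  "approximable f \<longleftrightarrow> L2 f \<and> (\<forall>d>0. \<exists>g. TP g \<and> nrm (\<lambda>x. f x - g x) < d)"

lemma approximableD: "approximable f \<Longrightarrow> d > 0 \<Longrightarrow> \<exists>g. TP g \<and> nrm (\<lambda>x. f x - g x) < d"
  by (auto simp: approximable_def)

lemma TP_L2: "TP f \<Longrightarrow> L2 f" by (auto simp: TP_def L2_tp)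

lemma approximable_close:
  assumes "L2 f" "\<And>d. d > 0 \<Longrightarrow> \<exists>g. approximable g \<and> nrm (\<lambda>x. f x - g x) < d"
  shows "approximable f"
  unfolding approximable_def
proof (intro conjI allI impI)
  fix d :: real assume d: "d > 0"
  obtain g where g: "approximable g" "nrm (\<lambda>x. f x - g x) < d / 4" using assms(2)[of "d/4"] d by auto
  obtain h where h: "TP h" "nrm (\<lambda>x. g x - h x) < d / 4"
    using approximableD[OF g(1), of "d/4"] d by auto
  have "nrm (\<lambda>x. (f x - g x) + (g x - h x)) \<le> 2 * nrm (\<lambda>x. f x - g x) + 2 * nrm (\<lambda>x. g x - h x)"
    using g h assms(1) by (intro nrm_add_le L2_diff) (auto simp: approximable_def TP_L2)
  then have "nrm (\<lambda>x. f x - h x) < d" using g h by simp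
  then show "\<exists>g. TP g \<and> nrm (\<lambda>x. f x - g x) < d" using h by blast
qed (rule assms(1))

lemma approximable_TP: "TP f \<Longrightarrow> approximable f"
  by (rule approximable_close) (auto simp: TP_L2 approximable_def nrm_def intro!: exI[of _ f])

lemma approximable_add:
  assumes "approximable f" "approximable g" shows "approximable (\<lambda>x. f x + g x)"
  unfolding approximable_def
proof (intro conjI allI impI)
  show "L2 (\<lambda>x. f x + g x)" using assms by (auto simp: approximable_def intro: L2_add)
  fix d :: real assume d: "d > 0"
  obtain f' where f': "TP f'" "nrm (\<lambda>x. f x - f' x) < d / 4"
    using approximableD[OF assms(1), of "d/4"] d by auto
  obtain g' where g': "TP g'" "nrm (\<lambda>x. g x - g' x) < d / 4"
    using approximableD[OF assms(2), of "d/4"] d by auto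
  have "nrm (\<lambda>x. (f x - f' x) + (g x - g' x)) \<le> 2 * nrm (\<lambda>x. f x - f' x) + 2 * nrm (\<lambda>x. g x - g' x)"
    using f' g' assms by (intro nrm_add_le L2_diff) (auto simp: approximable_def TP_L2)
  then have "nrm (\<lambda>x. (f x + g x) - (f' x + g' x)) < d" using f' g' by (simp add: algebra_simps)
  then show "\<exists>h. TP h \<and> nrm (\<lambda>x. f x + g x - h x) < d" using TP_add[OF f'(1) g'(1)] by blast
qed

lemma approximable_cmult:
  assumes "approximable f" shows "approximable (\<lambda>x. c * f x)"
  unfolding approximable_def
proof (intro conjI allI impI)
  show "L2 (\<lambda>x. c * f x)" using assms by (auto simp: approximable_def intro: L2_cmult)
  fix d :: real assume d: "d > 0"
  have "d / ((cmod c)\<^sup>2 + 1) > 0" using d by (simp add: add_nonneg_pos)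
  then obtain f' where f': "TP f'" "nrm (\<lambda>x. f x - f' x) < d / ((cmod c)\<^sup>2 + 1)"
    using assms by (auto simp: approximable_def)
  have "nrm (\<lambda>x. c * f x - c * f' x) = (cmod c)\<^sup>2 * nrm (\<lambda>x. f x - f' x)"
    using nrm_cmult[of c "\<lambda>x. f x - f' x"] by (simp add: algebra_simps)
  also have "\<dots> \<le> ((cmod c)\<^sup>2 + 1) * nrm (\<lambda>x. f x - f' x)" by (intro mult_right_mono) auto
  also have "\<dots> < d" using f'(2)
    by (subst (asm) pos_less_divide_eq) (simp_all add: add_nonneg_pos mult.commute)
  finally show "\<exists>h. TP h \<and> nrm (\<lambda>x. c * f x - h x) < d" using TP_cmult[OF f'(1)] by blast
qed

lemma approximable_sum:
  "(\<And>i. i \<in> I \<Longrightarrow> approximable (f i)) \<Longrightarrow> approximable (\<lambda>x. \<Sum>i\<in>I. f i x)"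
proof (induction I rule: infinite_finite_induct)
  case (insert i I)
  have "approximable (\<lambda>x. f i x + (\<Sum>i\<in>I. f i x))" using insert by (intro approximable_add) auto
  then show ?case using insert.hyps by simp
qed (simp_all add: approximable_TP TP_0)

text \<open>The limit step used three times: from continuous functions to indicators of closed sets,
  from disjoint finite unions to countable ones, and from simple functions to all of L2.\<close>

lemma approximable_dominated:
  assumes f: "f \<in> borel_measurable borel" and g: "\<And>n. approximable (g n)"
    and lim: "\<And>x. (\<lambda>n. g n x) \<longlonglongrightarrow> f x"
    and G: "integrable M G" "\<And>n x. (cmod (g n x))\<^sup>2 \<le> G x"
  shows "approximable f"
proof (rule approximable_close)
  have [measurable]: "f \<in> borel_measurable borel" by fact
  have [measurable]: "g n \<in> borel_measurable borel" for n using g L2_measurable by (auto simp: approximable_def)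
  have sq: "(\<lambda>n. (cmod (g n x))\<^sup>2) \<longlonglongrightarrow> (cmod (f x))\<^sup>2" for x
    by (intro tendsto_intros lim)
  have fG: "(cmod (f x))\<^sup>2 \<le> G x" for x
    by (rule LIMSEQ_le_const2[OF sq]) (use G(2) in blast)
  show "L2 f" by (rule L2_mono(1)[OF G(1) f fG])
  fix d :: real assume d: "d > 0"
  have bd: "(cmod (f x - g n x))\<^sup>2 \<le> 4 * G x" for n x
  proof -
    have "(cmod (f x - g n x))\<^sup>2 \<le> (cmod (f x) + cmod (g n x))\<^sup>2"
      by (intro power_mono norm_triangle_ineq4) auto
    also have "\<dots> \<le> 2 * (cmod (f x))\<^sup>2 + 2 * (cmod (g n x))\<^sup>2"
      using sum_squares_bound[of "cmod (f x)" "cmod (g n x)"] by (simp add: power2_sum)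
    finally show ?thesis using fG[of x] G(2)[of n x] by simp
  qed
  have "(\<lambda>n. LINT x|M. (cmod (f x - g n x))\<^sup>2) \<longlonglongrightarrow> (LINT x|M. (0::real))"
  proof (rule integral_dominated_convergence)
    show "integrable M (\<lambda>x. 4 * G x)" using G(1) by simp
    show "AE x in M. (\<lambda>n. (cmod (f x - g n x))\<^sup>2) \<longlonglongrightarrow> 0"
    proof (rule AE_I2)
      fix x
      have "(\<lambda>n. (cmod (f x - g n x))\<^sup>2) \<longlonglongrightarrow> (cmod (f x - f x))\<^sup>2" by (intro tendsto_intros lim)
      then show "(\<lambda>n. (cmod (f x - g n x))\<^sup>2) \<longlonglongrightarrow> 0" by simp
    qed
    show "AE x in M. norm ((cmod (f x - g n x))\<^sup>2) \<le> 4 * G x" for n using bd by (intro AE_I2) simp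
  qed simp_all
  then have "(\<lambda>n. nrm (\<lambda>x. f x - g n x)) \<longlonglongrightarrow> 0" by (simp add: nrm_def)
  from order_tendstoD(2)[OF this d] obtain n where "nrm (\<lambda>x. f x - g n x) < d"
    by (auto simp: eventually_sequentially)
  then show "\<exists>g. approximable g \<and> nrm (\<lambda>x. f x - g x) < d" using g by blast
qed

lemma compact_torus: "compact (flat_torus a b)"
  unfolding flat_torus_def by (intro compact_Times compact_sphere)

lemma approximable_continuous:
  assumes "continuous_on UNIV (h :: complex \<times> complex \<Rightarrow> real)"
  shows "approximable (\<lambda>p. of_real (h (proj p)))"
proof (rule approximable_close)
  have "continuous_on UNIV (\<lambda>p. h (proj p))"
    by (rule continuous_on_compose2[OF assms continuous_proj]) auto
  then show L: "L2 (\<lambda>p. of_real (h (proj p)))" by (intro L2_continuous continuous_intros)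
  fix d :: real assume d: "d > 0"
  obtain g where g: "real_polynomial_function g" "\<And>x. x \<in> flat_torus a b \<Longrightarrow> \<bar>h x - g x\<bar> < sqrt (d / 2)"
    using Stone_Weierstrass_real_polynomial_function[OF compact_torus continuous_on_subset[OF assms], of "sqrt (d/2)"] d
    by auto
  have tp: "TP (\<lambda>p. of_real (g (proj p)))" by (rule TP_real_polynomial[OF g(1)])
  have "cmod (of_real (h (proj p)) - of_real (g (proj p))) \<le> sqrt (d / 2) * cmod 1" for p
    using g(2)[OF proj_in_torus, of p] by (simp flip: of_real_diff)
  then have "nrm (\<lambda>p. of_real (h (proj p)) - of_real (g (proj p))) \<le> (sqrt (d / 2))\<^sup>2 * nrm (\<lambda>x. 1)"
    using L2_measurable[OF L2_diff[OF L TP_L2[OF tp]]] by (intro L2_nrm_mono(2) TP_L2 TP_const)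
  also have "\<dots> < d" using d by (simp add: nrm_def measure_M_UNIV)
  finally show "\<exists>g. approximable g \<and> nrm (\<lambda>x. of_real (h (proj x)) - g x) < d"
    using approximable_TP[OF tp] by blast
qed

lemma approximable_closed:
  assumes "closed C" shows "approximable (\<lambda>p. indicator C (proj p))"
proof (cases "C = {}")
  case True then show ?thesis by (simp add: approximable_TP TP_0)
next
  case False
  \<comment> \<open>Equal to 1 on \<open>C\<close>; off \<open>C\<close> it is 0 as soon as
    \<open>n\<close> exceeds the inverse of the distance.\<close>
  define h where "h n z = max 0 (1 - real n * infdist z C)" for n z
  show ?thesis
  proof (rule approximable_dominated)
    show "approximable (\<lambda>p. of_real (h n (proj p)))" for n
      unfolding h_def by (intro approximable_continuous continuous_intros)
    show "(\<lambda>n. complex_of_real (h n (proj p))) \<longlonglongrightarrow> indicator C (proj p)" for p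
    proof (cases "proj p \<in> C")
      case True
      then show ?thesis by (simp add: h_def)
    next
      case 2: False
      then have pos: "infdist (proj p) C > 0"
        using in_closed_iff_infdist_zero[OF assms False] infdist_nonneg by (metis order_less_le)
      obtain N :: nat where N: "1 / infdist (proj p) C \<le> N" using real_arch_simple by blast
      have "\<forall>\<^sub>F n in sequentially. complex_of_real (h n (proj p)) = 0"
        using eventually_ge_at_top[of N]
      proof eventually_elim
        case (elim n)
        then have "1 / infdist (proj p) C \<le> real n" using N by linarith
        then have "1 \<le> real n * infdist (proj p) C" using pos by (simp add: field_simps)
        then show ?case by (simp add: h_def)
      qed
      then show ?thesis using 2 by (simp add: tendsto_eventually)
    qed
    have "C \<in> sets borel" using assms by simp
    then show "(\<lambda>p. indicator C (proj p) :: complex) \<in> borel_measurable borel" by measurable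
    show "integrable M (\<lambda>x. 1 :: real)" by (rule finite_measure.integrable_const[OF finite_measure_M])
    have "0 \<le> h n z" "h n z \<le> 1" for n z using infdist_nonneg[of z C] mult_nonneg_nonneg[of "real n" "infdist z C"] by (auto simp: h_def)
    then show "(cmod (complex_of_real (h n (proj p))))\<^sup>2 \<le> 1" for n p by (simp add: power_le_one)
  qed
qed

text \<open>Dynkin's argument: the closed sets are stable under intersection and generate the Borel
  sets.\<close>

lemma approximable_borel:
  assumes "B \<in> sets borel" shows "approximable (\<lambda>p. indicator B (proj p))"
proof -
  have "Int_stable (Collect closed :: (complex \<times> complex) set set)"
    "Collect closed \<subseteq> Pow (UNIV :: (complex \<times> complex) set)"
    "B \<in> sigma_sets UNIV (Collect closed)"
    using assms by (auto simp: Int_stable_def borel_eq_closed)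
  then show ?thesis
  proof (induction rule: sigma_sets_induct_disjoint)
    case (basic A) then show ?case by (simp add: approximable_closed)
  next
    case empty then show ?case by (simp add: approximable_TP TP_0)
  next
    case (compl A)
    have "approximable (\<lambda>p. 1 + (-1) * indicator A (proj p))"
      by (intro approximable_add approximable_cmult compl approximable_TP TP_const)
    also have "(\<lambda>p. 1 + (-1) * indicator A (proj p) :: complex) = (\<lambda>p. indicator (UNIV - A) (proj p))"
      by (auto simp: indicator_def)
    finally show ?case .
  next
    case (union A)
    have [measurable]: "A i \<in> sets borel" for i using union(2) by (auto simp: borel_eq_closed)
    have s: "indicator (\<Union>i<n. A i) z = (\<Sum>i<n. indicator (A i) z :: complex)" for n z
      using union(1) by (intro indicator_UN_disjoint) (auto simp: disjoint_family_on_def)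
    show ?case
    proof (rule approximable_dominated)
      show "approximable (\<lambda>p. indicator (\<Union>i<n. A i) (proj p))" for n
        unfolding s by (intro approximable_sum union)
      show "(\<lambda>n. indicator (\<Union>i<n. A i) (proj p) :: complex) \<longlonglongrightarrow> indicator (\<Union>i. A i) (proj p)" for p
        by (rule LIMSEQ_indicator_UN)
      have "(\<Union>i. A i) \<in> sets borel" by auto
      then show "(\<lambda>p. indicator (\<Union>i. A i) (proj p) :: complex) \<in> borel_measurable borel"
        by (rule measurable_compose[OF measurable_proj borel_measurable_indicator])
      show "integrable M (\<lambda>x. 1 :: real)" by (rule finite_measure.integrable_const[OF finite_measure_M])
    qed (auto simp: indicator_def)
  qed
qed

lemma approximable_AE:
  assumes "approximable g" "f \<in> borel_measurable borel" "AE x in M. f x = g x"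
  shows "approximable f"
proof (rule approximable_close)
  have [measurable]: "f \<in> borel_measurable borel" "g \<in> borel_measurable borel"
    using assms L2_measurable by (auto simp: approximable_def)
  have "integrable M (\<lambda>x. (cmod (f x))\<^sup>2) \<longleftrightarrow> integrable M (\<lambda>x. (cmod (g x))\<^sup>2)"
    using assms(3) by (intro integrable_cong_AE) auto
  then show "L2 f" using assms by (simp add: approximable_def L2_def)
  fix d :: real assume "d > 0"
  have "nrm (\<lambda>x. f x - g x) = (LINT x|M. 0)"
    unfolding nrm_def using assms(3) by (intro integral_cong_AE) auto
  then show "\<exists>g. approximable g \<and> nrm (\<lambda>x. f x - g x) < d" using assms(1) \<open>d > 0\<close> by auto
qed

text \<open>A Borel set of the plane need not be a union of fibres of the covering. Its indicator
  agrees almost everywhere for \<open>M\<close> with that of such a union, obtained through the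
  section \<open>proj_inv\<close>.\<close>

lemma approximable_indicator:
  assumes [measurable]: "A \<in> sets borel" shows "approximable (indicator A)"
proof (rule approximable_AE)
  have "proj_inv -` A \<inter> space borel \<in> sets borel" by measurable
  then show "approximable (\<lambda>p. indicator (proj_inv -` A) (proj p))" by (intro approximable_borel) simp
  show "AE p in M. indicator A p = (indicator (proj_inv -` A) (proj p) :: complex)"
    using AE_proj_inv by eventually_elim (auto simp: indicator_def)
qed measurable

theorem L2_approximable: assumes "L2 f" shows "approximable f"
proof -
  have [measurable]: "f \<in> borel_measurable M" using L2_measurable[OF assms] by simp
  obtain F where F: "\<And>i. simple_function M (F i)" "\<And>x. (\<lambda>i. F i x) \<longlonglongrightarrow> f x"
      "\<And>i x. dist (F i x) 0 \<le> 2 * dist (f x) 0"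
    using borel_measurable_implies_sequence_metric[of f M 0] by auto
  have rep: "F i = (\<lambda>x. \<Sum>y\<in>range (F i). y * indicator (F i -` {y}) x)" for i
  proof
    fix x
    have "finite (range (F i))" using F(1)[of i] by (simp add: simple_function_def)
    then show "F i x = (\<Sum>y\<in>range (F i). y * indicator (F i -` {y}) x)"
      by (simp add: indicator_def if_distrib sum.delta cong: if_cong)
  qed
  have ap: "approximable (F i)" for i
  proof (subst rep, intro approximable_sum approximable_cmult approximable_indicator)
    fix y assume "y \<in> range (F i)"
    then show "F i -` {y} \<in> sets borel" using F(1)[of i] by (auto simp: simple_function_def)
  qed
  show ?thesis
  proof (rule approximable_dominated)
    show "integrable M (\<lambda>x. 4 * (cmod (f x))\<^sup>2)" using L2_integrable[OF assms] by simp
    show "(cmod (F n x))\<^sup>2 \<le> 4 * (cmod (f x))\<^sup>2" for n x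
      using power_mono[OF F(3)[of n x], of 2] by (simp add: power_mult_distrib)
  qed (use ap F L2_measurable[OF assms] in auto)
qed

lemma bessel: "L2 f \<Longrightarrow> finite K \<Longrightarrow> (\<Sum>k\<in>K. (cmod (fc f k))\<^sup>2) \<le> nrm f"
  using nrm_diff_tp[of f K "fc f"] nrm_nonneg[of "\<lambda>x. f x - tp K (fc f) x"] by simp

theorem parseval: assumes "L2 f" shows "((\<lambda>k. (cmod (fc f k))\<^sup>2) has_sum nrm f) UNIV"
  unfolding has_sum_def tendsto_iff
proof (intro allI impI)
  fix d :: real assume "d > 0"
  then obtain K c where K: "finite K" "nrm (\<lambda>x. f x - tp K c x) < d"
    using L2_approximable[OF assms] by (auto simp: approximable_def TP_def)
  \<comment> \<open>The Fourier coefficients approximate best, so the defect of the partial sum over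
    \<open>K\<close> is at most the error of the given polynomial.\<close>
  have "nrm f - (\<Sum>k\<in>K. (cmod (fc f k))\<^sup>2) < d"
    using nrm_diff_tp[OF assms K(1), of c] K(2) sum_nonneg[of K "\<lambda>k. (cmod (fc f k - c k))\<^sup>2"] by simp
  then have "dist (\<Sum>k\<in>Y. (cmod (fc f k))\<^sup>2) (nrm f) < d" if "finite Y" "K \<subseteq> Y" for Y
    using bessel[OF assms that(1)] sum_mono2[OF that, of "\<lambda>k. (cmod (fc f k))\<^sup>2"]
    by (simp add: dist_real_def)
  then show "\<forall>\<^sub>F Y in finite_subsets_at_top UNIV. dist (\<Sum>k\<in>Y. (cmod (fc f k))\<^sup>2) (nrm f) < d"
    using K(1) by (auto simp: eventually_finite_subsets_at_top)
qed

lemma proj_inv_in_cell: "proj_inv z \<in> cell"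
  using a_pos b_pos Arg2pi[of "fst z"] Arg2pi[of "snd z"]
  by (auto simp: proj_inv_def cell_def cbox_Pair_eq intro: mult_left_mono)

lemma periodic_proj_inv: "periodic f \<Longrightarrow> f (proj_inv (proj x)) = f x"
  by (erule periodicD) (rule proj_proj_inv[OF proj_in_torus])

lemma periodic_diff: "periodic f \<Longrightarrow> periodic g \<Longrightarrow> periodic (\<lambda>x. f x - g x)"
  unfolding periodic_def by (intro allI impI arg_cong2[where f="(-)"]) blast+

lemma periodic_const: "periodic (\<lambda>x. c)" by (simp add: periodic_def)

lemma integral_zero_imp_zero:
  fixes f :: "real \<times> real \<Rightarrow> real"
  assumes "continuous_on UNIV f" "periodic f" "\<And>x. 0 \<le> f x" "(LINT x|M. f x) = 0"
  shows "f x = 0"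
proof -
  have "integral cell f = 0"
    using assms(4) area_pos by (simp add: integral_M_continuous[OF assms(1)])
  moreover have "box (0, 0) (2 * pi * a, 2 * pi * b) \<noteq> {}"
    using a_pos b_pos by (auto simp: box_ne_empty Basis_prod_def)
  ultimately have "\<forall>x\<in>cell. f x = 0"
    unfolding cell_def
    by (subst (asm) integral_cbox_eq_0_iff) (auto intro: continuous_on_subset[OF assms(1)] assms(3))
  then show ?thesis using proj_inv_in_cell periodic_proj_inv[OF assms(2)] by metis
qed

lemma nrm_zero_imp_zero:
  assumes "continuous_on UNIV f" "periodic f" "nrm f = 0"
  shows "f x = 0"
proof -
  have "(cmod (f x))\<^sup>2 = 0"
  proof (rule integral_zero_imp_zero)
    show "continuous_on UNIV (\<lambda>x. (cmod (f x))\<^sup>2)" by (intro continuous_intros assms)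
    show "periodic (\<lambda>x. (cmod (f x))\<^sup>2)" using periodic_comp[OF assms(2), of "\<lambda>z. (cmod z)\<^sup>2"] by simp
  qed (use assms(3) in \<open>auto simp: nrm_def\<close>)
  then show ?thesis by simp
qed

lemma nrm_le_fc:
  assumes "L2 h" "L2 g" "\<And>k. cmod (fc h k) \<le> C * cmod (fc g k)"
  shows "nrm h \<le> C\<^sup>2 * nrm g"
proof (rule has_sum_mono)
  show "((\<lambda>k. (cmod (fc h k))\<^sup>2) has_sum nrm h) UNIV" by (rule parseval[OF assms(1)])
  show "((\<lambda>k. C\<^sup>2 * (cmod (fc g k))\<^sup>2) has_sum C\<^sup>2 * nrm g) UNIV"
    by (rule has_sum_cmult_right[OF parseval[OF assms(2)]])
  show "(cmod (fc h k))\<^sup>2 \<le> C\<^sup>2 * (cmod (fc g k))\<^sup>2" for k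
    using power_mono[OF assms(3)[of k], of 2] by (simp add: power_mult_distrib)
qed

lemma fc_unique:
  assumes "continuous_on UNIV f" "periodic f" "continuous_on UNIV g" "periodic g" "\<And>k. fc f k = fc g k"
  shows "f x = g x"
proof -
  let ?h = "\<lambda>x. f x - g x"
  have L: "L2 f" "L2 g" using assms L2_continuous by auto
  have "nrm ?h \<le> 0\<^sup>2 * nrm f"
    by (rule nrm_le_fc) (use L assms(5) in \<open>auto simp: fc_diff intro: L2_diff\<close>)
  then have "nrm ?h = 0" using nrm_nonneg[of ?h] by simp
  moreover have "periodic ?h" by (intro periodic_diff assms)
  ultimately have "?h x = 0" by (intro nrm_zero_imp_zero continuous_intros assms)
  then show ?thesis by simp
qed

lemma norm_fc_le:
  assumes "L2 f" "\<And>x. cmod (f x) \<le> d" shows "cmod (fc f k) \<le> d"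
proof -
  have d: "0 \<le> d" using assms(2)[of 0] norm_ge_zero order_trans by blast
  have "(cmod (fc f k))\<^sup>2 \<le> nrm f" using bessel[OF assms(1), of "{k}"] by simp
  also have "\<dots> \<le> d\<^sup>2 * nrm (\<lambda>x. 1)"
    using L2_measurable[OF assms(1)] assms(2) by (intro L2_nrm_mono(2) L2_continuous) auto
  also have "\<dots> = d\<^sup>2" by (simp add: nrm_def measure_M_UNIV)
  finally show ?thesis using d by (simp add: power2_le_iff_abs_le)
qed

subsection \<open>Absolutely convergent Fourier series\<close>

definition wiener :: "(int \<times> int \<Rightarrow> complex) \<Rightarrow> real \<times> real \<Rightarrow> complex" where
  "wiener c x = (\<Sum>\<^sub>\<infinity>k. c k * e k x)"

context
  fixes c :: "int \<times> int \<Rightarrow> complex"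
  assumes abs_summable: "(\<lambda>k. cmod (c k)) summable_on UNIV"
begin

text \<open>The bound holds for every larger index set because the tail of the absolute values
  dominates. This allows one finite set to serve two series at once.\<close>

lemma wiener_approx:
  assumes "d > 0"
  shows "\<exists>J. finite J \<and> (\<forall>J' x. finite J' \<longrightarrow> J \<subseteq> J' \<longrightarrow> cmod (wiener c x - tp J' c x) \<le> d)"
proof -
  obtain J where J: "finite J" "dist (\<Sum>k\<in>J. cmod (c k)) (\<Sum>\<^sub>\<infinity>k. cmod (c k)) \<le> d"
    using infsum_finite_approximation[OF abs_summable assms] by auto
  have "cmod (wiener c x - tp J' c x) \<le> d" if J': "finite J'" "J \<subseteq> J'" for J' x
  proof -
    have abs: "(\<lambda>k. cmod (c k * e k x)) summable_on UNIV" using abs_summable by (simp add: norm_mult)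
    then have s: "(\<lambda>k. c k * e k x) summable_on UNIV" by (rule abs_summable_summable)
    have sJ: "(\<lambda>k. c k * e k x) summable_on (- J')" "(\<lambda>k. cmod (c k)) summable_on (- J')" "(\<lambda>k. cmod (c k * e k x)) summable_on (- J')"
      using summable_on_subset_banach[OF s] summable_on_subset_banach[OF abs_summable] summable_on_subset_banach[OF abs] by auto
    have "wiener c x = tp J' c x + (\<Sum>\<^sub>\<infinity>k\<in>- J'. c k * e k x)"
      unfolding wiener_def tp_def
      using infsum_Un_disjoint[of "\<lambda>k. c k * e k x" J' "- J'"] sJ(1) J'(1) by simp
    then have "cmod (wiener c x - tp J' c x) \<le> (\<Sum>\<^sub>\<infinity>k\<in>- J'. cmod (c k * e k x))"
      using norm_infsum_bound[OF sJ(3)] by simp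
    also have "\<dots> = (\<Sum>\<^sub>\<infinity>k\<in>- J'. cmod (c k))" by (simp add: norm_mult)
    also have "\<dots> = (\<Sum>\<^sub>\<infinity>k. cmod (c k)) - (\<Sum>k\<in>J'. cmod (c k))"
      using infsum_Un_disjoint[of "\<lambda>k. cmod (c k)" J' "- J'"] sJ(2) J'(1) by simp
    also have "\<dots> \<le> (\<Sum>\<^sub>\<infinity>k. cmod (c k)) - (\<Sum>k\<in>J. cmod (c k))"
      using J' by (intro diff_left_mono sum_mono2) auto
    also have "\<dots> \<le> d" using J(2) by (simp add: dist_real_def)
    finally show ?thesis .
  qed
  with J(1) show ?thesis by blast
qed

lemma continuous_wiener: "continuous_on UNIV (wiener c)"
proof (rule continuous_on_iff[THEN iffD2], intro ballI allI impI)
  fix x :: "real \<times> real" and d :: real assume d: "d > 0"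
  obtain J where J: "finite J" "\<And>x. cmod (wiener c x - tp J c x) \<le> d / 4"
    using wiener_approx[of "d/4"] d by (metis divide_pos_pos order_refl zero_less_numeral)
  have "continuous_on UNIV (tp J c)" by (rule smooth_continuous[OF smooth_tp])
  then have "\<forall>x\<in>UNIV. \<forall>d>0. \<exists>r>0. \<forall>y\<in>UNIV. dist y x < r \<longrightarrow> dist (tp J c y) (tp J c x) < d"
    by (simp only: continuous_on_iff)
  moreover have "d / 4 > 0" using d by simp
  ultimately obtain r where r: "r > 0" "\<And>y. dist y x < r \<Longrightarrow> dist (tp J c y) (tp J c x) < d / 4"
    by (meson UNIV_I)
  have "dist (wiener c y) (wiener c x) < d" if "dist y x < r" for y
  proof -
    have eq: "wiener c y - wiener c x =
        ((wiener c y - tp J c y) + (tp J c y - tp J c x)) - (wiener c x - tp J c x)" by simp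
    have "cmod (wiener c y - wiener c x) \<le>
        cmod (wiener c y - tp J c y) + cmod (tp J c y - tp J c x) + cmod (wiener c x - tp J c x)"
      unfolding eq
      using norm_triangle_ineq4[of "(wiener c y - tp J c y) + (tp J c y - tp J c x)" "wiener c x - tp J c x"]
        norm_triangle_ineq[of "wiener c y - tp J c y" "tp J c y - tp J c x"] by linarith
    then show ?thesis using J(2)[of x] J(2)[of y] r(2)[OF that] d unfolding dist_norm by linarith
  qed
  then show "\<exists>r>0. \<forall>y\<in>UNIV. dist y x < r \<longrightarrow> dist (wiener c y) (wiener c x) < d" using r(1) by blast
qed

lemma periodic_wiener: "periodic (wiener c)"
  unfolding periodic_def wiener_def
  by (intro allI impI infsum_cong arg_cong2[where f=times] refl periodicD[OF periodic_e])

lemma fc_wiener: "fc (wiener c) k = c k"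
proof -
  have "cmod (fc (wiener c) k - c k) \<le> 0 + d" if d: "d > 0" for d
  proof -
    obtain J where J: "finite J" "\<And>J' x. finite J' \<Longrightarrow> J \<subseteq> J' \<Longrightarrow> cmod (wiener c x - tp J' c x) \<le> d"
      using wiener_approx[OF d] by blast
    let ?J = "insert k J"
    have L: "L2 (wiener c)" by (rule L2_continuous[OF continuous_wiener])
    have "cmod (fc (\<lambda>x. wiener c x - tp ?J c x) k) \<le> d"
      by (intro norm_fc_le L2_diff L L2_tp J(2)) (use J(1) in auto)
    then show ?thesis using J(1) by (simp add: fc_diff L L2_tp fc_tp)
  qed
  then have "cmod (fc (wiener c) k - c k) \<le> 0" by (rule field_le_epsilon)
  then show ?thesis by simp
qed

end

lemma summable_inverse_squares:
  assumes "r > 0" shows "(\<lambda>m::int. 1 / (1 + (of_int m / r)\<^sup>2 :: real)) summable_on UNIV"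
proof -
  let ?g = "\<lambda>m::int. 1 / (1 + (of_int m / r)\<^sup>2 :: real)"
  have "summable (\<lambda>n::nat. r\<^sup>2 * inverse (of_nat n ^ 2) :: real)"
    by (intro summable_mult inverse_power_summable) simp
  then have "summable (\<lambda>n::nat. ?g (int n))"
  proof (rule summable_comparison_test_ev[rotated])
    show "\<forall>\<^sub>F n in sequentially. norm (?g (int n)) \<le> r\<^sup>2 * inverse (of_nat n ^ 2)"
      using eventually_gt_at_top[of 0]
    proof eventually_elim
      case (elim n)
      have "1 / (1 + (n / r)\<^sup>2) \<le> 1 / ((n / r)\<^sup>2)"
        using elim assms by (intro divide_left_mono mult_pos_pos add_pos_nonneg) auto
      then show ?case using elim assms by (simp add: field_simps power2_eq_square)
    qed
  qed
  then have n: "(\<lambda>n::nat. ?g (int n)) summable_on UNIV"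
    by (subst summable_on_UNIV_nonneg_real_iff) auto
  have s1: "?g summable_on (range int)"
    using n by (subst summable_on_reindex) (auto simp: o_def)
  have s2: "?g summable_on (range (\<lambda>n. - int n))"
    using n by (subst summable_on_reindex) (auto simp: o_def inj_on_def)
  have U: "(UNIV :: int set) = range int \<union> (range (\<lambda>n. - int n) - range int)"
    by (auto simp: image_iff) (metis int_cases2)
  show ?thesis unfolding U
    by (rule summable_on_Un_disjoint[OF s1 summable_on_subset_banach[OF s2]]) auto
qed

lemma summable_inverse_squares_fr:
  "(\<lambda>k. 1 / ((1 + (fst (fr k))\<^sup>2) * (1 + (snd (fr k))\<^sup>2))) summable_on UNIV"
proof -
  let ?g = "\<lambda>r (m::int). 1 / (1 + (of_int m / r)\<^sup>2 :: real)"
  have "(\<lambda>k. ?g a (fst k) * ?g b (snd k)) summable_on UNIV"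
  proof (rule nonneg_bdd_above_summable_on)
    let ?S = "infsum (?g a) UNIV * infsum (?g b) UNIV"
    have "sum (\<lambda>k. ?g a (fst k) * ?g b (snd k)) F \<le> ?S" if "finite F" for F
    proof -
      have "sum (\<lambda>k. ?g a (fst k) * ?g b (snd k)) F \<le> sum (\<lambda>k. ?g a (fst k) * ?g b (snd k)) (fst ` F \<times> snd ` F)"
        using that by (intro sum_mono2 subset_fst_snd) auto
      also have "\<dots> = sum (?g a) (fst ` F) * sum (?g b) (snd ` F)"
        by (simp add: sum_product sum.cartesian_product case_prod_beta)
      also have "\<dots> \<le> ?S"
        using that a_pos b_pos
        by (intro mult_mono finite_sum_le_infsum summable_inverse_squares infsum_nonneg sum_nonneg) auto
      finally show ?thesis .
    qed
    then show "bdd_above (sum (\<lambda>k. ?g a (fst k) * ?g b (snd k)) ` {F. F \<subseteq> UNIV \<and> finite F})"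
      by (auto simp: bdd_above_def)
  qed auto
  then show ?thesis by (simp add: fr_def)
qed

text \<open>The operator 1 - D v D v has a symbol that is never 0, so boundedness of the
  coefficients of \<open>g\<close> is decay of those of \<open>f\<close>.\<close>

lemma fc_regularize:
  fixes f :: "real \<times> real \<Rightarrow> complex" and v :: "real \<times> real"
  assumes "smooth f" "periodic f"
  defines "g \<equiv> \<lambda>x. f x - D v (D v f) x"
  shows "smooth g" "periodic g" "fc g k = of_real (1 + (fr k \<bullet> v)\<^sup>2) * fc f k"
proof -
  have s: "smooth (D v f)" "periodic (D v f)" "smooth (D v (D v f))" "periodic (D v (D v f))"
    using assms smooth_D periodic_D by blast+
  show "smooth g" unfolding g_def by (intro smooth_diff s assms)
  show "periodic g" unfolding g_def by (intro periodic_diff s assms)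
  have "fc g k = fc f k - fc (D v (D v f)) k"
    unfolding g_def by (intro fc_diff L2_smooth s assms)
  also have "fc (D v (D v f)) k = - of_real ((fr k \<bullet> v)\<^sup>2) * fc f k"
  proof -
    have "fc (D v (D v f)) k = (\<i> * of_real (fr k \<bullet> v)) * ((\<i> * of_real (fr k \<bullet> v)) * fc f k)"
      by (simp only: fc_D s assms)
    also have "\<dots> = (\<i> * \<i>) * (of_real (fr k \<bullet> v) * of_real (fr k \<bullet> v)) * fc f k"
      by (simp only: mult_ac)
    finally show ?thesis by (simp add: power2_eq_square)
  qed
  finally show "fc g k = of_real (1 + (fr k \<bullet> v)\<^sup>2) * fc f k" by (simp add: algebra_simps)
qed

lemma smooth_fc_decay:
  fixes f :: "real \<times> real \<Rightarrow> complex"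
  assumes "smooth f" "periodic f"
  shows "(\<lambda>k. (1 + norm (fr k)) * cmod (fc f k)) summable_on UNIV"
proof -
  define T where "T v f = (\<lambda>x. f x - D v (D v f) x)" for v and f :: "real \<times> real \<Rightarrow> complex"
  have T: "smooth (T v f)" "periodic (T v f)" "fc (T v f) k = of_real (1 + (fr k \<bullet> v)\<^sup>2) * fc f k"
    if "smooth f" "periodic f" for v k and f :: "real \<times> real \<Rightarrow> complex"
    unfolding T_def using fc_regularize[OF that] by auto
  let ?v = "(1, 0)" and ?w = "(0, 1)"
  \<comment> \<open>Each direction is used twice. The coefficients then decay like P^(-2), with
    \<open>P\<close> as below: one factor absorbs the weight \<open>1 + norm (fr k)\<close>, the
    other is summable over the lattice.\<close>
  define g where "g = T ?v (T ?v (T ?w (T ?w f)))"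
  have g: "smooth g" "periodic g" unfolding g_def by (intro T assms)+
  have fcg: "fc g k = of_real ((1 + (fst (fr k))\<^sup>2)\<^sup>2 * (1 + (snd (fr k))\<^sup>2)\<^sup>2) * fc f k" for k
    unfolding g_def by (simp add: T assms inner_prod_def power2_eq_square)
  define B where "B = sqrt (nrm g)"
  have B: "cmod (fc g k) \<le> B" for k
    using bessel[OF L2_smooth[OF g(1)], of "{k}"] unfolding B_def by (simp add: real_le_rsqrt)
  show ?thesis
  proof (rule summable_on_comparison_test)
    show "(\<lambda>k. 2 * B * (1 / ((1 + (fst (fr k))\<^sup>2) * (1 + (snd (fr k))\<^sup>2)))) summable_on UNIV"
      by (intro summable_on_cmult_right summable_inverse_squares_fr)
    fix k
    let ?x = "fst (fr k)" and ?y = "snd (fr k)"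
    define P where "P = (1 + ?x\<^sup>2) * (1 + ?y\<^sup>2)"
    have P: "P > 0" by (simp add: P_def add_pos_nonneg)
    have "cmod (fc g k) = P\<^sup>2 * cmod (fc f k)"
      unfolding fcg norm_mult norm_of_real P_def by (simp add: power_mult_distrib)
    then have 1: "P\<^sup>2 * cmod (fc f k) \<le> B" using B[of k] by simp
    have "norm (fr k) \<le> \<bar>?x\<bar> + \<bar>?y\<bar>"
      using norm_triangle_ineq[of "(?x, 0)" "(0, ?y)"] by (simp add: norm_prod_def)
    moreover have "\<bar>?x\<bar> \<le> (1 + ?x\<^sup>2) / 2" "\<bar>?y\<bar> \<le> (1 + ?y\<^sup>2) / 2"
      using zero_le_power2[of "\<bar>?x\<bar> - 1"] zero_le_power2[of "\<bar>?y\<bar> - 1"] by (auto simp: power2_eq_square algebra_simps)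
    moreover have "1 + ?x\<^sup>2 + ?y\<^sup>2 \<le> P"
      by (simp add: P_def algebra_simps)
    ultimately have 2: "1 + norm (fr k) \<le> 2 * P" by simp (smt (verit) zero_le_power2)
    have "(1 + norm (fr k)) * cmod (fc f k) \<le> 2 * P * cmod (fc f k)"
      using 2 by (intro mult_right_mono) auto
    also have "\<dots> = 2 * (P\<^sup>2 * cmod (fc f k)) / P" using P by (simp add: power2_eq_square)
    also have "\<dots> \<le> 2 * B / P" using 1 P by (intro divide_right_mono) auto
    finally show "(1 + norm (fr k)) * cmod (fc f k) \<le> 2 * B * (1 / ((1 + ?x\<^sup>2) * (1 + ?y\<^sup>2)))"
      by (simp add: P_def)
    show "0 \<le> (1 + norm (fr k)) * cmod (fc f k)" by simp
  qed
qed

lemma smooth_fc_summable: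
  assumes "smooth f" "periodic f"
  shows "(\<lambda>k. cmod (fc f k)) summable_on UNIV" "(\<lambda>k. norm (fr k) * cmod (fc f k)) summable_on UNIV"
  by (rule summable_on_comparison_test[OF smooth_fc_decay[OF assms]]; simp add: distrib_right)+

lemma wiener_fc:
  assumes "smooth f" "periodic f" shows "wiener (fc f) = f"
  by (rule ext, rule fc_unique)
    (use smooth_fc_summable(1)[OF assms] in
      \<open>auto intro: continuous_wiener periodic_wiener smooth_continuous assms simp: fc_wiener\<close>)

lemma smooth_tp_approx:
  assumes "smooth f" "periodic f" "d > 0"
  obtains J where "finite J" "\<And>x. cmod (f x - tp J (fc f) x) \<le> d"
  using wiener_approx[OF smooth_fc_summable(1)[OF assms(1,2)] assms(3)]
  unfolding wiener_fc[OF assms(1,2)] using that by auto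

text \<open>The Wiener algebra norm of the gradient. It measures how far multiplication by
  \<open>f\<close> is from commuting with a Lipschitz multiplier, and it bounds the oscillation of
  \<open>f\<close> along lines.\<close>

definition grad_sum :: "(real \<times> real \<Rightarrow> complex) \<Rightarrow> real" where
  "grad_sum f = (\<Sum>\<^sub>\<infinity>k. norm (fr k) * cmod (fc f k))"

lemma grad_sum_bound:
  assumes "smooth f" "periodic f" "finite J"
  shows "(\<Sum>k\<in>J. norm (fr k) * cmod (fc f k)) \<le> grad_sum f"
  unfolding grad_sum_def using assms by (intro finite_sum_le_infsum smooth_fc_summable) auto

lemma grad_sum_nonneg: "0 \<le> grad_sum f"
  unfolding grad_sum_def by (intro infsum_nonneg) auto

section \<open>Fourier multipliers and commutators\<close>

text \<open>Restricting the symbol to a finite set makes every output a trigonometric polynomial,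
  hence smooth, even when \<open>f\<close> is merely in L2.\<close>

definition multiplier :: "(int \<times> int) set \<Rightarrow> (int \<times> int \<Rightarrow> complex) \<Rightarrow> (real \<times> real \<Rightarrow> complex) \<Rightarrow> real \<times> real \<Rightarrow> complex" where
  "multiplier K m f = tp K (\<lambda>k. m k * fc f k)"

lemma fc_multiplier:
  assumes "finite K" "\<And>k. k \<notin> K \<Longrightarrow> m k = 0"
  shows "fc (multiplier K m f) k = m k * fc f k"
  using assms by (auto simp: multiplier_def fc_tp)

lemma L2_multiplier: "L2 (multiplier K m f)" by (simp add: multiplier_def L2_tp)

lemma multiplier_add:
  "L2 f \<Longrightarrow> L2 g \<Longrightarrow> multiplier K m (\<lambda>x. f x + g x) x = multiplier K m f x + multiplier K m g x"
  by (simp add: multiplier_def tp_def fc_add algebra_simps sum.distrib)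

lemma multiplier_cmult: "multiplier K m (\<lambda>x. c * f x) x = c * multiplier K m f x"
  by (simp add: multiplier_def tp_def fc_cmult sum_distrib_left mult_ac)

lemma multiplier_sum:
  "(\<And>i. i \<in> I \<Longrightarrow> L2 (f i)) \<Longrightarrow> multiplier K m (\<lambda>x. \<Sum>i\<in>I. f i x) x = (\<Sum>i\<in>I. multiplier K m (f i) x)"
  by (simp add: multiplier_def tp_def fc_sum sum_distrib_left sum_distrib_right) (rule sum.swap)

lemma nrm_multiplier:
  assumes "L2 f" "finite K" "\<And>k. k \<notin> K \<Longrightarrow> m k = 0" "\<And>k. cmod (m k) \<le> B"
  shows "nrm (multiplier K m f) \<le> B\<^sup>2 * nrm f"
  using assms by (intro nrm_le_fc L2_multiplier) (auto simp: fc_multiplier norm_mult intro: mult_right_mono)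

text \<open>For \<open>f = e j\<close> the commutator acts on coefficients through the difference
  \<open>m (k - j) - m k\<close>, of modulus at most \<open>C * norm (fr j)\<close>. Superposing
  these with the weights \<open>cmod (fc f j)\<close> produces \<open>grad_sum f\<close>. The bound
  \<open>B\<close> on the symbol serves only the remainder of the truncated series and does not
  enter the result.\<close>

lemma commutator:
  assumes f: "smooth f" "periodic f" and g: "L2 g" and K: "finite K" "\<And>k. k \<notin> K \<Longrightarrow> m k = 0"
    and lip: "\<And>k l. cmod (m k - m l) \<le> C * norm (fr k - fr l)" and C: "C \<ge> 0"
  shows "nrm (\<lambda>x. f x * multiplier K m g x - multiplier K m (\<lambda>x. f x * g x) x) \<le> (C * grad_sum f)\<^sup>2 * nrm g"
proof -
  let ?m = "multiplier K m"
  have fcm: "fc (multiplier K m f) k = m k * fc f k" for f k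
    by (rule fc_multiplier) (use K in auto)
  obtain B where B: "\<And>k. cmod (m k) \<le> B"
  proof -
    have "cmod (m k) \<le> (\<Sum>k\<in>K. cmod (m k))" for k
      using K by (cases "k \<in> K") (auto intro: member_le_sum sum_nonneg)
    then show ?thesis by (rule that)
  qed
  have B0: "0 \<le> B" using B[of 0] norm_ge_zero order_trans by blast
  have mean: "continuous_on UNIV f" by (rule smooth_continuous[OF f(1)])
  have fm: "f \<in> borel_measurable borel" by (rule borel_measurable_continuous_onI[OF mean])
  obtain Bf where Bf: "\<And>x. cmod (f x) \<le> Bf"
  proof -
    obtain J where J: "finite J" "\<And>x. cmod (f x - tp J (fc f) x) \<le> 1" using smooth_tp_approx[OF f, of 1] by auto
    have "cmod (f x) \<le> 1 + (\<Sum>k\<in>J. cmod (fc f k))" for x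
    proof -
      have "cmod (tp J (fc f) x) \<le> (\<Sum>k\<in>J. cmod (fc f k))"
        unfolding tp_def by (rule order_trans[OF norm_sum]) (simp add: norm_mult)
      then show ?thesis using J(2)[of x] norm_triangle_ineq2[of "f x" "tp J (fc f) x"] by linarith
    qed
    then show ?thesis by (rule that)
  qed
  have Lfg: "L2 (\<lambda>x. f x * g x)" by (rule L2_mult_bounded(1)[OF g fm Bf])
  let ?h = "\<lambda>x. f x * ?m g x - ?m (\<lambda>x. f x * g x) x"
  define G where "G = sqrt (nrm g)"
  have G0: "G \<ge> 0" by (simp add: G_def)
  have "sqrt (nrm ?h) \<le> C * grad_sum f * G + d" if d: "d > 0" for d
  proof -
    \<comment> \<open>The truncation error of \<open>f\<close> enters in two terms, each at most
      \<open>d' * B * G\<close>; this choice keeps their sum below \<open>d\<close>. The added ones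
      avoid division by 0.\<close>
    define d' where "d' = d / (2 * (B + 1) * (G + 1))"
    have d': "d' > 0" unfolding d'_def using d B0 G0 by (intro divide_pos_pos mult_pos_pos) auto
    obtain J where J: "finite J" "\<And>x. cmod (f x - tp J (fc f) x) \<le> d'" using smooth_tp_approx[OF f d'] by auto
    define r where "r x = f x - tp J (fc f) x" for x
    have rm: "r \<in> borel_measurable borel"
      unfolding r_def[abs_def] using fm L2_measurable[OF L2_tp] by simp
    have rb: "cmod (r x) \<le> d'" for x using J(2) by (simp add: r_def)
    have Lrg: "L2 (\<lambda>x. r x * g x)" by (rule L2_mult_bounded(1)[OF g rm rb])
    have Lrm: "L2 (\<lambda>x. r x * ?m g x)" by (rule L2_mult_bounded(1)[OF L2_multiplier rm rb])
    define q where "q j x = fc f j * (e j x * ?m g x - ?m (\<lambda>x. e j x * g x) x)" for j x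
    have Lq: "L2 (q j)" for j unfolding q_def[abs_def]
      by (intro L2_cmult L2_diff L2_e_mult L2_multiplier)
    have nq: "sqrt (nrm (q j)) \<le> (norm (fr j) * cmod (fc f j)) * (C * G)" for j
    proof -
      have "nrm (\<lambda>x. e j x * ?m g x - ?m (\<lambda>x. e j x * g x) x) \<le> (C * norm (fr j))\<^sup>2 * nrm (\<lambda>x. e j x * g x)"
      proof (rule nrm_le_fc)
        fix k
        have "fc (\<lambda>x. e j x * ?m g x - ?m (\<lambda>x. e j x * g x) x) k = (m (k - j) - m k) * fc (\<lambda>x. e j x * g x) k"
          by (simp only: fc_diff[OF L2_e_mult[OF L2_multiplier] L2_multiplier] fcm fc_e_mult left_diff_distrib)
        moreover have "cmod (m (k - j) - m k) \<le> C * norm (fr j)"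
          using lip[of "k - j" k] by (simp add: fr_diff)
        ultimately show "cmod (fc (\<lambda>x. e j x * ?m g x - ?m (\<lambda>x. e j x * g x) x) k) \<le> C * norm (fr j) * cmod (fc (\<lambda>x. e j x * g x) k)"
          by (simp add: norm_mult mult_right_mono)
      qed (intro L2_diff L2_e_mult L2_multiplier g)+
      then have "nrm (q j) \<le> (cmod (fc f j))\<^sup>2 * ((C * norm (fr j))\<^sup>2 * nrm g)"
        unfolding q_def nrm_cmult nrm_e_mult by (intro mult_left_mono) auto
      also have "\<dots> = ((norm (fr j) * cmod (fc f j)) * (C * G))\<^sup>2"
        unfolding G_def by (simp add: power_mult_distrib mult_ac)
      finally show ?thesis using C G0 by (intro real_le_lsqrt) auto
    qed
    have "f x * g x = (\<Sum>j\<in>J. fc f j * (e j x * g x)) + r x * g x" for x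
      by (simp add: r_def tp_def sum_distrib_right sum_distrib_left algebra_simps)
    then have "?m (\<lambda>x. f x * g x) x = (\<Sum>j\<in>J. fc f j * ?m (\<lambda>x. e j x * g x) x) + ?m (\<lambda>x. r x * g x) x" for x
      by (simp add: multiplier_add L2_sum L2_cmult L2_e_mult g Lrg multiplier_sum multiplier_cmult)
    moreover have "f x * ?m g x = (\<Sum>j\<in>J. fc f j * (e j x * ?m g x)) + r x * ?m g x" for x
      by (simp add: r_def tp_def sum_distrib_right sum_distrib_left algebra_simps)
    ultimately have h: "?h = (\<lambda>x. (\<Sum>j\<in>J. q j x) + (r x * ?m g x - ?m (\<lambda>x. r x * g x) x))"
      by (auto simp: q_def right_diff_distrib sum_subtractf)
    have "sqrt (nrm ?h) \<le> sqrt (nrm (\<lambda>x. \<Sum>j\<in>J. q j x)) + sqrt (nrm (\<lambda>x. r x * ?m g x + - ?m (\<lambda>x. r x * g x) x))"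
      unfolding h using sqrt_nrm_add[OF L2_sum L2_diff[OF Lrm L2_multiplier], of J q] Lq by simp
    also have "sqrt (nrm (\<lambda>x. \<Sum>j\<in>J. q j x)) \<le> (\<Sum>j\<in>J. sqrt (nrm (q j)))"
      by (rule sqrt_nrm_sum) (rule Lq)
    also have "\<dots> \<le> (\<Sum>j\<in>J. (norm (fr j) * cmod (fc f j)) * (C * G))" by (intro sum_mono nq)
    also have "\<dots> \<le> grad_sum f * (C * G)"
      unfolding sum_distrib_right[symmetric] using C G0 grad_sum_bound[OF f J(1)] by (intro mult_right_mono) auto
    also have "sqrt (nrm (\<lambda>x. r x * ?m g x + - ?m (\<lambda>x. r x * g x) x)) \<le> sqrt (nrm (\<lambda>x. r x * ?m g x)) + sqrt (nrm (?m (\<lambda>x. r x * g x)))"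
      using sqrt_nrm_add[OF Lrm L2_uminus[OF L2_multiplier]] by (simp add: nrm_uminus)
    also have "sqrt (nrm (\<lambda>x. r x * ?m g x)) \<le> d' * B * G"
    proof -
      have "nrm (\<lambda>x. r x * ?m g x) \<le> d'\<^sup>2 * nrm (?m g)"
        by (rule L2_mult_bounded(2)[OF L2_multiplier rm rb])
      also have "\<dots> \<le> d'\<^sup>2 * (B\<^sup>2 * nrm g)"
        by (intro mult_left_mono nrm_multiplier[OF g K(1) K(2) B] zero_le_power2)
      also have "\<dots> = (d' * B * G)\<^sup>2" by (simp add: G_def power_mult_distrib)
      finally show ?thesis using d' B0 G0 by (intro real_le_lsqrt) auto
    qed
    also have "sqrt (nrm (?m (\<lambda>x. r x * g x))) \<le> d' * B * G"
    proof -
      have "nrm (?m (\<lambda>x. r x * g x)) \<le> B\<^sup>2 * nrm (\<lambda>x. r x * g x)"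
        by (rule nrm_multiplier[OF Lrg K(1) K(2) B])
      also have "\<dots> \<le> B\<^sup>2 * (d'\<^sup>2 * nrm g)"
        by (intro mult_left_mono L2_mult_bounded(2)[OF g rm rb] zero_le_power2)
      also have "\<dots> = (d' * B * G)\<^sup>2" by (simp add: G_def power_mult_distrib)
      finally show ?thesis using d' B0 G0 by (intro real_le_lsqrt) auto
    qed
    also have "grad_sum f * (C * G) + (d' * B * G + d' * B * G) \<le> C * grad_sum f * G + d"
    proof -
      have "B * G \<le> (B + 1) * (G + 1)" using B0 G0 by (intro mult_mono) auto
      then have "2 * d' * (B * G) \<le> 2 * d' * ((B + 1) * (G + 1))" using d' by (intro mult_left_mono) auto
      also have "\<dots> = d" unfolding d'_def using B0 G0 by (simp add: field_simps add_nonneg_eq_0_iff)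
      finally show ?thesis by (simp add: mult_ac)
    qed
    finally show ?thesis by simp
  qed
  then have le: "sqrt (nrm ?h) \<le> C * grad_sum f * G" by (rule field_le_epsilon)
  have "nrm ?h = (sqrt (nrm ?h))\<^sup>2" by simp
  also have "\<dots> \<le> (C * grad_sum f * G)\<^sup>2" by (intro power_mono le) simp
  also have "\<dots> = (C * grad_sum f)\<^sup>2 * nrm g" by (simp add: G_def power_mult_distrib)
  finally show ?thesis .
qed

subsection \<open>Propagation in frequency space\<close>

lemma smooth_bounded:
  assumes "smooth f" "periodic f"
  shows "\<exists>B\<ge>0. \<forall>x. cmod (f x) \<le> B"
proof -
  obtain J where J: "finite J" "\<And>x. cmod (f x - tp J (fc f) x) \<le> 1" using smooth_tp_approx[OF assms, of 1] by auto
  have "cmod (f x) \<le> 1 + (\<Sum>k\<in>J. cmod (fc f k))" for x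
  proof -
    have "cmod (tp J (fc f) x) \<le> (\<Sum>k\<in>J. cmod (fc f k))"
      unfolding tp_def by (rule order_trans[OF norm_sum]) (simp add: norm_mult)
    then show ?thesis using J(2)[of x] norm_triangle_ineq2[of "f x" "tp J (fc f) x"] by linarith
  qed
  moreover have "0 \<le> 1 + (\<Sum>k\<in>J. cmod (fc f k))" by (intro add_nonneg_nonneg sum_nonneg) auto
  ultimately show ?thesis by blast
qed

text \<open>By \<open>integral_e_square\<close> this is the Fourier coefficient of index
  \<open>- j\<close> of \<bar>v\<bar>^2 for \<open>v = tp K c\<close>. A weight is integrated
  against this density only, so invariance has to be shown for nothing else.\<close>

definition corr :: "(int \<times> int) set \<Rightarrow> (int \<times> int \<Rightarrow> complex) \<Rightarrow> int \<times> int \<Rightarrow> complex" where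
  "corr K c j = (\<Sum>k\<in>K. c k * cnj (c (k + j)))"

lemma tp_times_cnj: "tp K c x * cnj (tp K c x) = (\<Sum>k\<in>K. \<Sum>l\<in>K. (c k * cnj (c l)) * e (k - l) x)"
  by (simp add: tp_def sum_product cnj_e algebra_simps diff_conv_add_uminus e_add del: add_uminus_conv_diff)

lemma integral_tp_square:
  assumes f: "L2 f"
  shows "(LINT x|M. f x * (tp K c x * cnj (tp K c x))) = (\<Sum>k\<in>K. \<Sum>l\<in>K. (c k * cnj (c l)) * fc f (l - k))"
proof -
  have i: "integrable M (\<lambda>x. f x * e (k - l) x)" for k l by (rule integrable_L2_mult[OF f L2_e])
  have "f x * (tp K c x * cnj (tp K c x)) = (\<Sum>k\<in>K. \<Sum>l\<in>K. (c k * cnj (c l)) * (f x * e (k - l) x))" for x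
    unfolding tp_times_cnj by (simp add: sum_distrib_left mult_ac)
  then show ?thesis
    using i by (simp add: fc_def)
qed

lemma integral_e_square:
  assumes "finite K" "\<And>k. k \<notin> K \<Longrightarrow> c k = 0"
  shows "(LINT x|M. e j x * (tp K c x * cnj (tp K c x))) = corr K c j"
proof -
  have "(LINT x|M. e j x * (tp K c x * cnj (tp K c x))) = (\<Sum>k\<in>K. \<Sum>l\<in>K. (if l = k + j then c k * cnj (c l) else 0))"
    unfolding integral_tp_square[OF L2_e] fc_e by (intro sum.cong refl) (auto simp: algebra_simps)
  also have "\<dots> = corr K c j"
    unfolding corr_def using assms by (intro sum.cong refl) (simp add: sum.delta)
  finally show ?thesis .
qed

lemma sum_shift_le:
  fixes u :: "int \<times> int \<Rightarrow> real"
  assumes "finite K" "\<And>k. 0 \<le> u k" "\<And>k. k \<notin> K \<Longrightarrow> u k = 0"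
  shows "(\<Sum>k\<in>K. u (k + j)) \<le> (\<Sum>k\<in>K. u k)"
proof -
  have "(\<Sum>k\<in>K. u (k + j)) = (\<Sum>k\<in>(\<lambda>k. k + j) ` K. u k)"
    by (subst sum.reindex) (auto simp: inj_on_def)
  also have "\<dots> = (\<Sum>k\<in>(\<lambda>k. k + j) ` K \<inter> K. u k)"
    using assms by (intro sum.mono_neutral_right) auto
  also have "\<dots> \<le> (\<Sum>k\<in>K. u k)" using assms by (intro sum_mono2) auto
  finally show ?thesis .
qed

lemma young_sum:
  fixes u v :: "int \<times> int \<Rightarrow> complex"
  assumes "t > 0"
  shows "(\<Sum>k\<in>K. cmod (u k) * cmod (v k)) \<le> (t * (\<Sum>k\<in>K. (cmod (u k))\<^sup>2) + (\<Sum>k\<in>K. (cmod (v k))\<^sup>2) / t) / 2"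
proof -
  have "x * y \<le> (t * x\<^sup>2 + y\<^sup>2 / t) / 2" for x y :: real
  proof -
    have "0 \<le> (t * x - y)\<^sup>2 / t" using assms by simp
    also have "\<dots> = t * x\<^sup>2 + y\<^sup>2 / t - 2 * (x * y)" using assms by (simp add: field_simps power2_eq_square)
    finally show ?thesis by simp
  qed
  then have "(\<Sum>k\<in>K. cmod (u k) * cmod (v k)) \<le> (\<Sum>k\<in>K. (t * (cmod (u k))\<^sup>2 + (cmod (v k))\<^sup>2 / t) / 2)"
    by (intro sum_mono) blast
  also have "\<dots> = (t * (\<Sum>k\<in>K. (cmod (u k))\<^sup>2) + (\<Sum>k\<in>K. (cmod (v k))\<^sup>2) / t) / 2"
    by (simp add: sum.distrib sum_distrib_left sum_divide_distrib add_divide_distrib)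
  finally show ?thesis .
qed

text \<open>Propagation along the direction \<open>\<theta>\<close>: comparing \<open>\<bar>k + j\<bar>\<^sup>2 - \<bar>k\<bar>\<^sup>2\<close>, computed from the equation,
  with \<open>2 R \<theta> \<bullet> j\<close>.\<close>

lemma transport_mode:
  assumes K: "finite K" "\<And>k. k \<notin> K \<Longrightarrow> c k = 0" and R: "R > 0" and t: "t > 0" and \<delta>: "\<delta> \<ge> 0"
    and near: "\<And>k. k \<in> K \<Longrightarrow> norm (fr k - R *\<^sub>R \<theta>) \<le> \<delta> * R"
    and eq: "\<And>k. of_real ((norm (fr k))\<^sup>2 - R\<^sup>2) * c k = of_real R * h k"
  shows "\<bar>fr j \<bullet> \<theta>\<bar> * cmod (corr K c j) \<le>
    (\<delta> * norm (fr j) + t) * (\<Sum>k\<in>K. (cmod (c k))\<^sup>2) + (\<Sum>k\<in>K. (cmod (h k))\<^sup>2) / t"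
proof -
  let ?N = "\<Sum>k\<in>K. (cmod (c k))\<^sup>2" and ?H = "\<Sum>k\<in>K. (cmod (h k))\<^sup>2"
  have h0: "h k = 0" if "k \<notin> K" for k using eq[of k] K(2)[OF that] R by simp
  define d where "d k = (norm (fr (k + j)))\<^sup>2 - (norm (fr k))\<^sup>2" for k
  define s where "s k = fr j \<bullet> ((fr k - R *\<^sub>R \<theta>) + (fr (k + j) - R *\<^sub>R \<theta>))" for k
  have ds: "d k = 2 * R * (fr j \<bullet> \<theta>) + s k" for k
    unfolding d_def s_def power2_norm_eq_inner fr_add
    by (simp add: inner_add_left inner_add_right inner_diff_right inner_commute)
  \<comment> \<open>This sum is evaluated twice. The equation at \<open>k\<close> and at
    \<open>k + j\<close> makes it R times correlations of \<open>c\<close> with \<open>h\<close>; by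
    \<open>ds\<close> it is also \<open>2 * R * (fr j \<bullet> \<theta>)\<close> times
    \<open>corr K c j\<close>, up to an error of order \<delta> R.\<close>
  define S where "S = (\<Sum>k\<in>K. of_real (d k) * (c k * cnj (c (k + j))))"
  have "of_real (d k) * (c k * cnj (c (k + j))) = of_real R * (c k * cnj (h (k + j)) - h k * cnj (c (k + j)))" for k
  proof -
    have "of_real (d k) * (c k * cnj (c (k + j))) =
        c k * cnj (of_real ((norm (fr (k + j)))\<^sup>2 - R\<^sup>2) * c (k + j)) - (of_real ((norm (fr k))\<^sup>2 - R\<^sup>2) * c k) * cnj (c (k + j))"
      by (simp add: d_def algebra_simps)
    then show ?thesis unfolding eq by (simp add: algebra_simps)
  qed
  then have "S = of_real R * ((\<Sum>k\<in>K. c k * cnj (h (k + j))) - (\<Sum>k\<in>K. h k * cnj (c (k + j))))"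
    by (simp add: S_def sum_distrib_left[symmetric] sum_subtractf)
  then have "cmod S \<le> R * (cmod (\<Sum>k\<in>K. c k * cnj (h (k + j))) + cmod (\<Sum>k\<in>K. h k * cnj (c (k + j))))"
    using R norm_triangle_ineq4 by (simp add: norm_mult)
  also have "cmod (\<Sum>k\<in>K. c k * cnj (h (k + j))) \<le> (\<Sum>k\<in>K. cmod (c k) * cmod (h (k + j)))"
    by (rule order_trans[OF norm_sum]) (simp add: norm_mult)
  also have "\<dots> \<le> (t * ?N + (\<Sum>k\<in>K. (cmod (h (k + j)))\<^sup>2) / t) / 2"
    by (rule young_sum[OF t])
  also have "(\<Sum>k\<in>K. (cmod (h (k + j)))\<^sup>2) \<le> ?H"
    by (rule sum_shift_le[OF K(1)]) (use h0 in auto)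
  also have "cmod (\<Sum>k\<in>K. h k * cnj (c (k + j))) \<le> (\<Sum>k\<in>K. cmod (c (k + j)) * cmod (h k))"
    by (rule order_trans[OF norm_sum]) (simp add: norm_mult mult.commute)
  also have "\<dots> \<le> (t * (\<Sum>k\<in>K. (cmod (c (k + j)))\<^sup>2) + ?H / t) / 2"
    by (rule young_sum[OF t])
  also have "(\<Sum>k\<in>K. (cmod (c (k + j)))\<^sup>2) \<le> ?N"
    by (rule sum_shift_le[OF K(1)]) (use K(2) in auto)
  finally have S1: "cmod S \<le> R * (t * ?N + ?H / t)"
    using R t by (simp add: divide_right_mono mult_left_mono add_mono)
  have "of_real (2 * R * (fr j \<bullet> \<theta>)) * corr K c j = S - (\<Sum>k\<in>K. of_real (s k) * (c k * cnj (c (k + j))))"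
    unfolding S_def corr_def ds by (simp add: sum_distrib_left sum_subtractf[symmetric] algebra_simps)
  then have "2 * R * (\<bar>fr j \<bullet> \<theta>\<bar> * cmod (corr K c j)) = cmod (S - (\<Sum>k\<in>K. of_real (s k) * (c k * cnj (c (k + j)))))"
  proof -
    assume "of_real (2 * R * (fr j \<bullet> \<theta>)) * corr K c j = S - (\<Sum>k\<in>K. of_real (s k) * (c k * cnj (c (k + j))))"
    from arg_cong[OF this, of cmod] show ?thesis
      using R by (simp add: norm_mult abs_mult)
  qed
  also have "\<dots> \<le> cmod S + cmod (\<Sum>k\<in>K. of_real (s k) * (c k * cnj (c (k + j))))" by (rule norm_triangle_ineq4)
  also have "cmod (\<Sum>k\<in>K. of_real (s k) * (c k * cnj (c (k + j)))) \<le> (\<Sum>k\<in>K. 2 * R * \<delta> * norm (fr j) * (cmod (c k) * cmod (c (k + j))))"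
  proof (rule order_trans[OF norm_sum], rule sum_mono)
    fix k assume k: "k \<in> K"
    show "cmod (of_real (s k) * (c k * cnj (c (k + j)))) \<le> 2 * R * \<delta> * norm (fr j) * (cmod (c k) * cmod (c (k + j)))"
    proof (cases "k + j \<in> K")
      case True
      have "\<bar>s k\<bar> \<le> norm (fr j) * norm ((fr k - R *\<^sub>R \<theta>) + (fr (k + j) - R *\<^sub>R \<theta>))"
        unfolding s_def by (rule Cauchy_Schwarz_ineq2)
      also have "\<dots> \<le> norm (fr j) * (\<delta> * R + \<delta> * R)"
        by (intro mult_left_mono norm_triangle_mono near k True) auto
      finally have "\<bar>s k\<bar> \<le> 2 * R * \<delta> * norm (fr j)" by (simp add: algebra_simps)
      then show ?thesis by (simp add: norm_mult mult_right_mono)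
    qed (simp add: K(2))
  qed
  also have "\<dots> = 2 * R * \<delta> * norm (fr j) * (\<Sum>k\<in>K. cmod (c k) * cmod (c (k + j)))"
    by (simp add: sum_distrib_left)
  also have "\<dots> \<le> 2 * R * \<delta> * norm (fr j) * ?N"
  proof (rule mult_left_mono)
    have "(\<Sum>k\<in>K. cmod (c k) * cmod (c (k + j))) \<le> (1 * ?N + (\<Sum>k\<in>K. (cmod (c (k + j)))\<^sup>2) / 1) / 2"
      by (rule young_sum) simp
    also have "(\<Sum>k\<in>K. (cmod (c (k + j)))\<^sup>2) \<le> ?N"
      by (rule sum_shift_le[OF K(1)]) (use K(2) in auto)
    finally show "(\<Sum>k\<in>K. cmod (c k) * cmod (c (k + j))) \<le> ?N" by simp
  qed (use R \<delta> in auto)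
  finally have "2 * R * (\<bar>fr j \<bullet> \<theta>\<bar> * cmod (corr K c j)) \<le> R * (t * ?N + ?H / t) + 2 * R * \<delta> * norm (fr j) * ?N"
    using S1 by linarith
  also have "\<dots> \<le> 2 * R * ((\<delta> * norm (fr j) + t) * ?N + ?H / t)"
  proof -
    have "0 \<le> t * ?N + ?H / t" using t by (intro add_nonneg_nonneg mult_nonneg_nonneg divide_nonneg_pos sum_nonneg) auto
    then have "0 \<le> R * (t * ?N + ?H / t)" using R by simp
    moreover have "2 * R * ((p + t) * N + y) = R * (t * N + y) + R * (t * N + y) + 2 * R * p * N" for p N y
      by (simp add: algebra_simps)
    ultimately show ?thesis by (simp only: mult.assoc)
  qed
  finally have "2 * R * (\<bar>fr j \<bullet> \<theta>\<bar> * cmod (corr K c j)) \<le> 2 * R * ((\<delta> * norm (fr j) + t) * ?N + ?H / t)" .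
  moreover have "0 < 2 * R" using R by simp
  ultimately show ?thesis by (rule mult_left_le_imp_le)
qed

text \<open>Averaging along the direction \<theta>, seen on Fourier coefficients: exactly the modes
  that are constant along \<theta> survive.\<close>

definition along :: "real \<times> real \<Rightarrow> (int \<times> int \<Rightarrow> complex) \<Rightarrow> int \<times> int \<Rightarrow> complex" where
  "along \<theta> c j = (if fr j \<bullet> \<theta> = 0 then c j else 0)"

lemma summable_along: "(\<lambda>k. cmod (c k)) summable_on UNIV \<Longrightarrow> (\<lambda>k. cmod (along \<theta> c k)) summable_on UNIV"
  by (rule summable_on_comparison_test) (auto simp: along_def)

lemma integral_close:
  assumes f: "continuous_on UNIV f" and g: "continuous_on UNIV g" and v: "continuous_on UNIV v"
    and d: "\<And>x. cmod (f x - g x) \<le> d"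
  shows "cmod ((LINT x|M. f x * (v x * cnj (v x))) - (LINT x|M. g x * (v x * cnj (v x)))) \<le> d * nrm v"
proof -
  have i: "integrable M (\<lambda>x. f x * (v x * cnj (v x)))" "integrable M (\<lambda>x. g x * (v x * cnj (v x)))"
    by (intro integrable_smooth continuous_intros f g v)+
  have "cmod ((LINT x|M. f x * (v x * cnj (v x))) - (LINT x|M. g x * (v x * cnj (v x)))) =
      cmod (LINT x|M. (f x - g x) * (v x * cnj (v x)))"
    using i by (simp add: left_diff_distrib)
  also have "\<dots> \<le> (LINT x|M. d * (cmod (v x))\<^sup>2)"
  proof (rule Bochner_Integration.integral_norm_bound_integral)
    show "integrable M (\<lambda>x. (f x - g x) * (v x * cnj (v x)))"
      by (intro integrable_smooth continuous_intros f g v)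
    show "integrable M (\<lambda>x. d * (cmod (v x))\<^sup>2)"
      by (intro integrable_smooth continuous_intros v)
    show "cmod ((f x - g x) * (v x * cnj (v x))) \<le> d * (cmod (v x))\<^sup>2" for x
      using d by (simp add: norm_mult power2_eq_square mult_right_mono)
  qed
  finally show ?thesis by (simp add: nrm_def)
qed

lemma norm_chain: "cmod (x - y) \<le> cmod (x - p) + cmod (y - q) + cmod (p - q)"
proof -
  have "cmod (x - y) = cmod ((x - p) - (y - q) + (p - q))" by simp
  then show ?thesis using norm_triangle_ineq[of "(x - p) - (y - q)" "p - q"] norm_triangle_ineq4[of "x - p" "y - q"]
    by linarith
qed

text \<open>The modes removed by \<open>along\<close> have
  \<open>fr j \<bullet> \<theta> \<noteq> 0\<close> and are small by \<open>transport_mode\<close>,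
  but with a constant containing the inverse of that divisor. So the weight is first truncated to
  finitely many modes, and only then are \<delta>0 and the constant chosen; they depend on \<theta>
  and \<epsilon>.\<close>

lemma transport:
  assumes psi: "smooth \<psi>" "periodic \<psi>" and \<epsilon>: "\<epsilon> > 0"
  shows "\<exists>\<delta>0>0. \<exists>C\<ge>0. \<forall>\<delta> K c R h. 0 \<le> \<delta> \<longrightarrow> \<delta> \<le> \<delta>0 \<longrightarrow> finite K \<longrightarrow> (\<forall>k. k \<notin> K \<longrightarrow> c k = 0) \<longrightarrow> R > 0 \<longrightarrow>
     (\<forall>k\<in>K. norm (fr k - R *\<^sub>R \<theta>) \<le> \<delta> * R) \<longrightarrow> (\<forall>k. of_real ((norm (fr k))\<^sup>2 - R\<^sup>2) * c k = of_real R * h k) \<longrightarrow>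
     cmod ((LINT x|M. \<psi> x * (tp K c x * cnj (tp K c x))) - (LINT x|M. wiener (along \<theta> (fc \<psi>)) x * (tp K c x * cnj (tp K c x))))
       \<le> \<epsilon> * nrm (tp K c) + C * (\<Sum>k\<in>K. (cmod (h k))\<^sup>2)"
proof -
  let ?c = "along \<theta> (fc \<psi>)"
  have s: "(\<lambda>k. cmod (fc \<psi> k)) summable_on UNIV" by (rule smooth_fc_summable(1)[OF psi])
  have s': "(\<lambda>k. cmod (?c k)) summable_on UNIV" by (rule summable_along[OF s])
  have e4: "\<epsilon> / 4 > 0" using \<epsilon> by simp
  obtain J1 where J1: "finite J1" "\<And>J' x. finite J' \<Longrightarrow> J1 \<subseteq> J' \<Longrightarrow> cmod (\<psi> x - tp J' (fc \<psi>) x) \<le> \<epsilon> / 4"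
    using wiener_approx[OF s e4] unfolding wiener_fc[OF psi] by blast
  obtain J2 where J2: "finite J2" "\<And>J' x. finite J' \<Longrightarrow> J2 \<subseteq> J' \<Longrightarrow> cmod (wiener ?c x - tp J' ?c x) \<le> \<epsilon> / 4"
    using wiener_approx[OF s' e4] by blast
  \<comment> \<open>Both series are truncated to the same modes, so that their difference can be
    taken term by term.\<close>
  define J where "J = J1 \<union> J2"
  have J: "finite J" "\<And>x. cmod (\<psi> x - tp J (fc \<psi>) x) \<le> \<epsilon> / 4" "\<And>x. cmod (wiener ?c x - tp J ?c x) \<le> \<epsilon> / 4"
    unfolding J_def
    by (rule finite_UnI[OF J1(1) J2(1)], rule J1(2)[OF finite_UnI[OF J1(1) J2(1)] Un_upper1],
      rule J2(2)[OF finite_UnI[OF J1(1) J2(1)] Un_upper2])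
  define w where "w j = (if fr j \<bullet> \<theta> = 0 then 0 else cmod (fc \<psi> j) / \<bar>fr j \<bullet> \<theta>\<bar>)" for j
  have w0: "w j \<ge> 0" for j by (simp add: w_def)
  define A where "A = (\<Sum>j\<in>J. w j)"
  define B where "B = (\<Sum>j\<in>J. w j * norm (fr j))"
  have AB: "A \<ge> 0" "B \<ge> 0" using w0 by (auto simp: A_def B_def intro!: sum_nonneg)
  \<comment> \<open>The error \<epsilon> is spent in quarters: two on the truncations, one on
    \<open>A * t\<close>, one on \<open>B * \<delta>0\<close>. A small \<open>t\<close> is paid for
    by the factor \<open>A / t\<close> in front of the source.\<close>
  define t where "t = \<epsilon> / (4 * (A + 1))"
  define \<delta>0 where "\<delta>0 = \<epsilon> / (4 * (B + 1))"
  have t: "t > 0" "A * t \<le> \<epsilon> / 4" using \<epsilon> AB by (auto simp: t_def field_simps)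
  have d0: "\<delta>0 > 0" "B * \<delta>0 \<le> \<epsilon> / 4" using \<epsilon> AB by (auto simp: \<delta>0_def field_simps)
  have "cmod ((LINT x|M. \<psi> x * (tp K c x * cnj (tp K c x))) - (LINT x|M. wiener ?c x * (tp K c x * cnj (tp K c x))))
       \<le> \<epsilon> * nrm (tp K c) + (A / t) * (\<Sum>k\<in>K. (cmod (h k))\<^sup>2)"
    if \<delta>: "0 \<le> \<delta>" "\<delta> \<le> \<delta>0" and K: "finite K" "\<And>k. k \<notin> K \<Longrightarrow> c k = 0" and R: "R > 0"
      and near: "\<And>k. k \<in> K \<Longrightarrow> norm (fr k - R *\<^sub>R \<theta>) \<le> \<delta> * R"
      and eq: "\<And>k. of_real ((norm (fr k))\<^sup>2 - R\<^sup>2) * c k = of_real R * h k" for \<delta> K c R h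
  proof -
    let ?v = "tp K c"
    let ?N = "\<Sum>k\<in>K. (cmod (c k))\<^sup>2" and ?H = "\<Sum>k\<in>K. (cmod (h k))\<^sup>2"
    have N: "nrm ?v = ?N" "?N \<ge> 0" "?H \<ge> 0" using K by (auto simp: nrm_tp intro: sum_nonneg)
    have cv: "continuous_on UNIV ?v" "continuous_on UNIV (tp J b)" for b by (rule smooth_continuous[OF smooth_tp])+
    have int: "(LINT x|M. tp J b x * (?v x * cnj (?v x))) = (\<Sum>j\<in>J. b j * corr K c j)" for b
    proof -
      have "integrable M (\<lambda>x. b j * (e j x * (?v x * cnj (?v x))))" for j
        by (intro integrable_smooth continuous_intros cv smooth_continuous[OF smooth_e])
      moreover have "tp J b x * (?v x * cnj (?v x)) = (\<Sum>j\<in>J. b j * (e j x * (?v x * cnj (?v x))))" for x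
        by (simp add: tp_def[of J] sum_distrib_right mult.assoc)
      ultimately show ?thesis by (simp add: integral_e_square[OF K])
    qed
    have "cmod ((LINT x|M. \<psi> x * (?v x * cnj (?v x))) - (\<Sum>j\<in>J. fc \<psi> j * corr K c j)) \<le> \<epsilon> / 4 * nrm ?v"
      unfolding int[symmetric] by (rule integral_close[OF smooth_continuous[OF psi(1)] cv(2) cv(1) J(2)])
    moreover have "cmod ((LINT x|M. wiener ?c x * (?v x * cnj (?v x))) - (\<Sum>j\<in>J. ?c j * corr K c j)) \<le> \<epsilon> / 4 * nrm ?v"
      unfolding int[symmetric] by (rule integral_close[OF continuous_wiener[OF s'] cv(2) cv(1) J(3)])
    moreover have "cmod ((\<Sum>j\<in>J. fc \<psi> j * corr K c j) - (\<Sum>j\<in>J. ?c j * corr K c j)) \<le> (\<epsilon> / 4 + \<epsilon> / 4) * ?N + (A / t) * ?H"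
    proof -
      have "cmod ((\<Sum>j\<in>J. fc \<psi> j * corr K c j) - (\<Sum>j\<in>J. ?c j * corr K c j)) \<le> (\<Sum>j\<in>J. cmod ((fc \<psi> j - ?c j) * corr K c j))"
        unfolding sum_subtractf[symmetric] left_diff_distrib[symmetric] by (rule norm_sum)
      also have "\<dots> \<le> (\<Sum>j\<in>J. w j * ((\<delta>0 * norm (fr j) + t) * ?N + ?H / t))"
      proof (rule sum_mono)
        fix j assume "j \<in> J"
        show "cmod ((fc \<psi> j - ?c j) * corr K c j) \<le> w j * ((\<delta>0 * norm (fr j) + t) * ?N + ?H / t)"
        proof (cases "fr j \<bullet> \<theta> = 0")
          case True then show ?thesis by (simp add: along_def w_def)
        next
          case False
          have "\<bar>fr j \<bullet> \<theta>\<bar> * cmod (corr K c j) \<le> (\<delta> * norm (fr j) + t) * ?N + ?H / t"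
            by (rule transport_mode[OF K R t(1) \<delta>(1) near eq])
          also have "\<dots> \<le> (\<delta>0 * norm (fr j) + t) * ?N + ?H / t"
            using \<delta> N by (intro add_right_mono mult_right_mono) auto
          finally have "w j * (\<bar>fr j \<bullet> \<theta>\<bar> * cmod (corr K c j)) \<le> w j * ((\<delta>0 * norm (fr j) + t) * ?N + ?H / t)"
            by (rule mult_left_mono[OF _ w0])
          moreover have "w j * (\<bar>fr j \<bullet> \<theta>\<bar> * cmod (corr K c j)) = cmod ((fc \<psi> j - ?c j) * corr K c j)"
            using False by (simp add: w_def along_def norm_mult)
          ultimately show ?thesis by simp
        qed
      qed
      also have "\<dots> = (B * \<delta>0 + A * t) * ?N + (A / t) * ?H"
      proof -
        have "(\<Sum>j\<in>J. w j * ((\<delta>0 * norm (fr j) + t) * x + y / t)) = (B * \<delta>0 + A * t) * x + (A / t) * y" for x y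
        proof -
          have "w j * ((\<delta>0 * norm (fr j) + t) * x + y / t) = w j * norm (fr j) * (\<delta>0 * x) + w j * (t * x + y / t)" for j
            by (simp add: algebra_simps)
          then have "(\<Sum>j\<in>J. w j * ((\<delta>0 * norm (fr j) + t) * x + y / t)) = B * (\<delta>0 * x) + A * (t * x + y / t)"
            by (simp add: A_def B_def sum_distrib_right sum.distrib)
          then show ?thesis by (simp add: algebra_simps)
        qed
        then show ?thesis .
      qed
      also have "\<dots> \<le> (\<epsilon> / 4 + \<epsilon> / 4) * ?N + (A / t) * ?H"
        using t d0 N by (intro add_right_mono mult_right_mono add_mono) auto
      finally show ?thesis .
    qed
    ultimately have "cmod ((LINT x|M. \<psi> x * (?v x * cnj (?v x))) - (LINT x|M. wiener ?c x * (?v x * cnj (?v x))))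
       \<le> \<epsilon> / 4 * ?N + \<epsilon> / 4 * ?N + ((\<epsilon> / 4 + \<epsilon> / 4) * ?N + (A / t) * ?H)"
      unfolding N(1) by - (rule order_trans[OF norm_chain[of _ _ "\<Sum>j\<in>J. fc \<psi> j * corr K c j" "\<Sum>j\<in>J. ?c j * corr K c j"]], linarith)
    also have "\<dots> = \<epsilon> * ?N + (A / t) * ?H" by (simp add: field_simps)
    finally show ?thesis by (simp add: N(1))
  qed
  note bound = this
  have "0 \<le> A / t" using t AB by simp
  show ?thesis
    by (intro exI[of _ \<delta>0] conjI exI[of _ "A / t"] allI impI d0(1) \<open>0 \<le> A / t\<close>, rule bound) blast+
qed

end

subsection \<open>A weight and its averages along geodesics\<close>

locale observed_torus = torus +
  fixes \<phi> :: "real \<times> real \<Rightarrow> real"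
  assumes smooth_phi: "smooth \<phi>" and periodic_phi: "periodic \<phi>"
    and phi_nonneg: "\<And>x. 0 \<le> \<phi> x" and phi_le_1: "\<And>x. \<phi> x \<le> 1" and phi_1: "\<exists>x. \<phi> x = 1"
begin

text \<open>The square makes the integral of \<open>\<psi>\<close> against \<bar>v\<bar>^2 equal to
  \<open>nrm\<close> of \<phi> v, while \<phi> itself stays smooth and can be commuted with
  multipliers.\<close>

definition \<psi> :: "real \<times> real \<Rightarrow> complex" where "\<psi> x = of_real ((\<phi> x)\<^sup>2)"

definition mass :: real where "mass = (LINT x|M. (\<phi> x)\<^sup>2)"

lemma smooth_psi: "smooth \<psi>"
  unfolding \<psi>_def[abs_def] power2_eq_square by (intro smooth_of_real smooth_mult smooth_phi)

lemma periodic_psi: "periodic \<psi>"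
  unfolding \<psi>_def[abs_def] by (rule periodic_comp[OF periodic_phi, of "\<lambda>t. of_real (t\<^sup>2)"])

lemma summable_psi: "(\<lambda>k. cmod (fc \<psi> k)) summable_on UNIV"
  by (rule smooth_fc_summable(1)[OF smooth_psi periodic_psi])

lemma continuous_phi: "continuous_on S \<phi>"
  using smooth_continuous[OF smooth_phi] continuous_on_subset by blast

lemma integrable_phi_square: "integrable M (\<lambda>x. (\<phi> x)\<^sup>2)"
  by (intro integrable_smooth continuous_intros continuous_phi)

lemma fc_psi_0: "fc \<psi> 0 = of_real mass"
  unfolding fc_def \<psi>_def mass_def by (simp flip: of_real_power)

lemma mass_pos: "mass > 0"
proof (rule ccontr)
  assume "\<not> mass > 0"
  moreover have "mass \<ge> 0" unfolding mass_def by simp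
  ultimately have 0: "(LINT x|M. (\<phi> x)\<^sup>2) = 0" unfolding mass_def[symmetric] by linarith
  obtain x where "\<phi> x = 1" using phi_1 by blast
  moreover have "(\<phi> x)\<^sup>2 = 0"
    by (rule integral_zero_imp_zero[OF _ periodic_comp[OF periodic_phi, of "\<lambda>t. t\<^sup>2"] _ 0])
      (auto intro!: continuous_intros continuous_phi)
  ultimately show False by simp
qed

lemma fc_psi_small:
  assumes "d > 0" shows "\<exists>J. finite J \<and> (\<forall>k. k \<notin> J \<longrightarrow> cmod (fc \<psi> k) \<le> d)"
proof -
  obtain J where J: "finite J" "\<And>x. cmod (\<psi> x - tp J (fc \<psi>) x) \<le> d"
    using smooth_tp_approx[OF smooth_psi periodic_psi assms] by blast
  have "cmod (fc \<psi> k) \<le> d" if "k \<notin> J" for k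
  proof -
    have "cmod (fc (\<lambda>x. \<psi> x - tp J (fc \<psi>) x) k) \<le> d"
      by (intro norm_fc_le J L2_diff L2_smooth smooth_psi smooth_tp)
    then show ?thesis using that J(1) by (simp add: fc_diff L2_smooth smooth_psi smooth_tp fc_tp)
  qed
  with J(1) show ?thesis by blast
qed

text \<open>If \<open>\<bar>fc \<psi> k\<bar> = fc \<psi> 0\<close> then \<open>\<psi>\<close> is a multiple of \<open>e k \<psi>\<close>, so that \<open>\<bar>fc \<psi>\<bar>\<close> is constant on the
  multiples of \<open>k\<close>, contradicting summability.\<close>

lemma fc_psi_less:
  assumes k: "k \<noteq> 0" shows "cmod (fc \<psi> k) < mass"
proof (rule ccontr)
  assume "\<not> cmod (fc \<psi> k) < mass"
  then have ge: "cmod (fc \<psi> k) \<ge> mass" by simp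
  then have nz: "fc \<psi> k \<noteq> 0" using mass_pos by auto
  define c where "c = cnj (fc \<psi> k) / of_real (cmod (fc \<psi> k))"
  have c: "cmod c = 1" using nz by (simp add: c_def norm_divide)
  have cf: "c * fc \<psi> k = of_real (cmod (fc \<psi> k))"
    using nz by (simp add: c_def mult.commute[of "cnj _"] complex_norm_square[symmetric] power2_eq_square)
  \<comment> \<open>With \<open>c\<close> turning \<open>fc \<psi> k\<close> positive, this is a
    nonnegative function of integral at most 0. Its vanishing forces
    \<open>c * e (- k) x = 1\<close> wherever \<phi> is not 0.\<close>
  define h where "h x = (\<phi> x)\<^sup>2 * (1 - Re (c * e (- k) x))" for x
  have ch: "continuous_on UNIV h"
    unfolding h_def[abs_def]
    by (intro continuous_intros continuous_phi smooth_continuous[OF smooth_e])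
  have "periodic (\<lambda>x. (1 - Re (c * e (- k) x)))"
    using periodic_comp[OF periodic_e[of "-k"], of "\<lambda>z. 1 - Re (c * z)"] .
  then have ph: "periodic h"
    unfolding h_def[abs_def] by (rule periodic_mult[OF periodic_comp[OF periodic_phi, of "\<lambda>t. t\<^sup>2"]])
  have u: "cmod (c * e (- k) x) = 1" for x by (simp add: norm_mult c)
  have h0: "0 \<le> h x" for x
    using complex_Re_le_cmod[of "c * e (- k) x"] unfolding h_def u by simp
  have ic: "integrable M (\<lambda>x. c * (\<psi> x * e (- k) x))"
    by (intro integrable_smooth continuous_intros smooth_continuous smooth_psi smooth_e)
  have "h x = (\<phi> x)\<^sup>2 - Re (c * (\<psi> x * e (- k) x))" for x
    by (simp add: h_def \<psi>_def algebra_simps)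
  then have "(LINT x|M. h x) = mass - (LINT x|M. Re (c * (\<psi> x * e (- k) x)))"
    using integrable_phi_square integrable_Re[OF ic] by (simp only: mass_def Bochner_Integration.integral_diff)
  also have "(LINT x|M. Re (c * (\<psi> x * e (- k) x))) = Re (c * fc \<psi> k)"
    unfolding integral_Re[OF ic] by (simp only: integral_mult_right_zero fc_def)
  also have "mass - Re (c * fc \<psi> k) \<le> 0" using ge by (simp add: cf)
  finally have "(LINT x|M. h x) = 0" using Bochner_Integration.integral_nonneg[of M h] h0 by (simp add: order_antisym)
  then have hz: "h x = 0" for x by (rule integral_zero_imp_zero[OF ch ph h0])
  have pt: "\<psi> x = c * (e (- k) x * \<psi> x)" for x
  proof (cases "\<phi> x = 0")
    case False
    then have "Re (c * e (- k) x) = 1" using hz[of x] by (simp add: h_def)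
    moreover have "(Re (c * e (- k) x))\<^sup>2 + (Im (c * e (- k) x))\<^sup>2 = 1"
      using u[of x] by (metis cmod_power2 one_power2)
    ultimately have "c * e (- k) x = 1" by (simp add: complex_eq_iff)
    then show ?thesis by (simp add: mult.assoc[symmetric])
  qed (simp add: \<psi>_def)
  have "fc \<psi> l = fc (\<lambda>x. c * (e (- k) x * \<psi> x)) l" for l
    by (rule arg_cong[where f="\<lambda>f. fc f l"], rule ext, rule pt)
  also have "fc (\<lambda>x. c * (e (- k) x * \<psi> x)) l = c * fc \<psi> (l + k)" for l
    by (simp add: fc_cmult fc_e_mult)
  finally have "cmod (fc \<psi> l) = cmod (c * fc \<psi> (l + k))" for l by (rule arg_cong)
  then have shift: "cmod (fc \<psi> (l + k)) = cmod (fc \<psi> l)" for l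
    by (simp add: norm_mult c)
  \<comment> \<open>The multiples of \<open>k\<close>: along them the modulus of the coefficient
    stays equal to \<open>mass\<close>, against the decay in \<open>fc_psi_small\<close>.\<close>
  define g where "g n = (int n * fst k, int n * snd k)" for n
  have gS: "g (Suc n) = g n + k" for n by (cases k) (simp add: g_def algebra_simps)
  have gn: "cmod (fc \<psi> (g n)) = mass" for n
  proof (induction n)
    case 0
    have "g 0 = 0" by (simp add: g_def zero_prod_def)
    then show ?case using mass_pos by (simp add: fc_psi_0)
  qed (simp add: gS shift)
  have "inj g"
  proof (rule injI)
    fix n n' assume "g n = g n'"
    then have "int n * fst k = int n' * fst k" "int n * snd k = int n' * snd k" by (auto simp: g_def)
    then show "n = n'" using k by (cases "fst k = 0") (auto simp: zero_prod_def prod_eq_iff)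
  qed
  obtain J where J: "finite J" "\<And>k. k \<notin> J \<Longrightarrow> cmod (fc \<psi> k) \<le> mass / 2"
    using fc_psi_small[OF half_gt_zero[OF mass_pos]] by blast
  have "infinite (range g)" using \<open>inj g\<close> by (rule range_inj_infinite)
  then have "\<not> range g \<subseteq> J" using finite_subset[OF _ J(1)] by (rule contrapos_nn)
  then obtain n where n: "g n \<notin> J" by (auto simp only: image_subset_iff)
  show False using J(2)[OF n] mass_pos unfolding gn by linarith
qed

text \<open>All but finitely many coefficients are at most half the mass, and each of the remaining
  ones is strictly smaller than the mass; the gap is a minimum over a finite set.\<close>

lemma spectral_gap: "\<exists>\<gamma>>0. \<gamma> \<le> mass \<and> (\<forall>k. k \<noteq> 0 \<longrightarrow> cmod (fc \<psi> k) \<le> mass - \<gamma>)"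
proof -
  obtain J where J: "finite J" "\<And>k. k \<notin> J \<Longrightarrow> cmod (fc \<psi> k) \<le> mass / 2"
    using fc_psi_small[OF half_gt_zero[OF mass_pos]] by blast
  define S where "S = insert (mass / 2) ((\<lambda>k. mass - cmod (fc \<psi> k)) ` (J - {0}))"
  have S: "finite S" "S \<noteq> {}" using J(1) by (auto simp: S_def)
  have "Min S > 0" using S mass_pos fc_psi_less by (subst Min_gr_iff) (auto simp: S_def)
  moreover have "Min S \<le> mass / 2" using S by (intro Min_le) (auto simp: S_def)
  moreover have "cmod (fc \<psi> k) \<le> mass - Min S" if "k \<noteq> 0" for k
  proof (cases "k \<in> J")
    case True
    then have "Min S \<le> mass - cmod (fc \<psi> k)" using S(1) that by (intro Min_le) (auto simp: S_def)
    then show ?thesis by simp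
  next
    case False
    then show ?thesis using J(2) \<open>Min S \<le> mass / 2\<close> by fastforce
  qed
  ultimately show ?thesis using mass_pos by (intro exI[of _ "Min S"]) auto
qed

text \<open>Defined by its Fourier series, so that the same object makes sense whether the geodesics
  in direction \<theta> are closed or dense.\<close>

definition average :: "real \<times> real \<Rightarrow> real \<times> real \<Rightarrow> complex" where
  "average \<theta> = wiener (along \<theta> (fc \<psi>))"

lemma continuous_average: "continuous_on UNIV (average \<theta>)"
  unfolding average_def by (rule continuous_wiener[OF summable_along[OF summable_psi]])

lemma fc_average: "fc (average \<theta>) k = along \<theta> (fc \<psi>) k"
  unfolding average_def by (rule fc_wiener[OF summable_along[OF summable_psi]])

lemma average_irrational:
  assumes "\<And>k. k \<noteq> 0 \<Longrightarrow> fr k \<bullet> \<theta> \<noteq> 0" shows "average \<theta> x = of_real mass"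
proof -
  have "average \<theta> x = (\<Sum>\<^sub>\<infinity>k\<in>{0}. along \<theta> (fc \<psi>) k * e k x)"
    unfolding average_def wiener_def
    using assms by (intro infsum_cong_neutral) (auto simp: along_def)
  then show ?thesis by (simp add: along_def fc_psi_0)
qed

text \<open>A direction orthogonal to the frequency of \<open>(m, n)\<close> is s times
  \<open>(- n * a, m * b)\<close>. Then every \<open>fr k \<bullet> \<theta>\<close> is an integer
  multiple of s, and all characters have the common period 2 pi / \<bar>s\<bar> along
  \<theta>.\<close>

lemma resonant_period:
  assumes \<theta>: "norm \<theta> = 1" and j: "j \<noteq> 0" "fr j \<bullet> \<theta> = 0"
  shows "\<exists>L>0. \<forall>k. \<exists>n::int. L * (fr k \<bullet> \<theta>) = 2 * pi * n"
proof -
  obtain t1 t2 where t: "\<theta> = (t1, t2)" by (cases \<theta>)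
  obtain m n where mn: "j = (m, n)" by (cases j)
  have eq: "m * t1 / a + n * t2 / b = 0" using j(2) by (simp add: fr_def mn t inner_prod_def)
  have ex: "\<exists>s::real. t1 = - s * n * a \<and> t2 = s * m * b"
  proof (cases "m = 0")
    case False
    have "t1 = - (t2 / (m * b)) * n * a"
      using eq False a_pos b_pos by (simp add: field_simps add_eq_0_iff)
    then show ?thesis using False b_pos by (intro exI[of _ "t2 / (m * b)"]) simp
  next
    case True
    then have n: "n \<noteq> 0" using j(1) mn by (auto simp: zero_prod_def)
    then have "t2 = 0" using eq True b_pos by simp
    then show ?thesis using n True a_pos by (intro exI[of _ "- t1 / (n * a)"]) simp
  qed
  then obtain s :: real where s: "t1 = - s * n * a" "t2 = s * m * b" by blast
  have s0: "s \<noteq> 0" using \<theta> by (auto simp: t s norm_prod_def)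
  have "\<exists>i::int. (2 * pi / \<bar>s\<bar>) * (fr k \<bullet> \<theta>) = 2 * pi * i" for k
  proof -
    have frk: "fr k \<bullet> \<theta> = s * of_int (snd k * m - fst k * n)"
      using a_pos b_pos by (simp add: fr_def t inner_prod_def s field_simps)
    have "(2 * pi / \<bar>s\<bar>) * (fr k \<bullet> \<theta>) = 2 * pi * (sgn s * of_int (snd k * m - fst k * n))"
      unfolding frk using s0 by (cases "s > 0") (simp_all add: algebra_simps)
    also have "sgn s * of_int (snd k * m - fst k * n) = of_int ((if s > 0 then 1 else -1) * (snd k * m - fst k * n))"
      using s0 by (auto simp: sgn_if)
    finally show ?thesis by blast
  qed
  then show ?thesis using s0 by (intro exI[of _ "2 * pi / \<bar>s\<bar>"]) auto
qed

lemma e_line: "e k (x + t *\<^sub>R \<theta>) = e k x * cis (t * (fr k \<bullet> \<theta>))"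
  by (simp add: e_def inner_add_right cis_mult)

lemma integral_cis:
  assumes "L > 0" "L * \<alpha> = 2 * pi * of_int n"
  shows "integral {0..L} (\<lambda>t. cis (t * \<alpha>)) = (if \<alpha> = 0 then of_real L else 0)"
proof (cases "\<alpha> = 0")
  case True
  then show ?thesis using assms by (simp add: scaleR_conv_of_real)
next
  case False
  have "((\<lambda>t. cis (t * \<alpha>)) has_integral (cis (L * \<alpha>) / (\<i> * \<alpha>) - cis (0 * \<alpha>) / (\<i> * \<alpha>))) {0..L}"
  proof (rule fundamental_theorem_of_calculus)
    fix t
    have "((\<lambda>t. cis (t * \<alpha>) / (\<i> * \<alpha>)) has_derivative (\<lambda>s. (s * \<alpha>) *\<^sub>R (\<i> * cis (t * \<alpha>)) / (\<i> * \<alpha>))) (at t within {0..L})"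
      by (rule bounded_linear.has_derivative[OF bounded_linear_divide
          has_derivative_cis[OF has_derivative_mult_left[OF has_derivative_ident]]])
    moreover have "(\<lambda>s. (s * \<alpha>) *\<^sub>R (\<i> * cis (t * \<alpha>)) / (\<i> * \<alpha>)) = (\<lambda>s. s *\<^sub>R cis (t * \<alpha>))"
      using False by (intro ext) (simp add: scaleR_conv_of_real field_simps)
    ultimately show "((\<lambda>t. cis (t * \<alpha>) / (\<i> * \<alpha>)) has_vector_derivative cis (t * \<alpha>)) (at t within {0..L})"
      by (simp only: has_vector_derivative_def)
  qed (use assms in auto)
  moreover have "cis (L * \<alpha>) = 1" unfolding assms(2) by (simp add: cis_multiple_2pi)
  ultimately show ?thesis using False by (simp add: integral_unique)
qed

text \<open>Over a common period \<open>L\<close> each mode integrates to L times itself or to 0,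
  according to whether it is constant along \<theta>. Uniform truncation carries this from
  polynomials to \<psi>.\<close>

lemma average_eq_orbit_integral:
  assumes L: "L > 0" "\<And>k. \<exists>n::int. L * (fr k \<bullet> \<theta>) = 2 * pi * n"
  shows "average \<theta> x = of_real (integral {0..L} (\<lambda>t. (\<phi> (x + t *\<^sub>R \<theta>))\<^sup>2) / L)"
proof -
  let ?c = "along \<theta> (fc \<psi>)"
  define A where "A = integral {0..L} (\<lambda>t. \<psi> (x + t *\<^sub>R \<theta>))"
  have cl: "continuous_on {0..L} (\<lambda>t. f (x + t *\<^sub>R \<theta>))" if "continuous_on UNIV f" for f :: "real \<times> real \<Rightarrow> complex"
    by (rule continuous_on_compose2[OF that]) (auto intro!: continuous_intros)
  have "cmod (of_real L * average \<theta> x - A) \<le> 0 + d" if d: "d > 0" for d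
  proof -
    define d' where "d' = d / (2 * L)"
    have d': "d' > 0" using d L by (simp add: d'_def)
    obtain J1 where J1: "finite J1" "\<And>J' x. finite J' \<Longrightarrow> J1 \<subseteq> J' \<Longrightarrow> cmod (\<psi> x - tp J' (fc \<psi>) x) \<le> d'"
      using wiener_approx[OF summable_psi d'] unfolding wiener_fc[OF smooth_psi periodic_psi] by blast
    obtain J2 where J2: "finite J2" "\<And>J' x. finite J' \<Longrightarrow> J2 \<subseteq> J' \<Longrightarrow> cmod (average \<theta> x - tp J' ?c x) \<le> d'"
      using wiener_approx[OF summable_along[OF summable_psi] d'] unfolding average_def by blast
    define J where "J = J1 \<union> J2"
    have Jf: "finite J" using J1 J2 by (simp add: J_def)
    have J: "cmod (\<psi> y - tp J (fc \<psi>) y) \<le> d'" "cmod (average \<theta> y - tp J ?c y) \<le> d'" for y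
      by (rule J1(2)[OF Jf], simp add: J_def) (rule J2(2)[OF Jf], simp add: J_def)
    have ci: "(\<lambda>t. cis (t * \<alpha>)) integrable_on {0..L}" for \<alpha>
      by (intro integrable_continuous_real continuous_intros)
    have "integral {0..L} (\<lambda>t. tp J (fc \<psi>) (x + t *\<^sub>R \<theta>)) = (\<Sum>j\<in>J. integral {0..L} (\<lambda>t. (fc \<psi> j * e j x) * cis (t * (fr j \<bullet> \<theta>))))"
      unfolding tp_def e_line mult.assoc[symmetric]
      by (rule integral_sum[OF Jf]) (intro integrable_on_mult_right ci)
    also have "\<dots> = (\<Sum>j\<in>J. (fc \<psi> j * e j x) * (if fr j \<bullet> \<theta> = 0 then of_real L else 0))"
    proof (rule sum.cong[OF refl])
      fix j
      obtain n :: int where "L * (fr j \<bullet> \<theta>) = 2 * pi * n" using L(2) by blast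
      from integral_cis[OF L(1) this]
      show "integral {0..L} (\<lambda>t. (fc \<psi> j * e j x) * cis (t * (fr j \<bullet> \<theta>))) = (fc \<psi> j * e j x) * (if fr j \<bullet> \<theta> = 0 then of_real L else 0)"
        by (simp only: integral_mult_right)
    qed
    also have "\<dots> = of_real L * tp J ?c x"
      unfolding tp_def sum_distrib_left by (intro sum.cong refl) (simp add: along_def)
    finally have tpJ: "integral {0..L} (\<lambda>t. tp J (fc \<psi>) (x + t *\<^sub>R \<theta>)) = of_real L * tp J ?c x" .
    have cont: "continuous_on UNIV \<psi>" "continuous_on UNIV (tp J (fc \<psi>))"
      by (rule smooth_continuous[OF smooth_psi], rule smooth_continuous[OF smooth_tp])
    have "cmod (A - of_real L * tp J ?c x) = cmod (integral {0..L} (\<lambda>t. \<psi> (x + t *\<^sub>R \<theta>) - tp J (fc \<psi>) (x + t *\<^sub>R \<theta>)))"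
      unfolding tpJ[symmetric] A_def
      by (subst Henstock_Kurzweil_Integration.integral_diff) (auto intro!: integrable_continuous_real cl cont)
    also have "\<dots> \<le> d' * (L - 0)"
      using L J by (intro integral_bound continuous_on_diff cl cont) auto
    finally have 1: "cmod (A - of_real L * tp J ?c x) \<le> d' * L" by simp
    have "cmod (of_real L * average \<theta> x - of_real L * tp J ?c x) = L * cmod (average \<theta> x - tp J ?c x)"
      using L by (simp add: right_diff_distrib[symmetric] norm_mult)
    also have "\<dots> \<le> L * d'" using J(2) L by (intro mult_left_mono) auto
    finally have 2: "cmod (of_real L * average \<theta> x - of_real L * tp J ?c x) \<le> L * d'" .
    have "cmod (of_real L * average \<theta> x - A) =
        cmod ((of_real L * average \<theta> x - of_real L * tp J ?c x) - (A - of_real L * tp J ?c x))" by simp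
    then have "cmod (of_real L * average \<theta> x - A) \<le> d' * L + L * d'"
      using norm_triangle_ineq4[of "of_real L * average \<theta> x - of_real L * tp J ?c x" "A - of_real L * tp J ?c x"] 1 2
      by linarith
    also have "\<dots> = d" using L by (simp add: d'_def)
    finally show ?thesis by simp
  qed
  then have "cmod (of_real L * average \<theta> x - A) \<le> 0" by (rule field_le_epsilon)
  then have "of_real L * average \<theta> x = A" by simp
  moreover have "A = of_real (integral {0..L} (\<lambda>t. (\<phi> (x + t *\<^sub>R \<theta>))\<^sup>2))"
    unfolding A_def \<psi>_def
    by (rule integral_unique, rule has_integral_of_real, rule integrable_integral, rule integrable_continuous_real)
      (auto intro!: continuous_intros continuous_on_compose2[OF continuous_phi[of UNIV]])
  ultimately show ?thesis using L by (simp add: field_simps)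
qed

lemma cmod_cis_diff_1: "cmod (cis t - 1) \<le> \<bar>t\<bar>"
proof -
  have "(cmod (cis t - 1))\<^sup>2 = (2 * sin (t / 2))\<^sup>2"
  proof -
    have "(cmod (cis t - 1))\<^sup>2 = 2 - 2 * cos t"
      by (simp add: cmod_power2 power2_diff)
    also have "\<dots> = (2 * sin (t / 2))\<^sup>2"
      using cos_double_sin[of "t / 2"] by (simp add: power_mult_distrib)
    finally show ?thesis .
  qed
  then have "cmod (cis t - 1) = \<bar>2 * sin (t / 2)\<bar>" by (metis real_sqrt_abs abs_norm_cancel)
  also have "\<dots> \<le> \<bar>t\<bar>" using abs_sin_x_le_abs_x[of "t / 2"] by simp
  finally show ?thesis .
qed

text \<open>Lipschitz continuity of \<psi> with a constant independent of the point and of the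
  direction. The allowed drop of 1/2 is made of two truncation errors 1/8 and the variation 1/4 of
  the truncated series.\<close>

lemma phi_near_1:
  assumes "\<phi> x = 1" "\<bar>t\<bar> * (4 * (grad_sum \<psi> + 1)) \<le> 1" "norm \<theta> = 1"
  shows "(\<phi> (x + t *\<^sub>R \<theta>))\<^sup>2 \<ge> 1 / 2"
proof -
  obtain J where J: "finite J" "\<And>x. cmod (\<psi> x - tp J (fc \<psi>) x) \<le> 1 / 8"
    using smooth_tp_approx[OF smooth_psi periodic_psi, of "1/8"] by auto
  have "tp J (fc \<psi>) (x + t *\<^sub>R \<theta>) - tp J (fc \<psi>) x = (\<Sum>j\<in>J. fc \<psi> j * e j x * (cis (t * (fr j \<bullet> \<theta>)) - 1))"
    unfolding tp_def e_line by (simp add: sum_subtractf[symmetric] algebra_simps)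
  then have "cmod (tp J (fc \<psi>) (x + t *\<^sub>R \<theta>) - tp J (fc \<psi>) x) \<le> (\<Sum>j\<in>J. cmod (fc \<psi> j * e j x * (cis (t * (fr j \<bullet> \<theta>)) - 1)))"
    by (simp add: norm_sum)
  also have "\<dots> \<le> (\<Sum>j\<in>J. \<bar>t\<bar> * (norm (fr j) * cmod (fc \<psi> j)))"
  proof (rule sum_mono)
    fix j
    have "cmod (cis (t * (fr j \<bullet> \<theta>)) - 1) \<le> \<bar>t\<bar> * \<bar>fr j \<bullet> \<theta>\<bar>"
      using cmod_cis_diff_1[of "t * (fr j \<bullet> \<theta>)"] by (simp add: abs_mult)
    also have "\<dots> \<le> \<bar>t\<bar> * norm (fr j)"
      using Cauchy_Schwarz_ineq2[of "fr j" \<theta>] assms(3) by (intro mult_left_mono) auto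
    finally have "cmod (fc \<psi> j) * cmod (cis (t * (fr j \<bullet> \<theta>)) - 1) \<le> cmod (fc \<psi> j) * (\<bar>t\<bar> * norm (fr j))"
      by (rule mult_left_mono) simp
    then show "cmod (fc \<psi> j * e j x * (cis (t * (fr j \<bullet> \<theta>)) - 1)) \<le> \<bar>t\<bar> * (norm (fr j) * cmod (fc \<psi> j))"
      by (simp add: norm_mult mult_ac)
  qed
  also have "\<dots> \<le> \<bar>t\<bar> * grad_sum \<psi>"
    unfolding sum_distrib_left[symmetric] by (intro mult_left_mono grad_sum_bound smooth_psi periodic_psi J) auto
  also have "\<dots> \<le> 1 / 4" using assms(2) by (simp add: algebra_simps)
  finally have 1: "cmod (tp J (fc \<psi>) (x + t *\<^sub>R \<theta>) - tp J (fc \<psi>) x) \<le> 1 / 4" .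
  have "cmod (\<psi> x - \<psi> (x + t *\<^sub>R \<theta>)) \<le> 1 / 8 + 1 / 8 + 1 / 4"
    using norm_chain[of "\<psi> x" "\<psi> (x + t *\<^sub>R \<theta>)" "tp J (fc \<psi>) x" "tp J (fc \<psi>) (x + t *\<^sub>R \<theta>)"]
      J(2)[of x] J(2)[of "x + t *\<^sub>R \<theta>"] 1 by (simp add: norm_minus_commute)
  then have "cmod (of_real (1 - (\<phi> (x + t *\<^sub>R \<theta>))\<^sup>2)) \<le> 1 / 2" by (simp add: \<psi>_def assms(1))
  then show ?thesis unfolding norm_of_real by linarith
qed

lemma average_resonant:
  assumes \<theta>: "norm \<theta> = 1" and j: "j \<noteq> 0" "fr j \<bullet> \<theta> = 0"
  shows "\<exists>\<Phi> c. c > 0 \<and> (\<forall>x. average \<theta> x = of_real (\<Phi> x)) \<and> (\<forall>x. 0 \<le> \<Phi> x \<and> \<Phi> x \<le> 1) \<and> (\<forall>x. \<phi> x = 1 \<longrightarrow> c \<le> \<Phi> x)"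
proof -
  obtain L where L: "L > 0" "\<And>k. \<exists>n::int. L * (fr k \<bullet> \<theta>) = 2 * pi * n"
    using resonant_period[OF assms] by blast
  define \<Phi> where "\<Phi> x = integral {0..L} (\<lambda>t. (\<phi> (x + t *\<^sub>R \<theta>))\<^sup>2) / L" for x
  have cont: "continuous_on S (\<lambda>t. (\<phi> (x + t *\<^sub>R \<theta>))\<^sup>2)" for x and S :: "real set"
    by (auto intro!: continuous_intros continuous_on_compose2[OF continuous_phi[of UNIV]])
  have int: "(\<lambda>t. (\<phi> (x + t *\<^sub>R \<theta>))\<^sup>2) integrable_on {s..t}" for x s t
    by (intro integrable_continuous_real cont)
  have sq: "(\<phi> x)\<^sup>2 \<le> 1" for x using phi_nonneg phi_le_1 by (simp add: power_le_one)
  have 0: "0 \<le> \<Phi> x" for x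
    unfolding \<Phi>_def using L by (intro divide_nonneg_pos Henstock_Kurzweil_Integration.integral_nonneg int) auto
  have "integral {0..L} (\<lambda>t. (\<phi> (x + t *\<^sub>R \<theta>))\<^sup>2) \<le> integral {0..L} (\<lambda>t. 1)" for x
    by (intro integral_le int) (auto intro: sq)
  then have 1: "\<Phi> x \<le> 1" for x using L by (simp add: \<Phi>_def)
  \<comment> \<open>An orbit that starts where \<phi> is 1 keeps \<phi>^2 above 1/2 for this time,
    cut at the period. Its average is then at least \<tau> / (2 L), the same bound for all such
    starting points.\<close>
  define \<tau> where "\<tau> = min L (1 / (4 * (grad_sum \<psi> + 1)))"
  have \<tau>: "\<tau> > 0" "\<tau> \<le> L" "\<tau> * (4 * (grad_sum \<psi> + 1)) \<le> 1"
  proof -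
    have g: "4 * (grad_sum \<psi> + 1) > 0" using grad_sum_nonneg[of \<psi>] by simp
    show "\<tau> > 0" "\<tau> \<le> L" using L g by (auto simp: \<tau>_def)
    have "\<tau> * (4 * (grad_sum \<psi> + 1)) \<le> 1 / (4 * (grad_sum \<psi> + 1)) * (4 * (grad_sum \<psi> + 1))"
      using g by (intro mult_right_mono) (auto simp: \<tau>_def)
    then show "\<tau> * (4 * (grad_sum \<psi> + 1)) \<le> 1" using g by simp
  qed
  have "\<tau> / (2 * L) \<le> \<Phi> x" if x: "\<phi> x = 1" for x
  proof -
    have "\<tau> / 2 = integral {0..\<tau>} (\<lambda>t. 1 / 2)" using \<tau> by simp
    also have "\<dots> \<le> integral {0..\<tau>} (\<lambda>t. (\<phi> (x + t *\<^sub>R \<theta>))\<^sup>2)"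
    proof (intro integral_le int)
      fix t assume t: "t \<in> {0..\<tau>}"
      have "\<bar>t\<bar> * (4 * (grad_sum \<psi> + 1)) \<le> \<tau> * (4 * (grad_sum \<psi> + 1))"
        using t grad_sum_nonneg[of \<psi>] by (intro mult_right_mono) auto
      then show "1 / 2 \<le> (\<phi> (x + t *\<^sub>R \<theta>))\<^sup>2" using \<tau> by (intro phi_near_1[OF x _ \<theta>]) simp
    qed auto
    also have "\<dots> \<le> integral {0..L} (\<lambda>t. (\<phi> (x + t *\<^sub>R \<theta>))\<^sup>2)"
      using \<tau> by (intro integral_subset_le int) auto
    finally show ?thesis using L by (simp add: \<Phi>_def field_simps)
  qed
  moreover have "\<tau> / (2 * L) > 0" using \<tau> L by simp
  moreover have "average \<theta> x = of_real (\<Phi> x)" for x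
    unfolding \<Phi>_def by (rule average_eq_orbit_integral[OF L])
  ultimately show ?thesis using 0 1 by (intro exI[of _ \<Phi>] exI[of _ "\<tau> / (2 * L)"]) simp
qed

end

context torus begin

section \<open>Geometry of the frequency lattice\<close>

lemma fc_mult_tp:
  assumes "L2 f" shows "fc (\<lambda>x. f x * tp K c x) k = (\<Sum>l\<in>K. c l * fc f (k - l))"
proof -
  have "(\<lambda>x. f x * tp K c x) = (\<lambda>x. \<Sum>l\<in>K. c l * (e l x * f x))"
    by (auto simp: tp_def sum_distrib_left mult_ac)
  then show ?thesis by (simp add: fc_sum L2_cmult L2_e_mult assms fc_cmult fc_e_mult)
qed

definition spacing :: real where "spacing = min (1 / a) (1 / b)"

lemma spacing_pos: "spacing > 0" using a_pos b_pos by (simp add: spacing_def)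

lemma norm_fr_ge: "k \<noteq> 0 \<Longrightarrow> norm (fr k) \<ge> spacing"
proof -
  assume "k \<noteq> 0"
  then consider "fst k \<noteq> 0" | "snd k \<noteq> 0" by (cases k) (auto simp: zero_prod_def)
  then show ?thesis
  proof cases
    case 1
    then have "1 \<le> \<bar>of_int (fst k) :: real\<bar>" by linarith
    then have "1 / a \<le> \<bar>fst (fr k)\<bar>" using a_pos by (simp add: fr_def divide_right_mono)
    also have "\<dots> \<le> norm (fr k)" using norm_fst_le[of "fst (fr k)" "snd (fr k)"] by simp
    finally show ?thesis by (simp add: spacing_def)
  next
    case 2
    then have "1 \<le> \<bar>of_int (snd k) :: real\<bar>" by linarith
    then have "1 / b \<le> \<bar>snd (fr k)\<bar>" using b_pos by (simp add: fr_def divide_right_mono)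
    also have "\<dots> \<le> norm (fr k)" using norm_snd_le[of "snd (fr k)" "fst (fr k)"] by simp
    finally show ?thesis by (simp add: spacing_def)
  qed
qed

lemma finite_fr_ball: "finite {k. norm (fr k) \<le> r}"
proof (rule finite_subset)
  show "{k. norm (fr k) \<le> r} \<subseteq> {- \<lceil>r * a\<rceil>..\<lceil>r * a\<rceil>} \<times> {- \<lceil>r * b\<rceil>..\<lceil>r * b\<rceil>}"
  proof
    fix k assume "k \<in> {k. norm (fr k) \<le> r}"
    then have k: "norm (fr k) \<le> r" by simp
    have "\<bar>fst (fr k)\<bar> \<le> r" "\<bar>snd (fr k)\<bar> \<le> r"
      using k norm_fst_le[of "fst (fr k)" "snd (fr k)"] norm_snd_le[of "snd (fr k)" "fst (fr k)"] by auto
    then have "\<bar>of_int (fst k)\<bar> \<le> r * a" "\<bar>of_int (snd k)\<bar> \<le> r * b"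
      using a_pos b_pos by (auto simp: fr_def field_simps)
    then show "k \<in> {- \<lceil>r * a\<rceil>..\<lceil>r * a\<rceil>} \<times> {- \<lceil>r * b\<rceil>..\<lceil>r * b\<rceil>}"
      by (cases k) (auto simp: abs_le_iff; linarith)
  qed
qed simp

definition perp :: "real \<times> real \<Rightarrow> real \<times> real" where "perp \<theta> = (- snd \<theta>, fst \<theta>)"

lemma inner_perp_decomp:
  assumes "norm \<theta> = 1"
  shows "u \<bullet> v = (u \<bullet> \<theta>) * (v \<bullet> \<theta>) + (u \<bullet> perp \<theta>) * (v \<bullet> perp \<theta>)"
proof -
  obtain s t x y z w where [simp]: "\<theta> = (s, t)" "u = (x, y)" "v = (z, w)" by (cases \<theta>, cases u, cases v)
  have st: "s * s + t * t = 1" using assms by (simp add: norm_prod_def power2_eq_square)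
  have "x * z + y * w = (s * s + t * t) * (x * z + y * w)" using st by simp
  also have "\<dots> = (x * s + y * t) * (z * s + w * t) + (y * s - x * t) * (w * s - z * t)"
    by (simp add: algebra_simps)
  finally show ?thesis by (simp add: perp_def algebra_simps)
qed

lemma norm_perp_decomp:
  assumes "norm \<theta> = 1" shows "(norm u)\<^sup>2 = (u \<bullet> \<theta>)\<^sup>2 + (u \<bullet> perp \<theta>)\<^sup>2"
  unfolding power2_norm_eq_inner using inner_perp_decomp[OF assms, of u u] by (simp add: power2_eq_square)

lemma nrm_le_fc3:
  assumes "L2 r" "L2 f" "L2 g" "L2 h"
    and "\<And>k. (cmod (fc r k))\<^sup>2 \<le> A * (cmod (fc f k))\<^sup>2 + B * (cmod (fc g k))\<^sup>2 + C * (cmod (fc h k))\<^sup>2"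
  shows "nrm r \<le> A * nrm f + B * nrm g + C * nrm h"
  by (rule has_sum_mono[OF parseval[OF assms(1)] _ assms(5)])
    (intro has_sum_add has_sum_cmult_right parseval assms)

end

subsection \<open>Control in a single direction\<close>

text \<open>Factor x^2 - s^2 with s the square root of max 0 m; replacing \<open>m\<close> by s^2
  can only decrease the distance. Negative \<open>m\<close> occurs when a line of frequencies misses
  the circle. The bound with \<bar>x\<bar> pays for a first-order term after division by the symbol,
  the other one for zeroth-order terms.\<close>

lemma off_shell_bound:
  fixes x m c :: real
  assumes "c > 0" "\<bar>\<bar>x\<bar> - sqrt (max 0 m)\<bar> \<ge> c"
  shows "c * \<bar>x\<bar> \<le> \<bar>x\<^sup>2 - m\<bar>" "c\<^sup>2 \<le> \<bar>x\<^sup>2 - m\<bar>"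
proof -
  define s where "s = sqrt (max 0 m)"
  have s: "s \<ge> 0" "s\<^sup>2 = max 0 m" by (auto simp: s_def)
  have "\<bar>x\<^sup>2 - s\<^sup>2\<bar> = \<bar>\<bar>x\<bar> - s\<bar> * (\<bar>x\<bar> + s)"
  proof -
    have "x\<^sup>2 - s\<^sup>2 = (\<bar>x\<bar> - s) * (\<bar>x\<bar> + s)" by (simp add: power2_eq_square algebra_simps flip: abs_mult)
    then show ?thesis using s by (simp add: abs_mult)
  qed
  moreover have "\<bar>x\<^sup>2 - s\<^sup>2\<bar> \<le> \<bar>x\<^sup>2 - m\<bar>"
    using s(2) by (cases "m \<ge> 0") auto
  moreover have "c * \<bar>x\<bar> \<le> \<bar>\<bar>x\<bar> - s\<bar> * (\<bar>x\<bar> + s)"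
    using assms s by (intro mult_mono) (auto simp: s_def)
  moreover have "c * c \<le> \<bar>\<bar>x\<bar> - s\<bar> * (\<bar>x\<bar> + s)"
  proof (rule mult_mono)
    show "c \<le> \<bar>\<bar>x\<bar> - s\<bar>" using assms by (simp add: s_def)
    then show "c \<le> \<bar>x\<bar> + s" using s by linarith
  qed (use assms in auto)
  ultimately show "c * \<bar>x\<bar> \<le> \<bar>x\<^sup>2 - m\<bar>" "c\<^sup>2 \<le> \<bar>x\<^sup>2 - m\<bar>"
    by (auto simp: power2_eq_square)
qed

context observed_torus begin

definition avg_form :: "real \<times> real \<Rightarrow> (real \<times> real \<Rightarrow> complex) \<Rightarrow> real" where
  "avg_form \<theta> v = Re (LINT x|M. average \<theta> x * (v x * cnj (v x)))"

text \<open>If every line orthogonal to \<open>\<theta>\<close> contains at most two frequencies of \<open>p\<close>, the spectral gap bounds the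
  off-diagonal terms.\<close>

lemma avg_form_sparse:
  assumes P: "finite P" and gap: "\<gamma> > 0" "\<gamma> \<le> mass" "\<And>k. k \<noteq> 0 \<Longrightarrow> cmod (fc \<psi> k) \<le> mass - \<gamma>"
    and sparse: "\<And>k l l'. k \<in> P \<Longrightarrow> l \<in> P \<Longrightarrow> l' \<in> P \<Longrightarrow> l \<noteq> k \<Longrightarrow> l' \<noteq> k \<Longrightarrow>
      fr (l - k) \<bullet> \<theta> = 0 \<Longrightarrow> fr (l' - k) \<bullet> \<theta> = 0 \<Longrightarrow> l = l'"
  shows "\<gamma> * nrm (tp P c) \<le> avg_form \<theta> (tp P c)"
proof -
  define rel where "rel k l = (if l \<noteq> k \<and> fr (l - k) \<bullet> \<theta> = 0 then 1 else 0 :: real)" for k l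
  define N where "N k = (cmod (c k))\<^sup>2" for k
  have fr_sym: "fr (l - k) \<bullet> \<theta> = 0 \<longleftrightarrow> fr (k - l) \<bullet> \<theta> = 0" for k l
    unfolding fr_diff inner_diff_left by linarith
  have rel_sym: "rel k l = rel l k" for k l by (cases "l = k") (simp_all add: rel_def fr_sym[of l k])
  have rel_sum: "(\<Sum>l\<in>P. rel k l) \<le> 1" if k: "k \<in> P" for k
  proof (cases "\<exists>l0\<in>P. l0 \<noteq> k \<and> fr (l0 - k) \<bullet> \<theta> = 0")
    case True
    then obtain l0 where l0: "l0 \<in> P" "l0 \<noteq> k" "fr (l0 - k) \<bullet> \<theta> = 0" by blast
    have "(\<Sum>l\<in>P. rel k l) = (\<Sum>l\<in>P. if l = l0 then 1 else 0)"
    proof (intro sum.cong refl)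
      fix l assume l: "l \<in> P"
      show "rel k l = (if l = l0 then 1 else 0)"
      proof (cases "l = l0")
        case True then show ?thesis using l0 by (simp add: rel_def)
      next
        case False
        then have "\<not> (l \<noteq> k \<and> fr (l - k) \<bullet> \<theta> = 0)"
          using sparse[OF k l l0(1) _ l0(2) _ l0(3)] by blast
        then show ?thesis using False unfolding rel_def by (simp only: if_False)
      qed
    qed
    then show ?thesis using P l0 by (simp add: sum.delta)
  next
    case False
    then have "(\<Sum>l\<in>P. rel k l) = 0" unfolding rel_def by (intro sum.neutral ballI if_not_P) blast
    then show ?thesis by simp
  qed
  \<comment> \<open>The off-diagonal contribution of a pair is split evenly between its two
    frequencies. Each frequency has at most one partner, so the total loss is at most
    \<open>mass - \<gamma>\<close> times the norm.\<close>
  have entry: "(if l = k then mass * N k else 0) - (mass - \<gamma>) * (rel k l * ((N k + N l) / 2))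
      \<le> Re ((c k * cnj (c l)) * along \<theta> (fc \<psi>) (l - k))" for k l
  proof (cases "l = k")
    case True
    then show ?thesis
      by (simp add: rel_def N_def along_def fc_psi_0 complex_norm_square[symmetric] flip: of_real_mult of_real_power)
  next
    case False
    show ?thesis
    proof (cases "fr (l - k) \<bullet> \<theta> = 0")
      case True
      have lk: "l - k \<noteq> 0" using False by simp
      have "- Re ((c k * cnj (c l)) * fc \<psi> (l - k)) \<le> cmod ((c k * cnj (c l)) * fc \<psi> (l - k))"
        using abs_Re_le_cmod[of "(c k * cnj (c l)) * fc \<psi> (l - k)"] by linarith
      also have "\<dots> = cmod (c k) * cmod (c l) * cmod (fc \<psi> (l - k))" by (simp add: norm_mult)
      also have "\<dots> \<le> ((N k + N l) / 2) * (mass - \<gamma>)"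
      proof (intro mult_mono gap(3) lk)
        show "cmod (c k) * cmod (c l) \<le> (N k + N l) / 2"
          using sum_squares_bound[of "cmod (c k)" "cmod (c l)"] by (simp add: N_def)
      qed (auto simp: N_def)
      finally show ?thesis using False True by (simp add: rel_def along_def mult.commute)
    qed (use False in \<open>simp add: rel_def along_def\<close>)
  qed
  have "\<gamma> * (\<Sum>k\<in>P. N k) = mass * (\<Sum>k\<in>P. N k) - (mass - \<gamma>) * (\<Sum>k\<in>P. N k)"
    by (simp add: algebra_simps)
  also have "\<dots> \<le> mass * (\<Sum>k\<in>P. N k) - (mass - \<gamma>) * (\<Sum>k\<in>P. \<Sum>l\<in>P. rel k l * ((N k + N l) / 2))"
  proof -
    have sw: "(\<Sum>k\<in>P. \<Sum>l\<in>P. rel k l * N l) = (\<Sum>k\<in>P. \<Sum>l\<in>P. rel k l * N k)"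
      by (subst sum.swap) (simp add: rel_sym)
    have "(\<Sum>k\<in>P. \<Sum>l\<in>P. rel k l * ((N k + N l) / 2)) = ((\<Sum>k\<in>P. \<Sum>l\<in>P. rel k l * N k) + (\<Sum>k\<in>P. \<Sum>l\<in>P. rel k l * N l)) / 2"
      by (simp add: sum.distrib[symmetric] sum_divide_distrib distrib_left add_divide_distrib)
    also have "\<dots> = (\<Sum>k\<in>P. (\<Sum>l\<in>P. rel k l) * N k)" by (simp add: sw sum_distrib_right)
    also have "\<dots> \<le> (\<Sum>k\<in>P. 1 * N k)" by (intro sum_mono mult_right_mono rel_sum) (auto simp: N_def)
    finally have "(\<Sum>k\<in>P. \<Sum>l\<in>P. rel k l * ((N k + N l) / 2)) \<le> (\<Sum>k\<in>P. N k)" by simp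
    then show ?thesis using gap(2) by (intro diff_left_mono mult_left_mono) auto
  qed
  also have "\<dots> = (\<Sum>k\<in>P. \<Sum>l\<in>P. (if l = k then mass * N k else 0) - (mass - \<gamma>) * (rel k l * ((N k + N l) / 2)))"
    using P by (simp add: sum_subtractf sum_distrib_left sum.delta)
  also have "\<dots> \<le> (\<Sum>k\<in>P. \<Sum>l\<in>P. Re ((c k * cnj (c l)) * along \<theta> (fc \<psi>) (l - k)))"
    by (intro sum_mono entry)
  also have "\<dots> = avg_form \<theta> (tp P c)"
    unfolding avg_form_def integral_tp_square[OF L2_continuous[OF continuous_average]] fc_average
    by (simp only: Re_sum)
  finally show ?thesis using P by (simp add: nrm_tp N_def)
qed

lemma directional_control_irrational:
  assumes "\<And>k. k \<noteq> 0 \<Longrightarrow> fr k \<bullet> \<theta> \<noteq> 0"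
  shows "nrm (tp K c) = (1 / mass) * avg_form \<theta> (tp K c)"
proof -
  have av: "average \<theta> x = of_real mass" for x by (rule average_irrational) (rule assms)
  have "avg_form \<theta> (tp K c) = Re (LINT x|M. of_real (mass * (cmod (tp K c x))\<^sup>2))"
    unfolding avg_form_def by (simp only: av complex_norm_square[symmetric] of_real_mult)
  also have "\<dots> = mass * nrm (tp K c)"
    unfolding integral_complex_of_real Re_complex_of_real nrm_def by (rule integral_mult_right_zero)
  finally show ?thesis using mass_pos by simp
qed

text \<open>Let \<eta> be a cut-off to the region where the average is small, constant along
  \<theta>. Multiplication by \<eta> preserves \<open>fr k \<bullet> \<theta>\<close>, so the
  equation for \<eta> v is a family of one-dimensional equations in the variable \<xi> orthogonal to
  \<theta>. The derivatives of \<eta> live where the average is bounded below, hence their terms are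
  controlled by \<open>avg_form\<close>. Frequencies off the circle are recovered by division by the
  symbol; those near it are at most two on each line and fall under \<open>avg_form_sparse\<close>.
  The part (1 - \<eta>) v is controlled by \<open>avg_form\<close> directly.\<close>

lemma directional_control_resonant:
  assumes \<theta>: "norm \<theta> = 1" and j: "j \<noteq> 0" "fr j \<bullet> \<theta> = 0"
  shows "\<exists>\<eta> C. smooth \<eta> \<and> periodic \<eta> \<and> C \<ge> 0 \<and> (\<forall>x. cmod (\<eta> x) \<le> 1) \<and> (\<forall>x. \<phi> x = 1 \<longrightarrow> \<eta> x = 0) \<and>
    (\<forall>R K c h. 0 < R \<longrightarrow> finite K \<longrightarrow> (\<forall>k\<in>K. \<bar>fr k \<bullet> \<theta>\<bar> \<le> 2 * R) \<longrightarrow>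
      (\<forall>k. of_real ((norm (fr k))\<^sup>2 - R\<^sup>2) * c k = h k) \<longrightarrow>
      nrm (tp K c) \<le> C * avg_form \<theta> (tp K c) + C * nrm (\<lambda>x. \<eta> x * tp K h x))"
proof -
  obtain \<Phi> c0 where c0: "c0 > 0" and avg: "\<And>x. average \<theta> x = of_real (\<Phi> x)"
    and \<Phi>: "\<And>x. 0 \<le> \<Phi> x" "\<And>x. \<Phi> x \<le> 1" "\<And>x. \<phi> x = 1 \<Longrightarrow> c0 \<le> \<Phi> x"
    using average_resonant[OF assms] by blast
  obtain \<gamma> where gap: "\<gamma> > 0" "\<gamma> \<le> mass" "\<And>k. k \<noteq> 0 \<Longrightarrow> cmod (fc \<psi> k) \<le> mass - \<gamma>"
    using spectral_gap by blast
  have "\<Phi> = (\<lambda>x. Re (average \<theta> x))" by (simp add: avg)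
  then have c\<Phi>: "continuous_on UNIV \<Phi>"
    using continuous_on_Re[OF continuous_average] by simp
  define \<xi> where "\<xi> = perp \<theta>"
  have c08: "c0 / 8 > 0" using c0 by simp
  \<comment> \<open>A trigonometric polynomial close to the average replaces it: it is smooth, and
    still constant along \<theta> because \<open>along\<close> keeps only modes orthogonal to
    \<theta>.\<close>
  obtain J where J: "finite J" "\<And>x. cmod (average \<theta> x - tp J (along \<theta> (fc \<psi>)) x) \<le> c0 / 8"
    using wiener_approx[OF summable_along[OF summable_psi] c08] unfolding average_def by (meson order_refl)
  define q where "q x = Re (tp J (along \<theta> (fc \<psi>)) x)" for x
  have q\<Phi>: "\<bar>q x - \<Phi> x\<bar> \<le> c0 / 8" for x
    using J(2)[of x] abs_Re_le_cmod[of "average \<theta> x - tp J (along \<theta> (fc \<psi>)) x"] by (simp add: avg q_def abs_minus_commute)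
  have sq: "smooth q" unfolding q_def[abs_def] by (rule smooth_linear[OF bounded_linear_Re smooth_tp])
  have pq: "periodic q" unfolding q_def[abs_def] by (rule periodic_comp[OF periodic_tp])
  have lq: "q (x + t *\<^sub>R \<theta>) = q x" for x t
  proof -
    have "along \<theta> (fc \<psi>) k * e k (x + t *\<^sub>R \<theta>) = along \<theta> (fc \<psi>) k * e k x" for k
      by (simp add: along_def e_line)
    then show ?thesis by (simp only: q_def tp_def)
  qed
  \<comment> \<open>T falls from 1 at c0/2 to 0 at 7 c0/8, over a length 3 c0/8. As \<open>q\<close>
    is within c0/8 of \<Phi>, the upper end lies below the values of \<open>q\<close> on {\<phi> =
    1}, and above the lower end \<Phi> is at least 3 c0/8.\<close>
  define T where "T y = 1 - step (8 / (3 * c0) * (y - c0 / 2))" for y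
  have sT: "smooth T"
    unfolding T_def[abs_def]
    by (intro smooth_diff smooth_const smooth_compose_real[OF smooth_step] smooth_mult smooth_ident)
  have T: "0 \<le> T y" "T y \<le> 1" for y using step_range[of "8 / (3 * c0) * (y - c0 / 2)"] by (auto simp: T_def)
  have T0: "T y = 0" if "y \<ge> 7 * c0 / 8" for y
    using that c0 unfolding T_def by (subst step_1) (auto simp: field_simps)
  have T1: "T y = 1" if "y < c0 / 2" for y
  proof -
    have "8 / (3 * c0) * (y - c0 / 2) \<le> 0" using that c0 by (intro mult_nonneg_nonpos) auto
    then show ?thesis unfolding T_def by (simp only: step_0)
  qed
  define \<eta> where "\<eta> x = complex_of_real (T (q x))" for x
  have s\<eta>: "smooth \<eta>" unfolding \<eta>_def[abs_def] by (intro smooth_of_real smooth_compose_real[OF sT sq])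
  have p\<eta>: "periodic \<eta>" unfolding \<eta>_def[abs_def] by (rule periodic_comp[OF pq])
  have \<eta>1: "cmod (\<eta> x) \<le> 1" for x using T by (simp add: \<eta>_def)
  have \<eta>0: "\<eta> x = 0" if "\<phi> x = 1" for x
  proof -
    have "q x \<ge> 7 * c0 / 8" using \<Phi>(3)[OF that] q\<Phi>[of x] by linarith
    then show ?thesis using T0 by (simp add: \<eta>_def)
  qed
  have D\<theta>: "D \<theta> \<eta> x = 0" for x
  proof -
    have "((\<lambda>t. \<eta> (x + t *\<^sub>R \<theta>)) has_vector_derivative D \<theta> \<eta> (x + 0 *\<^sub>R \<theta>)) (at 0)"
      by (rule has_vector_derivative_line[OF s\<eta>])
    moreover have "((\<lambda>t. \<eta> (x + t *\<^sub>R \<theta>)) has_vector_derivative 0) (at 0)"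
      unfolding \<eta>_def lq by simp
    ultimately have "D \<theta> \<eta> (x + 0 *\<^sub>R \<theta>) = 0" by (rule vector_derivative_unique_at)
    then show ?thesis by simp
  qed
  \<comment> \<open>Consequently multiplication by \<eta> moves frequencies only along
    \<xi>.\<close>
  have fc\<eta>: "fc \<eta> k = 0" if "fr k \<bullet> \<theta> \<noteq> 0" for k
    using fc_D[OF s\<eta> p\<eta>, of \<theta> k] that by (simp add: D\<theta>[THEN ext])
  define D1 where "D1 = D \<xi> \<eta>"
  define D2 where "D2 = D \<xi> D1"
  have D12: "smooth D1" "periodic D1" "smooth D2" "periodic D2"
    unfolding D1_def D2_def by (intro smooth_D periodic_D s\<eta> p\<eta>)+
  have fcD1: "fc D1 k = \<i> * of_real (fr k \<bullet> \<xi>) * fc \<eta> k" for k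
    unfolding D1_def by (rule fc_D[OF s\<eta> p\<eta>])
  have fcD2: "fc D2 k = - of_real ((fr k \<bullet> \<xi>)\<^sup>2) * fc \<eta> k" for k
    unfolding D2_def fc_D[OF D12(1,2)] fcD1 by (simp add: power2_eq_square algebra_simps)
  define U where "U = {x. q x < c0 / 2}"
  have "open U" unfolding U_def
    by (intro open_Collect_less continuous_on_const smooth_continuous[OF sq])
  have D1U: "D1 x = 0" if "x \<in> U" for x
    unfolding D1_def by (rule D_zero_open[OF \<open>open U\<close> that, where c=1]) (simp add: U_def \<eta>_def T1)
  have D2U: "D2 x = 0" if "x \<in> U" for x
    unfolding D2_def by (rule D_zero_open[OF \<open>open U\<close> that, where c=0]) (rule D1U)
  obtain B1 where B1: "\<And>x. cmod (D1 x) \<le> B1" using smooth_bounded[OF D12(1,2)] by blast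
  obtain B2 where B2: "\<And>x. cmod (D2 x) \<le> B2" using smooth_bounded[OF D12(3,4)] by blast
  \<comment> \<open>The inverse of the lower bound 3 c0/8 for \<Phi> off \<open>U\<close>.\<close>
  define \<kappa> where "\<kappa> = 8 / (3 * c0)"
  have \<kappa>: "\<kappa> > 0" using c0 by (simp add: \<kappa>_def)
  have off: "\<kappa> * \<Phi> x \<ge> 1" if "x \<notin> U" for x
  proof -
    have "c0 / 2 \<le> q x" using that by (simp add: U_def)
    then have "\<Phi> x \<ge> 3 * c0 / 8" using q\<Phi>[of x] by linarith
    then have "\<kappa> * (3 * c0 / 8) \<le> \<kappa> * \<Phi> x" using \<kappa> by (intro mult_left_mono) auto
    then show ?thesis using c0 by (simp add: \<kappa>_def)
  qed
  have wt: "(cmod (f x))\<^sup>2 \<le> (B\<^sup>2 * \<kappa>) * \<Phi> x" if "cmod (f x) \<le> B" "x \<in> U \<Longrightarrow> f x = 0" for f x B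
  proof (cases "x \<in> U")
    case True then show ?thesis using that \<kappa> \<Phi>(1) by simp
  next
    case False
    have "(cmod (f x))\<^sup>2 \<le> B\<^sup>2 * 1" using power_mono[OF that(1), of 2] by simp
    also have "\<dots> \<le> B\<^sup>2 * (\<kappa> * \<Phi> x)" by (intro mult_left_mono off[OF False]) simp
    finally show ?thesis by (simp add: mult.assoc)
  qed
  \<comment> \<open>A quarter of the spacing: two frequencies of one line within \<open>c1\<close>
    of the same of the two points where the line meets the circle would differ by less than 2 c1, so
    each point attracts at most one.\<close>
  define c1 where "c1 = spacing / 4"
  have c1: "c1 > 0" using spacing_pos by (simp add: c1_def)
  define \<alpha> where "\<alpha> = 12 / c1\<^sup>2 * (B1\<^sup>2 * \<kappa>) + 3 / c1 ^ 4 * (B2\<^sup>2 * \<kappa>)"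
  define \<beta> where "\<beta> = 3 / c1 ^ 4"
  have \<alpha>\<beta>: "\<alpha> \<ge> 0" "\<beta> \<ge> 0" using \<kappa> by (auto simp: \<alpha>_def \<beta>_def)
  define C where "C = (8 / \<gamma> + 2 * \<kappa>) + (8 / \<gamma> + 4) * (\<alpha> + \<beta>)"
  have C: "C \<ge> 0" using gap(1) \<kappa> \<alpha>\<beta> by (auto simp: C_def intro!: add_nonneg_nonneg mult_nonneg_nonneg)
  have "nrm (tp K c) \<le> C * avg_form \<theta> (tp K c) + C * nrm (\<lambda>x. \<eta> x * tp K h x)"
    if R: "0 < R" and K: "finite K" "\<And>k. k \<in> K \<Longrightarrow> \<bar>fr k \<bullet> \<theta>\<bar> \<le> 2 * R"
      and eq: "\<And>k. of_real ((norm (fr k))\<^sup>2 - R\<^sup>2) * c k = h k" for R K c h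
  proof -
    define v where "v = tp K c"
    define X where "X = avg_form \<theta> v"
    define E where "E x = \<eta> x * tp K h x" for x
    define w where "w x = \<eta> x * v x" for x
    have sv: "smooth v" unfolding v_def by (rule smooth_tp)
    have L: "L2 v" "L2 E" "L2 w" "L2 (\<lambda>x. D1 x * v x)" "L2 (\<lambda>x. D2 x * v x)"
      unfolding E_def[abs_def] w_def[abs_def]
      by (intro L2_smooth smooth_mult sv s\<eta> D12 smooth_tp)+
    have af: "avg_form \<theta> f = (LINT x|M. \<Phi> x * (cmod (f x))\<^sup>2)" for f
    proof -
      have "avg_form \<theta> f = Re (LINT x|M. of_real (\<Phi> x * (cmod (f x))\<^sup>2))"
        unfolding avg_form_def by (simp only: avg complex_norm_square[symmetric] of_real_mult)
      then show ?thesis unfolding integral_complex_of_real by simp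
    qed
    have i\<Phi>: "integrable M (\<lambda>x. \<Phi> x * (cmod (f x))\<^sup>2)" if "continuous_on UNIV f" for f :: "real \<times> real \<Rightarrow> complex"
      by (intro integrable_smooth continuous_intros c\<Phi> that)
    have weight: "nrm (\<lambda>x. f x * v x) \<le> A * X" if f: "continuous_on UNIV f" and A: "\<And>x. (cmod (f x))\<^sup>2 \<le> A * \<Phi> x" for f A
    proof -
      have "nrm (\<lambda>x. f x * v x) \<le> (LINT x|M. A * (\<Phi> x * (cmod (v x))\<^sup>2))"
        unfolding nrm_def
      proof (rule integral_mono)
        show "integrable M (\<lambda>x. (cmod (f x * v x))\<^sup>2)"
          by (intro integrable_smooth continuous_intros f smooth_continuous[OF sv])
        show "integrable M (\<lambda>x. A * (\<Phi> x * (cmod (v x))\<^sup>2))"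
          using i\<Phi>[OF smooth_continuous[OF sv]] by simp
        show "(cmod (f x * v x))\<^sup>2 \<le> A * (\<Phi> x * (cmod (v x))\<^sup>2)" for x
          using mult_right_mono[OF A[of x], of "(cmod (v x))\<^sup>2"] by (simp add: norm_mult power_mult_distrib mult.assoc)
      qed
      then show ?thesis by (simp add: X_def af)
    qed
    have X0: "X \<ge> 0" unfolding X_def af using \<Phi> by (intro Bochner_Integration.integral_nonneg) simp
    have n1: "nrm (\<lambda>x. D1 x * v x) \<le> (B1\<^sup>2 * \<kappa>) * X"
    proof (rule weight[OF smooth_continuous[OF D12(1)]])
      show "(cmod (D1 x))\<^sup>2 \<le> B1\<^sup>2 * \<kappa> * \<Phi> x" for x by (rule wt[OF B1 D1U])
    qed
    have n2: "nrm (\<lambda>x. D2 x * v x) \<le> (B2\<^sup>2 * \<kappa>) * X"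
    proof (rule weight[OF smooth_continuous[OF D12(3)]])
      show "(cmod (D2 x))\<^sup>2 \<le> B2\<^sup>2 * \<kappa> * \<Phi> x" for x by (rule wt[OF B2 D2U])
    qed
    have n3: "nrm (\<lambda>x. (1 - \<eta> x) * v x) \<le> \<kappa> * X"
    proof -
      have "cmod (1 - \<eta> x) \<le> 1" for x
      proof -
        have "1 - \<eta> x = of_real (1 - T (q x))" by (simp add: \<eta>_def)
        then show ?thesis using T[of "q x"] by (simp only: norm_of_real)
      qed
      then have "(cmod (1 - \<eta> x))\<^sup>2 \<le> (1\<^sup>2 * \<kappa>) * \<Phi> x" for x
        by (rule wt) (simp add: U_def \<eta>_def T1)
      from weight[OF _ this] show ?thesis
        by (simp add: continuous_on_diff smooth_continuous[OF s\<eta>])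
    qed
    have fcw: "fc w k = (\<Sum>l\<in>K. c l * fc \<eta> (k - l))" for k
      unfolding w_def[abs_def] v_def by (rule fc_mult_tp[OF L2_smooth[OF s\<eta>]])
    \<comment> \<open>Frequencies \<open>k\<close> and \<open>l\<close> linked by \<eta> have the
      same component along \<theta>, so their squared norms differ by the transverse part only.
      Rewriting that part with the \<xi>-component of \<open>k\<close>, not of \<open>l\<close>,
      puts the derivative outside \<open>D1 * v\<close>, where the symbol can absorb it.\<close>
    have key: "of_real ((norm (fr k))\<^sup>2 - R\<^sup>2) * fc w k =
        fc E k - 2 * \<i> * of_real (fr k \<bullet> \<xi>) * fc (\<lambda>x. D1 x * v x) k + fc (\<lambda>x. D2 x * v x) k" for k
    proof -
      have pt: "of_real ((norm (fr k))\<^sup>2 - R\<^sup>2) * (c l * fc \<eta> (k - l)) =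
          h l * fc \<eta> (k - l) - 2 * \<i> * of_real (fr k \<bullet> \<xi>) * (c l * fc D1 (k - l)) + c l * fc D2 (k - l)" for l
      proof (cases "fc \<eta> (k - l) = 0")
        case True then show ?thesis by (simp add: fcD1 fcD2)
      next
        case False
        define x where "x = fr k \<bullet> \<xi>"
        define y where "y = fr (k - l) \<bullet> \<xi>"
        have "fr (k - l) \<bullet> \<theta> = 0" using False fc\<eta> by blast
        then have th: "fr k \<bullet> \<theta> = fr l \<bullet> \<theta>" by (simp add: fr_diff inner_diff_left)
        have ly: "fr l \<bullet> \<xi> = x - y" by (simp add: x_def y_def fr_diff inner_diff_left)
        have eqk: "(norm (fr k))\<^sup>2 - R\<^sup>2 = ((norm (fr l))\<^sup>2 - R\<^sup>2) + (2 * x * y - y\<^sup>2)"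
          unfolding norm_perp_decomp[OF \<theta>] th \<xi>_def[symmetric] ly x_def[symmetric]
          by (simp add: power2_eq_square algebra_simps)
        have "of_real ((norm (fr k))\<^sup>2 - R\<^sup>2) * (c l * fc \<eta> (k - l)) =
            of_real ((norm (fr l))\<^sup>2 - R\<^sup>2) * c l * fc \<eta> (k - l) + of_real (2 * x * y - y\<^sup>2) * (c l * fc \<eta> (k - l))"
          by (simp only: eqk of_real_add distrib_right mult.assoc)
        also have "of_real ((norm (fr l))\<^sup>2 - R\<^sup>2) * c l = h l" by (rule eq)
        finally show ?thesis
          unfolding fcD1 fcD2 x_def[symmetric] y_def[symmetric] by (simp add: algebra_simps)
      qed
      have "of_real ((norm (fr k))\<^sup>2 - R\<^sup>2) * fc w k = (\<Sum>l\<in>K. of_real ((norm (fr k))\<^sup>2 - R\<^sup>2) * (c l * fc \<eta> (k - l)))"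
        unfolding fcw by (rule sum_distrib_left)
      also have "\<dots> = fc E k - 2 * \<i> * of_real (fr k \<bullet> \<xi>) * fc (\<lambda>x. D1 x * v x) k + fc (\<lambda>x. D2 x * v x) k"
        unfolding E_def[abs_def] v_def fc_mult_tp[OF L2_smooth[OF s\<eta>]] fc_mult_tp[OF L2_smooth[OF D12(1)]]
          fc_mult_tp[OF L2_smooth[OF D12(3)]] pt sum.distrib sum_subtractf by (simp only: sum_distrib_left)
      finally show ?thesis .
    qed
    \<comment> \<open>Half the chord cut by the circle of radius \<open>R\<close> on the line of
      \<open>k\<close> orthogonal to \<theta>, or 0 if the line misses the circle.\<close>
    define s where "s k = sqrt (max 0 (R\<^sup>2 - (fr k \<bullet> \<theta>)\<^sup>2))" for k
    define P where "P = {k. \<bar>fr k \<bullet> \<theta>\<bar> \<le> 2 * R \<and> \<bar>\<bar>fr k \<bullet> \<xi>\<bar> - s k\<bar> < c1}"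
    have finP: "finite P"
    proof (rule finite_subset[OF _ finite_fr_ball])
      show "P \<subseteq> {k. norm (fr k) \<le> 2 * R + (R + c1)}"
      proof
        fix k assume k: "k \<in> P"
        have "s k \<le> sqrt (R\<^sup>2)" unfolding s_def by (intro real_sqrt_le_mono) simp
        then have "s k \<le> R" using R by simp
        then have b: "\<bar>fr k \<bullet> \<theta>\<bar> \<le> 2 * R" "\<bar>fr k \<bullet> \<xi>\<bar> \<le> R + c1" using k by (auto simp: P_def)
        have "norm (fr k) = sqrt ((fr k \<bullet> \<theta>)\<^sup>2 + (fr k \<bullet> \<xi>)\<^sup>2)"
          using norm_perp_decomp[OF \<theta>, of "fr k"] \<xi>_def by (metis norm_ge_zero real_sqrt_unique)
        also have "\<dots> \<le> \<bar>fr k \<bullet> \<theta>\<bar> + \<bar>fr k \<bullet> \<xi>\<bar>" by (rule sqrt_sum_squares_le_sum_abs)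
        finally show "k \<in> {k. norm (fr k) \<le> 2 * R + (R + c1)}" using b by simp
      qed
    qed
    define p where "p = tp P (fc w)"
    define r where "r x = w x - p x" for x
    have Lp: "L2 p" "L2 r" unfolding p_def r_def[abs_def] by (intro L2_diff L L2_tp)+
    have fcr: "fc r k = (if k \<in> P then 0 else fc w k)" for k
      unfolding r_def[abs_def] p_def using finP by (simp add: fc_diff L L2_tp fc_tp)
    \<comment> \<open>Off \<open>P\<close> the symbol exceeds both c1^2 and c1 times the
      \<xi>-component. The constants are those of the square of a sum of three terms, with 12 = 3 *
      2^2.\<close>
    have nr: "nrm r \<le> 3 / c1 ^ 4 * nrm E + 12 / c1\<^sup>2 * nrm (\<lambda>x. D1 x * v x) + 3 / c1 ^ 4 * nrm (\<lambda>x. D2 x * v x)"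
    proof (rule nrm_le_fc3[OF Lp(2) L(2) L(4) L(5)])
      fix k
      show "(cmod (fc r k))\<^sup>2 \<le> 3 / c1 ^ 4 * (cmod (fc E k))\<^sup>2 + 12 / c1\<^sup>2 * (cmod (fc (\<lambda>x. D1 x * v x) k))\<^sup>2 +
          3 / c1 ^ 4 * (cmod (fc (\<lambda>x. D2 x * v x) k))\<^sup>2"
      proof (cases "k \<in> P \<or> fc w k = 0")
        case True
        then have "fc r k = 0" by (auto simp: fcr)
        then show ?thesis by (simp add: add_nonneg_nonneg)
      next
        case False
        define A where "A = \<bar>(norm (fr k))\<^sup>2 - R\<^sup>2\<bar>"
        obtain l where l: "l \<in> K" "c l * fc \<eta> (k - l) \<noteq> 0"
          using False unfolding fcw by (meson sum.not_neutral_contains_not_neutral)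
        then have "fr (k - l) \<bullet> \<theta> = 0" using fc\<eta>[of "k - l"] by auto
        then have "fr k \<bullet> \<theta> = fr l \<bullet> \<theta>" by (simp add: fr_diff inner_diff_left)
        then have "\<bar>fr k \<bullet> \<theta>\<bar> \<le> 2 * R" using K(2)[OF l(1)] by simp
        then have "\<bar>\<bar>fr k \<bullet> \<xi>\<bar> - s k\<bar> \<ge> c1" using False by (auto simp: P_def)
        from off_shell_bound[OF c1 this[unfolded s_def]]
        have A: "c1 * \<bar>fr k \<bullet> \<xi>\<bar> \<le> A" "c1\<^sup>2 \<le> A"
          unfolding A_def norm_perp_decomp[OF \<theta>] \<xi>_def[symmetric] by (simp_all add: algebra_simps)
        have A0: "A > 0" using A(2) c1 by (meson less_le_trans zero_less_power)
        define x where "x = cmod (fc E k)"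
        define y where "y = cmod (fc (\<lambda>x. D1 x * v x) k)"
        define z where "z = cmod (fc (\<lambda>x. D2 x * v x) k)"
        have xyz: "x \<ge> 0" "y \<ge> 0" "z \<ge> 0" by (auto simp: x_def y_def z_def)
        have "A * cmod (fc w k) = cmod (of_real ((norm (fr k))\<^sup>2 - R\<^sup>2) * fc w k)"
          unfolding A_def norm_mult norm_of_real ..
        also have "\<dots> \<le> x + 2 * \<bar>fr k \<bullet> \<xi>\<bar> * y + z"
          unfolding key x_def y_def z_def
          by (rule order_trans[OF norm_triangle_ineq], rule add_right_mono, rule order_trans[OF norm_triangle_ineq4])
            (simp add: norm_mult)
        finally have Aw: "A * cmod (fc w k) \<le> x + 2 * \<bar>fr k \<bullet> \<xi>\<bar> * y + z" .
        have "cmod (fc w k) \<le> (x + 2 * \<bar>fr k \<bullet> \<xi>\<bar> * y + z) / A"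
          using Aw A0 by (simp add: pos_le_divide_eq mult.commute)
        also have "\<dots> = x / A + 2 * (\<bar>fr k \<bullet> \<xi>\<bar> / A) * y + z / A" by (simp add: add_divide_distrib)
        also have "\<dots> \<le> x / c1\<^sup>2 + 2 * (1 / c1) * y + z / c1\<^sup>2"
        proof (intro add_mono mult_right_mono mult_left_mono divide_left_mono)
          show "\<bar>fr k \<bullet> \<xi>\<bar> / A \<le> 1 / c1" using A(1) A0 c1 by (simp add: field_simps)
        qed (use xyz A A0 c1 in auto)
        finally have "(cmod (fc w k))\<^sup>2 \<le> (x / c1\<^sup>2 + 2 * (1 / c1) * y + z / c1\<^sup>2)\<^sup>2"
          by (intro power_mono) auto
        also have "\<dots> \<le> 3 * ((x / c1\<^sup>2)\<^sup>2 + (2 * (1 / c1) * y)\<^sup>2 + (z / c1\<^sup>2)\<^sup>2)"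
        proof -
          have "(u + v + w)\<^sup>2 \<le> 3 * (u\<^sup>2 + v\<^sup>2 + w\<^sup>2)" for u v w :: real
            using zero_le_power2[of "u - v"] zero_le_power2[of "u - w"] zero_le_power2[of "v - w"]
            by (simp add: power2_eq_square algebra_simps)
          then show ?thesis .
        qed
        also have "\<dots> = 3 / c1 ^ 4 * x\<^sup>2 + 12 / c1\<^sup>2 * y\<^sup>2 + 3 / c1 ^ 4 * z\<^sup>2"
          by (simp add: power_divide power_mult_distrib algebra_simps power2_eq_square power4_eq_xxxx)
        finally show ?thesis using False by (simp add: fcr x_def y_def z_def)
      qed
    qed
    have nr': "nrm r \<le> \<alpha> * X + \<beta> * nrm E"
    proof -
      have "12 / c1\<^sup>2 * nrm (\<lambda>x. D1 x * v x) \<le> 12 / c1\<^sup>2 * ((B1\<^sup>2 * \<kappa>) * X)" by (intro mult_left_mono n1) simp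
      moreover have "3 / c1 ^ 4 * nrm (\<lambda>x. D2 x * v x) \<le> 3 / c1 ^ 4 * ((B2\<^sup>2 * \<kappa>) * X)" by (intro mult_left_mono n2) simp
      ultimately show ?thesis using nr unfolding \<alpha>_def \<beta>_def distrib_right mult.assoc by linarith
    qed
    \<comment> \<open>The form is passed from \<open>p = w - r\<close> back to \<open>v\<close>,
      using \<bar>w\<bar> \<le> \<bar>v\<bar> for the first term and \<Phi> \<le> 1 for the
      remainder.\<close>
    have np: "\<gamma> * nrm p \<le> 2 * X + 2 * nrm r"
    proof -
      have "\<gamma> * nrm p \<le> avg_form \<theta> p"
        unfolding p_def
      proof (rule avg_form_sparse[OF finP gap])
        fix k l l' assume P: "k \<in> P" "l \<in> P" "l' \<in> P" and ne: "l \<noteq> k" "l' \<noteq> k"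
          and o: "fr (l - k) \<bullet> \<theta> = 0" "fr (l' - k) \<bullet> \<theta> = 0"
        show "l = l'"
        proof (rule ccontr)
          assume "l \<noteq> l'"
          have sp: "4 * c1 \<le> \<bar>fr x \<bullet> \<xi> - fr y \<bullet> \<xi>\<bar>" if "x \<noteq> y" "fr x \<bullet> \<theta> = fr y \<bullet> \<theta>" for x y
          proof -
            have "(norm (fr (x - y)))\<^sup>2 = (fr x \<bullet> \<xi> - fr y \<bullet> \<xi>)\<^sup>2"
              unfolding norm_perp_decomp[OF \<theta>] \<xi>_def using that(2) by (simp add: fr_diff inner_diff_left)
            then have "norm (fr (x - y)) = \<bar>fr x \<bullet> \<xi> - fr y \<bullet> \<xi>\<bar>"
              by (metis abs_norm_cancel real_sqrt_abs)
            then show ?thesis using norm_fr_ge[of "x - y"] that(1) by (simp add: c1_def)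
          qed
          have th: "fr l \<bullet> \<theta> = fr k \<bullet> \<theta>" "fr l' \<bullet> \<theta> = fr k \<bullet> \<theta>" using o by (auto simp: fr_diff inner_diff_left)
          have "s l = s k" "s l' = s k" by (auto simp: s_def th)
          then have "\<bar>\<bar>fr k \<bullet> \<xi>\<bar> - s k\<bar> < c1" "\<bar>\<bar>fr l \<bullet> \<xi>\<bar> - s k\<bar> < c1" "\<bar>\<bar>fr l' \<bullet> \<xi>\<bar> - s k\<bar> < c1"
            using P by (auto simp: P_def)
          moreover have "4 * c1 \<le> \<bar>fr l \<bullet> \<xi> - fr k \<bullet> \<xi>\<bar>" "4 * c1 \<le> \<bar>fr l' \<bullet> \<xi> - fr k \<bullet> \<xi>\<bar>" "4 * c1 \<le> \<bar>fr l \<bullet> \<xi> - fr l' \<bullet> \<xi>\<bar>"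
            using sp ne \<open>l \<noteq> l'\<close> th by auto
          ultimately show False using c1 by (smt (verit))
        qed
      qed
      also have "\<dots> \<le> (LINT x|M. 2 * (\<Phi> x * (cmod (v x))\<^sup>2) + 2 * (cmod (r x))\<^sup>2)"
        unfolding af
      proof (rule integral_mono)
        show "integrable M (\<lambda>x. \<Phi> x * (cmod (p x))\<^sup>2)"
          unfolding p_def by (rule i\<Phi>[OF smooth_continuous[OF smooth_tp]])
        show "integrable M (\<lambda>x. 2 * (\<Phi> x * (cmod (v x))\<^sup>2) + 2 * (cmod (r x))\<^sup>2)"
          using i\<Phi>[OF smooth_continuous[OF sv]] L2_integrable[OF Lp(2)] by simp
        show "\<Phi> x * (cmod (p x))\<^sup>2 \<le> 2 * (\<Phi> x * (cmod (v x))\<^sup>2) + 2 * (cmod (r x))\<^sup>2" for x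
        proof -
          have "p x = w x - r x" by (simp add: r_def)
          then have "cmod (p x) \<le> cmod (w x) + cmod (r x)" by (simp add: norm_triangle_ineq4)
          also have "cmod (w x) \<le> cmod (v x)" using mult_right_mono[OF \<eta>1, of "cmod (v x)" x] by (simp add: w_def norm_mult)
          finally have "(cmod (p x))\<^sup>2 \<le> (cmod (v x) + cmod (r x))\<^sup>2" by (intro power_mono) auto
          also have "\<dots> \<le> 2 * (cmod (v x))\<^sup>2 + 2 * (cmod (r x))\<^sup>2"
            using sum_squares_bound[of "cmod (v x)" "cmod (r x)"] by (simp add: power2_sum)
          finally have "\<Phi> x * (cmod (p x))\<^sup>2 \<le> \<Phi> x * (2 * (cmod (v x))\<^sup>2 + 2 * (cmod (r x))\<^sup>2)"
            by (rule mult_left_mono[OF _ \<Phi>(1)])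
          also have "\<dots> = 2 * (\<Phi> x * (cmod (v x))\<^sup>2) + \<Phi> x * (2 * (cmod (r x))\<^sup>2)" by (simp add: algebra_simps)
          also have "\<Phi> x * (2 * (cmod (r x))\<^sup>2) \<le> 1 * (2 * (cmod (r x))\<^sup>2)" by (intro mult_right_mono \<Phi>) simp
          finally show ?thesis by simp
        qed
      qed
      also have "\<dots> = 2 * X + 2 * nrm r"
        unfolding X_def af nrm_def using i\<Phi>[OF smooth_continuous[OF sv]] L2_integrable[OF Lp(2)] by simp
      finally show ?thesis .
    qed
    have "nrm v \<le> 2 * nrm w + 2 * nrm (\<lambda>x. (1 - \<eta> x) * v x)"
    proof -
      have "(\<lambda>x. w x + (1 - \<eta> x) * v x) = v" by (auto simp: w_def algebra_simps)
      moreover have "L2 (\<lambda>x. (1 - \<eta> x) * v x)" by (intro L2_smooth smooth_mult smooth_diff smooth_const s\<eta> sv)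
      ultimately show ?thesis using nrm_add_le[OF L(3), of "\<lambda>x. (1 - \<eta> x) * v x"] by simp
    qed
    moreover have "nrm w \<le> 2 * nrm p + 2 * nrm r"
      using nrm_add_le[OF Lp] by (simp add: r_def)
    ultimately have "nrm v \<le> 4 * nrm p + 4 * nrm r + 2 * \<kappa> * X" using n3 by linarith
    also have "4 * nrm p \<le> 4 * ((2 * X + 2 * nrm r) / \<gamma>)"
      using np gap(1) by (intro mult_left_mono) (simp_all add: pos_le_divide_eq mult.commute)
    also have "4 * ((2 * X + 2 * nrm r) / \<gamma>) + 4 * nrm r + 2 * \<kappa> * X = (8 / \<gamma> + 2 * \<kappa>) * X + (8 / \<gamma> + 4) * nrm r"
      using gap(1) by (simp add: field_simps)
    also have "\<dots> \<le> (8 / \<gamma> + 2 * \<kappa>) * X + (8 / \<gamma> + 4) * (\<alpha> * X + \<beta> * nrm E)"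
      using gap(1) by (intro add_left_mono mult_left_mono nr') auto
    also have "\<dots> \<le> C * X + C * nrm E"
    proof -
      have "(8 / \<gamma> + 4) * (\<alpha> * X + \<beta> * nrm E) \<le> (8 / \<gamma> + 4) * ((\<alpha> + \<beta>) * X + (\<alpha> + \<beta>) * nrm E)"
        using gap(1) \<alpha>\<beta> X0 by (intro mult_left_mono add_mono mult_right_mono) auto
      moreover have "0 \<le> (8 / \<gamma> + 2 * \<kappa>) * nrm E" using gap(1) \<kappa> by simp
      moreover have "(u + w * (\<alpha> + \<beta>)) * X + (u + w * (\<alpha> + \<beta>)) * nrm E =
          u * X + u * nrm E + w * ((\<alpha> + \<beta>) * X + (\<alpha> + \<beta>) * nrm E)" for u w
        by (simp add: algebra_simps)
      ultimately show ?thesis unfolding C_def by simp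
    qed
    finally show ?thesis by (simp add: v_def X_def E_def[abs_def])
  qed
  note main = this
  show ?thesis
    by (intro exI[of _ \<eta>] exI[of _ C] conjI s\<eta> p\<eta> C allI impI \<eta>1 \<eta>0, assumption, rule main) blast+
qed

lemma directional_control:
  assumes \<theta>: "norm \<theta> = 1"
  shows "\<exists>\<eta> C. smooth \<eta> \<and> periodic \<eta> \<and> C \<ge> 0 \<and> (\<forall>x. cmod (\<eta> x) \<le> 1) \<and> (\<forall>x. \<phi> x = 1 \<longrightarrow> \<eta> x = 0) \<and>
    (\<forall>R K c h. 0 < R \<longrightarrow> finite K \<longrightarrow> (\<forall>k\<in>K. \<bar>fr k \<bullet> \<theta>\<bar> \<le> 2 * R) \<longrightarrow>
      (\<forall>k. of_real ((norm (fr k))\<^sup>2 - R\<^sup>2) * c k = h k) \<longrightarrow>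
      nrm (tp K c) \<le> C * avg_form \<theta> (tp K c) + C * nrm (\<lambda>x. \<eta> x * tp K h x))"
proof (cases "\<exists>j. j \<noteq> 0 \<and> fr j \<bullet> \<theta> = 0")
  case True
  then show ?thesis using directional_control_resonant[OF \<theta>] by blast
next
  case False
  then have "nrm (tp K c) = (1 / mass) * avg_form \<theta> (tp K c)" for K c
    by (intro directional_control_irrational) blast
  then show ?thesis
    using mass_pos
    by (intro exI[of _ "\<lambda>x. 0"] exI[of _ "1 / mass"]) (simp add: periodic_const)
qed

end

subsection \<open>High frequencies\<close>

lemma has_sum_sum_finite:
  fixes f :: "'i \<Rightarrow> 'a \<Rightarrow> real"
  assumes "finite I" "\<And>i. i \<in> I \<Longrightarrow> (f i has_sum s i) A"
  shows "((\<lambda>x. \<Sum>i\<in>I. f i x) has_sum (\<Sum>i\<in>I. s i)) A"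
  using assms by (induction I rule: finite_induct) (auto intro: has_sum_add)

context torus begin

section \<open>Localisation in frequency\<close>

text \<open>A Lipschitz profile is all that \<open>commutator\<close> asks for. Its slope is 1 /
  (\<delta> R), so moving it past a smooth function costs O(1/R).\<close>

definition tent :: "real \<Rightarrow> real \<Rightarrow> real \<times> real \<Rightarrow> int \<times> int \<Rightarrow> real" where
  "tent \<delta> R \<theta> k = max 0 (1 - norm (fr k - R *\<^sub>R \<theta>) / (\<delta> * R))"

definition sector :: "real \<Rightarrow> real \<Rightarrow> real \<times> real \<Rightarrow> (int \<times> int) set" where
  "sector \<delta> R \<theta> = {k. norm (fr k - R *\<^sub>R \<theta>) \<le> \<delta> * R}"

text \<open>The Fourier form of - \<Delta> w - R^2 w = div (F1, F2) + G.\<close>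

definition helmholtz where
  "helmholtz R w F1 F2 G \<longleftrightarrow> (\<forall>k. of_real ((norm (fr k))\<^sup>2 - R\<^sup>2) * fc w k =
     \<i> * of_real (fst (fr k)) * fc F1 k + \<i> * of_real (snd (fr k)) * fc F2 k + fc G k)"

context
  fixes \<delta> R :: real and \<theta> :: "real \<times> real"
  assumes \<delta>: "0 < \<delta>" "\<delta> \<le> 1" and R: "1 \<le> R" and \<theta>: "norm \<theta> = 1"
begin

lemma dR_pos: "\<delta> * R > 0" using \<delta> R by simp

lemma tent_range: "0 \<le> tent \<delta> R \<theta> k" "tent \<delta> R \<theta> k \<le> 1"
  using dR_pos by (auto simp: tent_def)

lemma tent_outside: "k \<notin> sector \<delta> R \<theta> \<Longrightarrow> tent \<delta> R \<theta> k = 0"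
  using dR_pos by (auto simp: tent_def sector_def field_simps)

lemma sector_norm: "k \<in> sector \<delta> R \<theta> \<Longrightarrow> norm (fr k) \<le> 2 * R"
proof -
  assume "k \<in> sector \<delta> R \<theta>"
  then have "norm (fr k - R *\<^sub>R \<theta>) \<le> \<delta> * R" by (simp add: sector_def)
  moreover have "norm (R *\<^sub>R \<theta>) = R" using R \<theta> by simp
  moreover have "\<delta> * R \<le> 1 * R" using \<delta> R by (intro mult_right_mono) auto
  ultimately show ?thesis using norm_triangle_sub[of "fr k" "R *\<^sub>R \<theta>"] by linarith
qed

lemma finite_sector: "finite (sector \<delta> R \<theta>)"
  by (rule finite_subset[OF _ finite_fr_ball[of "2 * R"]]) (use sector_norm in auto)

lemma tent_lipschitz: "\<bar>tent \<delta> R \<theta> k - tent \<delta> R \<theta> l\<bar> \<le> 1 / (\<delta> * R) * norm (fr k - fr l)"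
proof -
  have "\<bar>tent \<delta> R \<theta> k - tent \<delta> R \<theta> l\<bar> \<le> \<bar>norm (fr k - R *\<^sub>R \<theta>) / (\<delta> * R) - norm (fr l - R *\<^sub>R \<theta>) / (\<delta> * R)\<bar>"
  proof -
    have "\<bar>max 0 (1 - x) - max 0 (1 - y)\<bar> \<le> \<bar>x - y\<bar>" for x y :: real
      by (auto simp: max_def abs_if)
    then show ?thesis unfolding tent_def by blast
  qed
  also have "\<dots> = \<bar>norm (fr k - R *\<^sub>R \<theta>) - norm (fr l - R *\<^sub>R \<theta>)\<bar> / (\<delta> * R)"
    using dR_pos by (simp only: diff_divide_distrib[symmetric] abs_divide)
  also have "\<dots> \<le> norm ((fr k - R *\<^sub>R \<theta>) - (fr l - R *\<^sub>R \<theta>)) / (\<delta> * R)"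
    using dR_pos by (intro divide_right_mono norm_triangle_ineq3) auto
  finally show ?thesis by simp
qed

text \<open>The symbol of a derivative localised to a sector: it grows up to 2 R while the tent has
  slope 1 / (\<delta> R), so the product has a Lipschitz constant independent of
  \<open>R\<close>.\<close>

lemma tent_times_lipschitz:
  assumes u: "\<And>k. \<bar>u k\<bar> \<le> norm (fr k)" "\<And>k l. \<bar>u k - u l\<bar> \<le> norm (fr k - fr l)"
  shows "\<bar>u k * tent \<delta> R \<theta> k - u l * tent \<delta> R \<theta> l\<bar> \<le> (2 / \<delta> + 1) * norm (fr k - fr l)"
proof -
  let ?t = "tent \<delta> R \<theta>"
  have *: "\<bar>u k * ?t k - u l * ?t l\<bar> \<le> (2 / \<delta> + 1) * norm (fr k - fr l)" if k: "k \<in> sector \<delta> R \<theta>" for k l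
  proof -
    have "u k * ?t k - u l * ?t l = u k * (?t k - ?t l) + (u k - u l) * ?t l" by (simp add: algebra_simps)
    then have "\<bar>u k * ?t k - u l * ?t l\<bar> \<le> \<bar>u k\<bar> * \<bar>?t k - ?t l\<bar> + \<bar>u k - u l\<bar> * \<bar>?t l\<bar>"
      by (metis abs_mult abs_triangle_ineq)
    also have "\<dots> \<le> (2 * R) * (1 / (\<delta> * R) * norm (fr k - fr l)) + norm (fr k - fr l) * 1"
      using u tent_lipschitz tent_range R order_trans[OF u(1)[of k] sector_norm[OF k]]
      by (intro add_mono mult_mono) auto
    also have "\<dots> = (2 / \<delta> + 1) * norm (fr k - fr l)" using R \<delta> by (simp add: field_simps)
    finally show ?thesis .
  qed
  show ?thesis
  proof (cases "k \<in> sector \<delta> R \<theta>")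
    case True then show ?thesis by (rule *)
  next
    case k: False
    show ?thesis
    proof (cases "l \<in> sector \<delta> R \<theta>")
      case True
      from *[OF this, of k] show ?thesis by (simp add: abs_minus_commute norm_minus_commute)
    next
      case False
      then show ?thesis using k \<delta> by (simp add: tent_outside)
    qed
  qed
qed

end

end

context observed_torus begin

text \<open>\<open>directional_control\<close> bounds the piece by its averaged weight and by \<eta>
  times the localised source; \<open>transport\<close> exchanges the averaged weight for \<phi>^2;
  commutators undo the localisation. The support condition on F1 and F2 is there to make \<eta> F1
  and \<eta> F2 vanish.\<close>

lemma directional_estimate:
  assumes \<theta>: "norm \<theta> = 1"
  shows "\<exists>\<delta> C. 0 < \<delta> \<and> \<delta> \<le> 1 \<and> 0 \<le> C \<and> (\<forall>R w F1 F2 G. 1 \<le> R \<longrightarrow> L2 w \<longrightarrow> L2 F1 \<longrightarrow> L2 F2 \<longrightarrow> L2 G \<longrightarrow>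
     (\<forall>x. \<phi> x \<noteq> 1 \<longrightarrow> F1 x = 0 \<and> F2 x = 0) \<longrightarrow> helmholtz R w F1 F2 G \<longrightarrow>
     nrm (multiplier (sector \<delta> R \<theta>) (\<lambda>k. of_real (tent \<delta> R \<theta> k)) w)
       \<le> C * (nrm (\<lambda>x. of_real (\<phi> x) * w x) + nrm F1 + nrm F2 + nrm G) + C / R\<^sup>2 * nrm w)"
proof -
  obtain \<eta> C0 where \<eta>: "smooth \<eta>" "periodic \<eta>" "C0 \<ge> 0" "\<forall>x. cmod (\<eta> x) \<le> 1" "\<forall>x. \<phi> x = 1 \<longrightarrow> \<eta> x = 0"
    and control: "\<forall>R K c h. 0 < R \<longrightarrow> finite K \<longrightarrow> (\<forall>k\<in>K. \<bar>fr k \<bullet> \<theta>\<bar> \<le> 2 * R) \<longrightarrow>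
      (\<forall>k. of_real ((norm (fr k))\<^sup>2 - R\<^sup>2) * c k = h k) \<longrightarrow>
      nrm (tp K c) \<le> C0 * avg_form \<theta> (tp K c) + C0 * nrm (\<lambda>x. \<eta> x * tp K h x)"
    using directional_control[OF \<theta>] by (elim exE conjE) (rule that; assumption)
  \<comment> \<open>Small enough for the transport error, multiplied by \<open>C0\<close>, to be
    absorbed by half of the left side.\<close>
  define \<epsilon> where "\<epsilon> = 1 / (2 * (C0 + 1))"
  have \<epsilon>: "\<epsilon> > 0" "C0 * \<epsilon> \<le> 1 / 2" using \<eta>(3) by (auto simp: \<epsilon>_def field_simps)
  obtain \<delta>0 Ct where \<delta>0: "\<delta>0 > 0" "Ct \<ge> 0"
    and tr: "\<forall>\<delta> K c R h. 0 \<le> \<delta> \<longrightarrow> \<delta> \<le> \<delta>0 \<longrightarrow> finite K \<longrightarrow> (\<forall>k. k \<notin> K \<longrightarrow> c k = 0) \<longrightarrow> R > 0 \<longrightarrow>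
     (\<forall>k\<in>K. norm (fr k - R *\<^sub>R \<theta>) \<le> \<delta> * R) \<longrightarrow> (\<forall>k. of_real ((norm (fr k))\<^sup>2 - R\<^sup>2) * c k = of_real R * h k) \<longrightarrow>
     cmod ((LINT x|M. \<psi> x * (tp K c x * cnj (tp K c x))) - (LINT x|M. average \<theta> x * (tp K c x * cnj (tp K c x))))
       \<le> \<epsilon> * nrm (tp K c) + Ct * (\<Sum>k\<in>K. (cmod (h k))\<^sup>2)"
    using transport[OF smooth_psi periodic_psi \<epsilon>(1), of \<theta>, folded average_def]
    by (elim exE conjE) (rule that)
  define \<delta> where "\<delta> = min \<delta>0 1"
  have \<delta>: "0 < \<delta>" "\<delta> \<le> 1" "\<delta> \<le> \<delta>0" using \<delta>0 by (auto simp: \<delta>_def)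
  define \<phi>c where "\<phi>c x = complex_of_real (\<phi> x)" for x
  have \<phi>c: "smooth \<phi>c" "periodic \<phi>c"
    unfolding \<phi>c_def[abs_def] by (intro smooth_of_real smooth_phi periodic_comp[OF periodic_phi])+
  define g1 where "g1 = (grad_sum \<phi>c / \<delta>)\<^sup>2"
  define g2 where "g2 = ((2 / \<delta> + 1) * grad_sum \<eta>)\<^sup>2"
  define C where "C = 2 * (C0 * (2 + 2 * g1 + 12 * Ct) + C0 * (3 * g2 + 3))"
  have g: "g1 \<ge> 0" "g2 \<ge> 0" by (auto simp: g1_def g2_def)
  have C: "C \<ge> 0" using \<eta>(3) \<delta>0(2) g by (simp add: C_def)
  have "nrm (multiplier (sector \<delta> R \<theta>) (\<lambda>k. of_real (tent \<delta> R \<theta> k)) w)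
       \<le> C * (nrm (\<lambda>x. of_real (\<phi> x) * w x) + nrm F1 + nrm F2 + nrm G) + C / R\<^sup>2 * nrm w"
    if R: "1 \<le> R" and L: "L2 w" "L2 F1" "L2 F2" "L2 G"
      and F: "\<And>x. \<phi> x \<noteq> 1 \<Longrightarrow> F1 x = 0 \<and> F2 x = 0" and eq: "helmholtz R w F1 F2 G" for R w F1 F2 G
  proof -
    define t where "t = tent \<delta> R \<theta>"
    define K where "K = sector \<delta> R \<theta>"
    note td = \<delta>(1,2) R \<theta>
    have t: "\<And>k. 0 \<le> t k" "\<And>k. t k \<le> 1" "\<And>k. k \<notin> K \<Longrightarrow> t k = 0"
      unfolding t_def K_def using tent_range[OF td] tent_outside[OF td] by auto
    have K: "finite K" "\<And>k. k \<in> K \<Longrightarrow> norm (fr k) \<le> 2 * R"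
      unfolding K_def using finite_sector[OF td] sector_norm[OF td] by auto
    define c where "c k = of_real (t k) * fc w k" for k
    define h where "h k = of_real (t k) * (\<i> * of_real (fst (fr k)) * fc F1 k + \<i> * of_real (snd (fr k)) * fc F2 k + fc G k)" for k
    have ch: "of_real ((norm (fr k))\<^sup>2 - R\<^sup>2) * c k = h k" for k
    proof -
      have "of_real ((norm (fr k))\<^sup>2 - R\<^sup>2) * c k = of_real (t k) * (of_real ((norm (fr k))\<^sup>2 - R\<^sup>2) * fc w k)"
        unfolding c_def by (rule mult.left_commute)
      then show ?thesis using eq[unfolded helmholtz_def, rule_format, of k] by (simp only: h_def)
    qed
    define v where "v = tp K c"
    have v: "v = multiplier K (\<lambda>k. of_real (t k)) w" by (simp add: v_def c_def[abs_def] multiplier_def)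
    define H where "H = (\<Sum>k\<in>K. (cmod (h k / of_real R))\<^sup>2)"
    define Z where "Z = nrm F1 + nrm F2 + nrm G"
    have kth: "\<bar>fr k \<bullet> \<theta>\<bar> \<le> 2 * R" if "k \<in> K" for k
      using Cauchy_Schwarz_ineq2[of "fr k" \<theta>] \<theta> K(2)[OF that] by simp
    have c1: "nrm v \<le> C0 * avg_form \<theta> v + C0 * nrm (\<lambda>x. \<eta> x * tp K h x)"
      unfolding v_def
      by (rule control[rule_format, of R]) (use R K(1) kth ch in \<open>simp_all only: zero_less_one order_less_le_trans\<close>)
    have c2: "cmod ((LINT x|M. \<psi> x * (v x * cnj (v x))) - (LINT x|M. average \<theta> x * (v x * cnj (v x)))) \<le> \<epsilon> * nrm v + Ct * H"
      unfolding v_def H_def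
    proof (rule tr[rule_format, of \<delta>])
      show "of_real ((norm (fr k))\<^sup>2 - R\<^sup>2) * c k = of_real R * (h k / of_real R)" for k using ch R by simp
      show "norm (fr k - R *\<^sub>R \<theta>) \<le> \<delta> * R" if "k \<in> K" for k using that by (simp add: K_def sector_def)
      show "c k = 0" if "k \<notin> K" for k using t(3)[OF that] by (simp add: c_def)
    qed (use \<delta> K(1) R in simp_all)
    have c3: "(LINT x|M. \<psi> x * (v x * cnj (v x))) = of_real (nrm (\<lambda>x. \<phi>c x * v x))"
    proof -
      have "\<psi> x * (v x * cnj (v x)) = of_real ((cmod (\<phi>c x * v x))\<^sup>2)" for x
        unfolding norm_mult power_mult_distrib of_real_mult complex_norm_square[of "v x"]
        using phi_nonneg by (simp add: \<psi>_def \<phi>c_def)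
      then show ?thesis unfolding nrm_def by (simp only: integral_complex_of_real)
    qed
    have avg: "avg_form \<theta> v \<le> nrm (\<lambda>x. \<phi>c x * v x) + \<epsilon> * nrm v + Ct * H"
    proof -
      have "nrm (\<lambda>x. \<phi>c x * v x) - avg_form \<theta> v = Re ((LINT x|M. \<psi> x * (v x * cnj (v x))) - (LINT x|M. average \<theta> x * (v x * cnj (v x))))"
        unfolding avg_form_def c3 by simp
      then show ?thesis
        using c2 abs_Re_le_cmod[of "(LINT x|M. \<psi> x * (v x * cnj (v x))) - (LINT x|M. average \<theta> x * (v x * cnj (v x)))"]
        by linarith
    qed
    \<comment> \<open>Transport sees the source divided by \<open>R\<close>. On the sector
      frequencies are at most 2 R, so the derivative of F1 and F2 costs only a factor 2, and 12 = 3
      * 2^2.\<close>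
    have Hb: "H \<le> 12 * Z"
    proof -
      have "(cmod (h k / of_real R))\<^sup>2 \<le> 12 * (cmod (fc F1 k))\<^sup>2 + 12 * (cmod (fc F2 k))\<^sup>2 + 12 * (cmod (fc G k))\<^sup>2" if k: "k \<in> K" for k
      proof -
        define x where "x = cmod (fc F1 k)"
        define y where "y = cmod (fc F2 k)"
        define z where "z = cmod (fc G k)"
        have xyz: "x \<ge> 0" "y \<ge> 0" "z \<ge> 0" by (auto simp: x_def y_def z_def)
        have f: "\<bar>fst (fr k)\<bar> \<le> 2 * R" "\<bar>snd (fr k)\<bar> \<le> 2 * R"
          using norm_fst_le[of "fst (fr k)" "snd (fr k)"] norm_snd_le[of "snd (fr k)" "fst (fr k)"] K(2)[OF k] by auto
        have "cmod (h k) = t k * cmod (\<i> * of_real (fst (fr k)) * fc F1 k + \<i> * of_real (snd (fr k)) * fc F2 k + fc G k)"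
          using t(1) by (simp add: h_def norm_mult)
        also have "\<dots> \<le> 1 * cmod (\<i> * of_real (fst (fr k)) * fc F1 k + \<i> * of_real (snd (fr k)) * fc F2 k + fc G k)"
          using t by (intro mult_right_mono) auto
        also have "\<dots> \<le> \<bar>fst (fr k)\<bar> * x + \<bar>snd (fr k)\<bar> * y + z"
          using norm_triangle_ineq[of "\<i> * of_real (fst (fr k)) * fc F1 k + \<i> * of_real (snd (fr k)) * fc F2 k" "fc G k"]
            norm_triangle_ineq[of "\<i> * of_real (fst (fr k)) * fc F1 k" "\<i> * of_real (snd (fr k)) * fc F2 k"]
          by (simp add: norm_mult x_def y_def z_def)
        also have "\<dots> \<le> (2 * R) * x + (2 * R) * y + (2 * R) * z"
          using f xyz R mult_right_mono[of 1 "2 * R" z] by (intro add_mono mult_right_mono) auto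
        also have "\<dots> = R * (2 * (x + y + z))" by (simp add: algebra_simps)
        finally have "cmod (h k / of_real R) \<le> 2 * (x + y + z)"
          using R by (simp add: norm_divide pos_divide_le_eq mult.commute)
        then have "(cmod (h k / of_real R))\<^sup>2 \<le> (2 * (x + y + z))\<^sup>2" by (intro power_mono) auto
        also have "\<dots> \<le> 12 * x\<^sup>2 + 12 * y\<^sup>2 + 12 * z\<^sup>2"
          using zero_le_power2[of "x - y"] zero_le_power2[of "x - z"] zero_le_power2[of "y - z"]
          by (simp add: power2_eq_square algebra_simps)
        finally show ?thesis by (simp add: x_def y_def z_def)
      qed
      then have "H \<le> (\<Sum>k\<in>K. 12 * (cmod (fc F1 k))\<^sup>2 + 12 * (cmod (fc F2 k))\<^sup>2 + 12 * (cmod (fc G k))\<^sup>2)"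
        unfolding H_def by (rule sum_mono)
      also have "\<dots> = 12 * (\<Sum>k\<in>K. (cmod (fc F1 k))\<^sup>2) + 12 * (\<Sum>k\<in>K. (cmod (fc F2 k))\<^sup>2) + 12 * (\<Sum>k\<in>K. (cmod (fc G k))\<^sup>2)"
        by (simp add: sum.distrib sum_distrib_left)
      also have "\<dots> \<le> 12 * Z"
        unfolding Z_def distrib_left by (intro add_mono mult_left_mono bessel[OF _ K(1)] L) simp_all
      finally show ?thesis .
    qed
    \<comment> \<open>Moving the tent past \<phi> costs O(1/R) in norm; this is the origin of the
      term with 1 / R^2.\<close>
    have nphi: "nrm (\<lambda>x. \<phi>c x * v x) \<le> 2 * nrm (\<lambda>x. \<phi>c x * w x) + 2 * (g1 / R\<^sup>2) * nrm w"
    proof -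
      let ?m = "multiplier K (\<lambda>k. of_real (t k))"
      have Lw: "L2 (\<lambda>x. \<phi>c x * w x)"
      proof (rule L2_mult_bounded(1)[OF L(1)])
        show "\<phi>c \<in> borel_measurable borel"
          by (rule borel_measurable_continuous_onI[OF smooth_continuous[OF \<phi>c(1)]])
        show "cmod (\<phi>c x) \<le> 1" for x
          using phi_nonneg[of x] phi_le_1[of x] by (simp add: \<phi>c_def)
      qed
      have Lv: "L2 (\<lambda>x. \<phi>c x * v x)" unfolding v_def by (intro L2_smooth smooth_mult \<phi>c smooth_tp)
      have com: "nrm (\<lambda>x. \<phi>c x * ?m w x - ?m (\<lambda>x. \<phi>c x * w x) x) \<le> (1 / (\<delta> * R) * grad_sum \<phi>c)\<^sup>2 * nrm w"
      proof (rule commutator[OF \<phi>c L(1) K(1)])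
        show "cmod (of_real (t k) - of_real (t l)) \<le> 1 / (\<delta> * R) * norm (fr k - fr l)" for k l
          using tent_lipschitz[OF td, of k l] unfolding t_def by (simp flip: of_real_diff)
      qed (use t \<delta> R in auto)
      have mw: "nrm (?m (\<lambda>x. \<phi>c x * w x)) \<le> 1\<^sup>2 * nrm (\<lambda>x. \<phi>c x * w x)"
        by (rule nrm_multiplier[OF Lw K(1)]) (use t in auto)
      have "nrm (\<lambda>x. (\<phi>c x * v x - ?m (\<lambda>x. \<phi>c x * w x) x) + ?m (\<lambda>x. \<phi>c x * w x) x)
          \<le> 2 * nrm (\<lambda>x. \<phi>c x * v x - ?m (\<lambda>x. \<phi>c x * w x) x) + 2 * nrm (?m (\<lambda>x. \<phi>c x * w x))"
        by (intro nrm_add_le L2_diff Lv L2_multiplier)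
      moreover have "(1 / (\<delta> * R) * grad_sum \<phi>c)\<^sup>2 = g1 / R\<^sup>2"
        unfolding g1_def by (simp add: power_divide power_mult_distrib)
      ultimately show ?thesis using com mw unfolding v by simp
    qed
    \<comment> \<open>Here the source is not divided by \<open>R\<close>. Since \<eta> F1 = \<eta>
      F2 = 0, the products of \<eta> with the differentiated terms equal their commutators, which
      are bounded uniformly in \<open>R\<close>.\<close>
    have neta: "nrm (\<lambda>x. \<eta> x * tp K h x) \<le> (3 * g2 + 3) * Z"
    proof -
      define m1 where "m1 k = \<i> * of_real (fst (fr k) * t k)" for k
      define m2 where "m2 k = \<i> * of_real (snd (fr k) * t k)" for k
      define m3 where "m3 k = complex_of_real (t k)" for k
      have tph: "tp K h x = multiplier K m1 F1 x + multiplier K m2 F2 x + multiplier K m3 G x" for x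
        unfolding multiplier_def tp_def h_def m1_def m2_def m3_def sum.distrib[symmetric]
        by (intro sum.cong refl) (simp add: algebra_simps)
      have \<eta>F: "(\<lambda>x. \<eta> x * F1 x) = (\<lambda>x. 0)" "(\<lambda>x. \<eta> x * F2 x) = (\<lambda>x. 0)"
        by (rule ext, use F \<eta>(5) in \<open>simp only: mult_eq_0_iff\<close>, blast)+
      have m0: "multiplier K m (\<lambda>x. 0) x = 0" for m x by (simp add: multiplier_def tp_def)
      have u: "\<bar>fst (fr k)\<bar> \<le> norm (fr k)" "\<bar>snd (fr k)\<bar> \<le> norm (fr k)" for k
        using norm_fst_le[of "fst (fr k)" "snd (fr k)"] norm_snd_le[of "snd (fr k)" "fst (fr k)"] by auto
      have u': "\<bar>fst (fr k) - fst (fr l)\<bar> \<le> norm (fr k - fr l)" "\<bar>snd (fr k) - snd (fr l)\<bar> \<le> norm (fr k - fr l)" for k l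
        using u[of "k - l"] by (auto simp: fr_diff)
      have "nrm (\<lambda>x. \<eta> x * multiplier K m1 F1 x - multiplier K m1 (\<lambda>x. \<eta> x * F1 x) x) \<le> ((2 / \<delta> + 1) * grad_sum \<eta>)\<^sup>2 * nrm F1"
      proof (rule commutator[OF \<eta>(1,2) L(2) K(1)])
        show "cmod (m1 k - m1 l) \<le> (2 / \<delta> + 1) * norm (fr k - fr l)" for k l
          using tent_times_lipschitz[OF td, of "\<lambda>k. fst (fr k)" k l, OF u(1) u'(1)]
          unfolding m1_def t_def right_diff_distrib[symmetric] of_real_diff[symmetric] norm_mult norm_of_real by simp
      qed (use t \<delta> in \<open>auto simp: m1_def\<close>)
      then have n1: "nrm (\<lambda>x. \<eta> x * multiplier K m1 F1 x) \<le> g2 * nrm F1" by (simp add: \<eta>F m0 g2_def)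
      have "nrm (\<lambda>x. \<eta> x * multiplier K m2 F2 x - multiplier K m2 (\<lambda>x. \<eta> x * F2 x) x) \<le> ((2 / \<delta> + 1) * grad_sum \<eta>)\<^sup>2 * nrm F2"
      proof (rule commutator[OF \<eta>(1,2) L(3) K(1)])
        show "cmod (m2 k - m2 l) \<le> (2 / \<delta> + 1) * norm (fr k - fr l)" for k l
          using tent_times_lipschitz[OF td, of "\<lambda>k. snd (fr k)" k l, OF u(2) u'(2)]
          unfolding m2_def t_def right_diff_distrib[symmetric] of_real_diff[symmetric] norm_mult norm_of_real by simp
      qed (use t \<delta> in \<open>auto simp: m2_def\<close>)
      then have n2: "nrm (\<lambda>x. \<eta> x * multiplier K m2 F2 x) \<le> g2 * nrm F2" by (simp add: \<eta>F m0 g2_def)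
      have "nrm (\<lambda>x. \<eta> x * multiplier K m3 G x) \<le> 1\<^sup>2 * nrm (multiplier K m3 G)"
        using borel_measurable_continuous_onI[OF smooth_continuous[OF \<eta>(1)]] \<eta>(4)
        by (intro L2_mult_bounded(2) L2_multiplier) auto
      also have "nrm (multiplier K m3 G) \<le> 1\<^sup>2 * nrm G"
        by (rule nrm_multiplier[OF L(4) K(1)]) (use t in \<open>auto simp: m3_def\<close>)
      finally have n3: "nrm (\<lambda>x. \<eta> x * multiplier K m3 G x) \<le> nrm G" by simp
      have sq3: "(cmod (x + y + z))\<^sup>2 \<le> 3 * (cmod x)\<^sup>2 + 3 * (cmod y)\<^sup>2 + 3 * (cmod z)\<^sup>2" for x y z
      proof -
        have "cmod (x + y + z) \<le> cmod x + cmod y + cmod z"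
          using norm_triangle_ineq[of "x + y" z] norm_triangle_ineq[of x y] by linarith
        then have "(cmod (x + y + z))\<^sup>2 \<le> (cmod x + cmod y + cmod z)\<^sup>2" by (intro power_mono) auto
        also have "\<dots> \<le> 3 * (cmod x)\<^sup>2 + 3 * (cmod y)\<^sup>2 + 3 * (cmod z)\<^sup>2"
          using zero_le_power2[of "cmod x - cmod y"] zero_le_power2[of "cmod x - cmod z"] zero_le_power2[of "cmod y - cmod z"]
          by (simp add: power2_eq_square algebra_simps)
        finally show ?thesis .
      qed
      have Lm: "L2 (\<lambda>x. \<eta> x * multiplier K m f x)" for m f
        unfolding multiplier_def by (intro L2_smooth smooth_mult \<eta> smooth_tp)
      note im = L2_integrable[OF Lm]
      have "nrm (\<lambda>x. \<eta> x * tp K h x) \<le> (LINT x|M. 3 * (cmod (\<eta> x * multiplier K m1 F1 x))\<^sup>2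
          + 3 * (cmod (\<eta> x * multiplier K m2 F2 x))\<^sup>2 + 3 * (cmod (\<eta> x * multiplier K m3 G x))\<^sup>2)"
      proof (rule L2_mono(2))
        show "(\<lambda>x. \<eta> x * tp K h x) \<in> borel_measurable borel"
          by (intro L2_measurable L2_smooth smooth_mult \<eta> smooth_tp)
        show "(cmod (\<eta> x * tp K h x))\<^sup>2 \<le> 3 * (cmod (\<eta> x * multiplier K m1 F1 x))\<^sup>2
          + 3 * (cmod (\<eta> x * multiplier K m2 F2 x))\<^sup>2 + 3 * (cmod (\<eta> x * multiplier K m3 G x))\<^sup>2" for x
          unfolding tph distrib_left by (rule sq3)
      qed (use im in simp)
      also have "\<dots> = 3 * nrm (\<lambda>x. \<eta> x * multiplier K m1 F1 x) + 3 * nrm (\<lambda>x. \<eta> x * multiplier K m2 F2 x) + 3 * nrm (\<lambda>x. \<eta> x * multiplier K m3 G x)"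
        unfolding nrm_def using im by simp
      also have "\<dots> \<le> 3 * (g2 * nrm F1) + 3 * (g2 * nrm F2) + 3 * nrm G" using n1 n2 n3 by linarith
      also have "\<dots> \<le> (3 * g2 + 3) * Z"
        using g(2) mult_nonneg_nonneg[OF g(2) nrm_nonneg[of G]] by (simp add: Z_def algebra_simps)
      finally show ?thesis .
    qed
    define Y where "Y = nrm (\<lambda>x. \<phi>c x * w x)"
    have YZ: "Y \<ge> 0" "Z \<ge> 0" by (auto simp: Y_def Z_def)
    have "nrm v \<le> C0 * (nrm (\<lambda>x. \<phi>c x * v x) + \<epsilon> * nrm v + Ct * H) + C0 * ((3 * g2 + 3) * Z)"
      using c1 mult_left_mono[OF avg \<eta>(3)] mult_left_mono[OF neta \<eta>(3)] by linarith
    also have "\<dots> \<le> C0 * ((2 * Y + 2 * (g1 / R\<^sup>2) * nrm w) + \<epsilon> * nrm v + Ct * (12 * Z)) + C0 * ((3 * g2 + 3) * Z)"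
      using nphi Hb \<eta>(3) \<delta>0(2) unfolding Y_def by (intro add_mono mult_left_mono order_refl) auto
    also have "\<dots> = (C0 * \<epsilon>) * nrm v + (C0 * (2 * Y + 12 * Ct * Z) + C0 * (3 * g2 + 3) * Z + 2 * C0 * g1 / R\<^sup>2 * nrm w)"
      by (simp add: algebra_simps)
    also have "(C0 * \<epsilon>) * nrm v \<le> (1 / 2) * nrm v" by (intro mult_right_mono \<epsilon>) simp
    finally have "nrm v \<le> 2 * (C0 * (2 * Y + 12 * Ct * Z) + C0 * (3 * g2 + 3) * Z) + 4 * C0 * g1 / R\<^sup>2 * nrm w"
      by simp
    also have "\<dots> \<le> C * (Y + Z) + C / R\<^sup>2 * nrm w"
    proof (rule add_mono)
      have "C * (Y + Z) - 2 * (C0 * (2 * Y + 12 * Ct * Z) + C0 * (3 * g2 + 3) * Z) =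
          2 * C0 * ((2 * g1 + 12 * Ct) * Y + (2 + 2 * g1) * Z + (3 * g2 + 3) * Y)"
        by (simp add: C_def algebra_simps)
      also have "\<dots> \<ge> 0" using \<eta>(3) g \<delta>0(2) YZ by (intro mult_nonneg_nonneg add_nonneg_nonneg) auto
      finally show "2 * (C0 * (2 * Y + 12 * Ct * Z) + C0 * (3 * g2 + 3) * Z) \<le> C * (Y + Z)" by simp
      have "0 \<le> C0 * Ct" "0 \<le> C0 * g2" using \<eta>(3) g \<delta>0(2) by auto
      then have "4 * C0 * g1 \<le> C" using \<eta>(3) unfolding C_def by (simp add: algebra_simps)
      then show "4 * C0 * g1 / R\<^sup>2 * nrm w \<le> C / R\<^sup>2 * nrm w"
        by (intro mult_right_mono divide_right_mono) auto
    qed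
    finally show ?thesis
      unfolding v K_def t_def Y_def Z_def \<phi>c_def by (simp add: add.assoc)
  qed
  note main = this
  show ?thesis
    by (intro exI[of _ \<delta>] exI[of _ C] conjI \<delta> C allI impI, rule main) blast+
qed

text \<open>Near the circle every frequency is seen by one of finitely many tents; away from it the
  symbol dominates a full derivative, so the source bounds the coefficient. The terms with 1 / R^2
  are absorbed once \<open>R\<close> is large.\<close>

theorem high_frequency:
  "\<exists>R0 C. 1 \<le> R0 \<and> 0 \<le> C \<and> (\<forall>R w F1 F2 G. R0 \<le> R \<longrightarrow> L2 w \<longrightarrow> L2 F1 \<longrightarrow> L2 F2 \<longrightarrow> L2 G \<longrightarrow>
     (\<forall>x. \<phi> x \<noteq> 1 \<longrightarrow> F1 x = 0 \<and> F2 x = 0) \<longrightarrow> helmholtz R w F1 F2 G \<longrightarrow>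
     nrm w \<le> C * (nrm (\<lambda>x. of_real (\<phi> x) * w x) + nrm F1 + nrm F2 + nrm G))"
proof -
  define good where "good \<theta> \<delta> C \<longleftrightarrow> 0 < \<delta> \<and> \<delta> \<le> 1 \<and> 0 \<le> C \<and> (\<forall>R w F1 F2 G. 1 \<le> R \<longrightarrow> L2 w \<longrightarrow> L2 F1 \<longrightarrow> L2 F2 \<longrightarrow> L2 G \<longrightarrow>
     (\<forall>x. \<phi> x \<noteq> 1 \<longrightarrow> F1 x = 0 \<and> F2 x = 0) \<longrightarrow> helmholtz R w F1 F2 G \<longrightarrow>
     nrm (multiplier (sector \<delta> R \<theta>) (\<lambda>k. of_real (tent \<delta> R \<theta> k)) w)
       \<le> C * (nrm (\<lambda>x. of_real (\<phi> x) * w x) + nrm F1 + nrm F2 + nrm G) + C / R\<^sup>2 * nrm w)" for \<theta> \<delta> C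
  have "\<forall>\<theta>\<in>sphere 0 1. \<exists>\<delta> C. good \<theta> \<delta> C"
    unfolding good_def using directional_estimate by simp
  then obtain d cc where g: "\<And>\<theta>. \<theta> \<in> sphere 0 1 \<Longrightarrow> good \<theta> (d \<theta>) (cc \<theta>)" by metis
  have d: "0 < d \<theta>" "d \<theta> \<le> 1" "0 \<le> cc \<theta>" if "\<theta> \<in> sphere 0 1" for \<theta>
    using g[OF that] by (auto simp: good_def)
  \<comment> \<open>A quarter of the width is reserved for the angle and, through \<rho>, another
    quarter for the radius. Every frequency close to the circle then lies within half the width of
    some tent, where that tent is at least 1/2.\<close>
  obtain \<Theta> where \<Theta>: "\<Theta> \<subseteq> sphere 0 1" "finite \<Theta>" "sphere 0 1 \<subseteq> (\<Union>\<theta>\<in>\<Theta>. ball \<theta> (d \<theta> / 4))"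
  proof (rule compactE_image[OF compact_sphere, of "sphere 0 1" "\<lambda>\<theta>. ball \<theta> (d \<theta> / 4)" "0 :: real \<times> real" 1])
    show "sphere 0 1 \<subseteq> (\<Union>\<theta>\<in>sphere 0 1. ball \<theta> (d \<theta> / 4))"
    proof
      fix \<theta> :: "real \<times> real" assume \<theta>: "\<theta> \<in> sphere 0 1"
      then have "\<theta> \<in> ball \<theta> (d \<theta> / 4)" using d(1)[OF \<theta>] by simp
      then show "\<theta> \<in> (\<Union>\<theta>\<in>sphere 0 1. ball \<theta> (d \<theta> / 4))" using \<theta> by blast
    qed
  qed auto
  have "(1, 0) \<in> sphere (0 :: real \<times> real) 1" by (simp add: norm_prod_def)
  then have ne: "\<Theta> \<noteq> {}" using \<Theta>(3) by blast
  define \<rho> where "\<rho> = Min (d ` \<Theta>) / 4"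
  have "Min (d ` \<Theta>) > 0" using \<Theta> ne d by (subst Min_gr_iff) auto
  then have \<rho>: "\<rho> > 0" by (simp add: \<rho>_def)
  have \<rho>d: "\<rho> \<le> d \<theta> / 4" if "\<theta> \<in> \<Theta>" for \<theta>
    unfolding \<rho>_def using \<Theta>(2) that by (intro divide_right_mono Min_le) auto
  have \<rho>1: "\<rho> \<le> 1 / 4"
  proof -
    obtain \<theta> where "\<theta> \<in> \<Theta>" using ne by blast
    then show ?thesis using \<rho>d[of \<theta>] d(2)[of \<theta>] \<Theta>(1) by auto
  qed
  define Cm where "Cm = (\<Sum>\<theta>\<in>\<Theta>. cc \<theta>)"
  have Cm: "Cm \<ge> 0" unfolding Cm_def using d(3) \<Theta>(1) by (intro sum_nonneg) auto
  define C where "C = 2 * (4 * Cm + 3 / \<rho>\<^sup>2)"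
  \<comment> \<open>The threshold on \<open>R\<close> gives Cm / R^2 \<le> 1/8. After the factor 4
    from the tents, the terms with \<open>nrm w\<close> on the right amount to at most half of
    it.\<close>
  have "nrm w \<le> C * (nrm (\<lambda>x. of_real (\<phi> x) * w x) + nrm F1 + nrm F2 + nrm G)"
    if R0: "8 * Cm + 1 \<le> R" and L: "L2 w" "L2 F1" "L2 F2" "L2 G"
      and F: "\<forall>x. \<phi> x \<noteq> 1 \<longrightarrow> F1 x = 0 \<and> F2 x = 0" and eq: "helmholtz R w F1 F2 G" for R w F1 F2 G
  proof -
    have R: "1 \<le> R" using R0 Cm by linarith
    define V where "V \<theta> = multiplier (sector (d \<theta>) R \<theta>) (\<lambda>k. of_real (tent (d \<theta>) R \<theta> k)) w" for \<theta>
    define Z where "Z = nrm (\<lambda>x. of_real (\<phi> x) * w x) + nrm F1 + nrm F2 + nrm G"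
    have V: "nrm (V \<theta>) \<le> cc \<theta> * Z + cc \<theta> / R\<^sup>2 * nrm w" if "\<theta> \<in> \<Theta>" for \<theta>
    proof -
      have "good \<theta> (d \<theta>) (cc \<theta>)" using g \<Theta>(1) that by blast
      then show ?thesis unfolding good_def V_def Z_def using R L F eq by blast
    qed
    have fV: "fc (V \<theta>) k = of_real (tent (d \<theta>) R \<theta> k) * fc w k" if "\<theta> \<in> \<Theta>" for \<theta> k
    proof -
      have th: "\<theta> \<in> sphere 0 1" using that \<Theta>(1) by blast
      then have td: "0 < d \<theta>" "d \<theta> \<le> 1" "1 \<le> R" "norm \<theta> = 1" using d R by auto
      show ?thesis unfolding V_def
        by (rule fc_multiplier[OF finite_sector[OF td]]) (simp add: tent_outside[OF td])
    qed
    \<comment> \<open>The first sum covers frequencies near the circle, with 4 the inverse square of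
      the tent's value 1/2. The rest is division by a symbol of size at least \<rho> (n + 1), where
      n is the length of the frequency.\<close>
    have pt: "(cmod (fc w k))\<^sup>2 \<le> 4 * (\<Sum>\<theta>\<in>\<Theta>. (cmod (fc (V \<theta>) k))\<^sup>2) +
        3 / \<rho>\<^sup>2 * ((cmod (fc F1 k))\<^sup>2 + (cmod (fc F2 k))\<^sup>2 + (cmod (fc G k))\<^sup>2)" for k
    proof (cases "\<bar>norm (fr k) - R\<bar> < \<rho> * R")
      case True
      have "\<rho> * R \<le> 1 / 4 * R" using \<rho>1 R by (intro mult_right_mono) auto
      then have pos: "norm (fr k) > 0" using True R by linarith
      define \<theta>0 where "\<theta>0 = (1 / norm (fr k)) *\<^sub>R fr k"
      have "\<theta>0 \<in> sphere 0 1" using pos by (simp add: \<theta>0_def)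
      then obtain \<theta> where \<theta>: "\<theta> \<in> \<Theta>" "dist \<theta> \<theta>0 < d \<theta> / 4" using \<Theta>(3) by auto
      have th: "\<theta> \<in> sphere 0 1" using \<theta> \<Theta>(1) by blast
      have "fr k - R *\<^sub>R \<theta> = (norm (fr k) - R) *\<^sub>R \<theta>0 + R *\<^sub>R (\<theta>0 - \<theta>)"
      proof -
        have "(norm (fr k) - R) *\<^sub>R \<theta>0 + R *\<^sub>R (\<theta>0 - \<theta>) = norm (fr k) *\<^sub>R \<theta>0 - R *\<^sub>R \<theta>"
          by (simp add: algebra_simps)
        also have "norm (fr k) *\<^sub>R \<theta>0 = fr k" using pos by (simp add: \<theta>0_def)
        finally show ?thesis by simp
      qed
      then have "norm (fr k - R *\<^sub>R \<theta>) \<le> norm ((norm (fr k) - R) *\<^sub>R \<theta>0) + norm (R *\<^sub>R (\<theta>0 - \<theta>))"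
        by (simp only: norm_triangle_ineq)
      also have "norm ((norm (fr k) - R) *\<^sub>R \<theta>0) = \<bar>norm (fr k) - R\<bar>" using \<open>\<theta>0 \<in> sphere 0 1\<close> by simp
      also have "norm (R *\<^sub>R (\<theta>0 - \<theta>)) \<le> R * (d \<theta> / 4)"
        using \<theta>(2) R by (simp add: dist_norm norm_minus_commute)
      also have "\<bar>norm (fr k) - R\<bar> \<le> (d \<theta> / 4) * R"
        using True mult_right_mono[OF \<rho>d[OF \<theta>(1)], of R] R by linarith
      finally have "norm (fr k - R *\<^sub>R \<theta>) \<le> (d \<theta> * R) / 2" by (simp add: mult.commute)
      then have "norm (fr k - R *\<^sub>R \<theta>) / (d \<theta> * R) \<le> 1 / 2" using d[OF th] R by (simp add: field_simps)
      then have "1 / 2 \<le> tent (d \<theta>) R \<theta> k" by (simp only: tent_def le_max_iff_disj) linarith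
      then have "(1 / 2)\<^sup>2 \<le> (tent (d \<theta>) R \<theta> k)\<^sup>2" by (intro power_mono) auto
      then have "1 * (cmod (fc w k))\<^sup>2 \<le> (4 * (tent (d \<theta>) R \<theta> k)\<^sup>2) * (cmod (fc w k))\<^sup>2"
        by (intro mult_right_mono) (auto simp: power2_eq_square)
      also have "\<dots> = 4 * (cmod (fc (V \<theta>) k))\<^sup>2" by (simp add: fV[OF \<theta>(1)] norm_mult power_mult_distrib)
      also have "\<dots> \<le> 4 * (\<Sum>\<theta>\<in>\<Theta>. (cmod (fc (V \<theta>) k))\<^sup>2)"
        using member_le_sum[OF \<theta>(1), of "\<lambda>\<theta>. (cmod (fc (V \<theta>) k))\<^sup>2"] \<Theta>(2) by simp
      finally show ?thesis by (simp add: add_increasing2)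
    next
      case False
      define x where "x = cmod (fc F1 k)"
      define y where "y = cmod (fc F2 k)"
      define z where "z = cmod (fc G k)"
      define n where "n = norm (fr k)"
      have xyz: "x \<ge> 0" "y \<ge> 0" "z \<ge> 0" "n \<ge> 0" by (auto simp: x_def y_def z_def n_def)
      have "\<bar>n\<^sup>2 - R\<^sup>2\<bar> = \<bar>n - R\<bar> * (n + R)"
      proof -
        have "n\<^sup>2 - R\<^sup>2 = (n - R) * (n + R)" by (simp add: power2_eq_square algebra_simps)
        then show ?thesis using xyz R by (simp add: abs_mult)
      qed
      also have "\<dots> \<ge> \<rho> * (n + 1)"
      proof -
        have "\<rho> * 1 \<le> \<rho> * R" using \<rho> R by (intro mult_left_mono) auto
        then have "\<rho> \<le> \<bar>n - R\<bar>" using False by (simp add: n_def)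
        then show ?thesis using \<rho> R xyz by (intro mult_mono) auto
      qed
      finally have low: "\<rho> * (n + 1) \<le> \<bar>n\<^sup>2 - R\<^sup>2\<bar>" .
      have f: "\<bar>fst (fr k)\<bar> \<le> n" "\<bar>snd (fr k)\<bar> \<le> n"
        using norm_fst_le[of "fst (fr k)" "snd (fr k)"] norm_snd_le[of "snd (fr k)" "fst (fr k)"] by (auto simp: n_def)
      have "\<rho> * (n + 1) * cmod (fc w k) \<le> \<bar>n\<^sup>2 - R\<^sup>2\<bar> * cmod (fc w k)" by (intro mult_right_mono low) simp
      also have "\<dots> = cmod (of_real ((norm (fr k))\<^sup>2 - R\<^sup>2) * fc w k)" unfolding norm_mult norm_of_real n_def ..
      also have "\<dots> = cmod (\<i> * of_real (fst (fr k)) * fc F1 k + \<i> * of_real (snd (fr k)) * fc F2 k + fc G k)"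
        using eq unfolding helmholtz_def by metis
      also have "\<dots> \<le> \<bar>fst (fr k)\<bar> * x + \<bar>snd (fr k)\<bar> * y + z"
        using norm_triangle_ineq[of "\<i> * of_real (fst (fr k)) * fc F1 k + \<i> * of_real (snd (fr k)) * fc F2 k" "fc G k"]
          norm_triangle_ineq[of "\<i> * of_real (fst (fr k)) * fc F1 k" "\<i> * of_real (snd (fr k)) * fc F2 k"]
        by (simp add: norm_mult x_def y_def z_def)
      also have "\<dots> \<le> (n + 1) * x + (n + 1) * y + (n + 1) * z"
        using f xyz mult_right_mono[of 1 "n + 1" z] by (intro add_mono mult_right_mono) auto
      finally have "(n + 1) * (\<rho> * cmod (fc w k)) \<le> (n + 1) * (x + y + z)" by (simp add: algebra_simps)
      then have "\<rho> * cmod (fc w k) \<le> x + y + z" using xyz by (subst (asm) mult_le_cancel_left_pos) auto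
      then have "(\<rho> * cmod (fc w k))\<^sup>2 \<le> (x + y + z)\<^sup>2" using \<rho> by (intro power_mono) auto
      also have "\<dots> \<le> 3 * (x\<^sup>2 + y\<^sup>2 + z\<^sup>2)"
        using zero_le_power2[of "x - y"] zero_le_power2[of "x - z"] zero_le_power2[of "y - z"]
        by (simp add: power2_eq_square algebra_simps)
      finally have "(cmod (fc w k))\<^sup>2 \<le> 3 / \<rho>\<^sup>2 * (x\<^sup>2 + y\<^sup>2 + z\<^sup>2)"
        using \<rho> by (simp add: power_mult_distrib field_simps)
      moreover have "0 \<le> 4 * (\<Sum>\<theta>\<in>\<Theta>. (cmod (fc (V \<theta>) k))\<^sup>2)" by (intro mult_nonneg_nonneg sum_nonneg) auto
      ultimately show ?thesis by (simp add: x_def y_def z_def)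
    qed
    have "nrm w \<le> 4 * (\<Sum>\<theta>\<in>\<Theta>. nrm (V \<theta>)) + 3 / \<rho>\<^sup>2 * (nrm F1 + nrm F2 + nrm G)"
      by (rule has_sum_mono[OF parseval[OF L(1)] _ pt])
        (intro has_sum_add has_sum_cmult_right has_sum_sum_finite \<Theta> parseval L, simp add: V_def L2_multiplier)
    also have "(\<Sum>\<theta>\<in>\<Theta>. nrm (V \<theta>)) \<le> (\<Sum>\<theta>\<in>\<Theta>. cc \<theta> * Z + cc \<theta> / R\<^sup>2 * nrm w)" by (intro sum_mono V)
    also have "\<dots> = Cm * Z + Cm / R\<^sup>2 * nrm w"
      by (simp add: Cm_def sum.distrib sum_distrib_right sum_divide_distrib)
    also have "Cm / R\<^sup>2 * nrm w \<le> 1 / 8 * nrm w"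
    proof (rule mult_right_mono)
      have "8 * Cm \<le> R * 1" using R0 by simp
      also have "\<dots> \<le> R * R" using R by (intro mult_left_mono) auto
      finally show "Cm / R\<^sup>2 \<le> 1 / 8" using R by (simp add: field_simps power2_eq_square)
    qed simp
    also have "3 / \<rho>\<^sup>2 * (nrm F1 + nrm F2 + nrm G) \<le> 3 / \<rho>\<^sup>2 * Z"
      by (intro mult_left_mono) (auto simp: Z_def)
    finally have main: "nrm w \<le> 4 * (Cm * Z + 1 / 8 * nrm w) + 3 / \<rho>\<^sup>2 * Z" by simp
    have lin: "n \<le> 2 * (4 * p + q)" if "n \<le> 4 * (p + 1 / 8 * n) + q" for n p q :: real
      using that by argo
    have CZ: "C * Z = 2 * (4 * (Cm * Z) + 3 / \<rho>\<^sup>2 * Z)" by (simp add: C_def algebra_simps)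
    have "nrm w \<le> C * Z" unfolding CZ by (rule lin[OF main])
    then show ?thesis by (simp add: Z_def)
  qed
  note main = this
  have C01: "1 \<le> 8 * Cm + 1" "0 \<le> C" using Cm by (auto simp: C_def)
  show ?thesis
    by (intro exI[of _ "8 * Cm + 1"] exI[of _ C] conjI allI impI C01, rule main) assumption+
qed

end

context torus begin

subsection \<open>Low frequencies\<close>

lemma D_tp: "D v (tp K c) x = tp K (\<lambda>k. \<i> * of_real (fr k \<bullet> v) * c k) x"
proof -
  have "(tp K c has_derivative (\<lambda>v. \<Sum>k\<in>K. c k * (\<i> * of_real (fr k \<bullet> v) * e k x))) (at x)"
    unfolding tp_def[abs_def]
    by (intro has_derivative_sum has_derivative_mult_right e_has_derivative)
  then have "D v (tp K c) x = (\<Sum>k\<in>K. c k * (\<i> * of_real (fr k \<bullet> v) * e k x))" by (rule D_eqI)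
  then show ?thesis by (simp add: tp_def mult_ac)
qed

text \<open>Induction on the number of frequencies. Differentiating along a vector and subtracting
  the eigenvalue of \<open>e k0\<close> removes the mode \<open>k0\<close> and keeps the function 0
  on \<open>U\<close>.\<close>

lemma tp_zero_on_open:
  assumes "finite K" "open U" "U \<noteq> {}" "\<And>x. x \<in> U \<Longrightarrow> tp K c x = 0" "k \<in> K"
  shows "c k = 0"
  using assms(1,4,5)
proof (induction K arbitrary: c k rule: finite_induct)
  case (insert k0 K)
  have c0: "c k = 0" if k: "k \<in> K" for k
  proof -
    \<comment> \<open>In this direction the coefficient of \<open>k\<close> is multiplied by i times
      the squared length of \<open>fr (k - k0)\<close>, so it is not lost.\<close>
    let ?v = "fr (k - k0)"
    have "tp K (\<lambda>k. of_real (fr (k - k0) \<bullet> ?v) * c k) x = 0" if x: "x \<in> U" for x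
    proof -
      have "\<i> * tp K (\<lambda>k. of_real (fr (k - k0) \<bullet> ?v) * c k) x =
          tp (insert k0 K) (\<lambda>k. \<i> * of_real (fr k \<bullet> ?v) * c k) x - \<i> * of_real (fr k0 \<bullet> ?v) * tp (insert k0 K) c x"
      proof -
        have "tp (insert k0 K) (\<lambda>k. \<i> * of_real (fr k \<bullet> v) * c k) x - \<i> * of_real (fr k0 \<bullet> v) * tp (insert k0 K) c x =
            (\<Sum>k\<in>insert k0 K. \<i> * (of_real (fr (k - k0) \<bullet> v) * c k * e k x))" for v
          unfolding tp_def sum_distrib_left sum_subtractf[symmetric]
          by (intro sum.cong refl) (simp add: fr_diff inner_diff_left algebra_simps)
        also have "(\<Sum>k\<in>insert k0 K. \<i> * (of_real (fr (k - k0) \<bullet> v) * c k * e k x)) =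
            \<i> * tp K (\<lambda>k. of_real (fr (k - k0) \<bullet> v) * c k) x" for v
          using insert.hyps by (simp add: tp_def sum_distrib_left)
        finally show ?thesis by (rule sym)
      qed
      also have "tp (insert k0 K) (\<lambda>k. \<i> * of_real (fr k \<bullet> ?v) * c k) x = D ?v (tp (insert k0 K) c) x"
        by (rule D_tp[symmetric])
      also have "\<dots> = 0" by (rule D_zero_open[OF assms(2) x, where c=0]) (rule insert.prems(1))
      finally show ?thesis using insert.prems(1)[OF x] by simp
    qed
    from insert.IH[OF this k] have "of_real (?v \<bullet> ?v) * c k = 0" .
    moreover have "k - k0 \<noteq> 0" using k insert.hyps by auto
    ultimately show ?thesis using fr_eq_0_iff[of "k - k0"] by simp
  qed
  obtain x where x: "x \<in> U" using assms(3) by blast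
  have "tp (insert k0 K) c x = c k0 * e k0 x"
    using insert.hyps c0 by (simp add: tp_def)
  moreover have "e k0 x \<noteq> 0" using norm_e[of k0 x] by (metis norm_zero zero_neq_one)
  ultimately have ck0: "c k0 = 0" using insert.prems(1)[OF x] by simp
  show ?case
  proof (cases "k = k0")
    case False
    then show ?thesis using insert.prems(2) by (intro c0) simp
  qed (simp add: ck0)
qed simp

text \<open>Both sides are quadratic forms in finitely many coefficients. The right one is positive
  definite, because a trigonometric polynomial that vanishes on an open set is 0; its minimum over
  the compact unit sphere gives the constant.\<close>

lemma trig_lower_bound:
  fixes \<sigma> :: "real \<times> real \<Rightarrow> real"
  assumes K: "finite K" and \<sigma>: "continuous_on UNIV \<sigma>" "periodic \<sigma>" "\<And>x. 0 \<le> \<sigma> x" "\<exists>x. \<sigma> x > 0"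
  shows "\<exists>C\<ge>0. \<forall>c. (\<Sum>k\<in>K. (cmod (c k))\<^sup>2) \<le> C * (LINT x|M. \<sigma> x * (cmod (tp K c x))\<^sup>2)"
proof (cases "K = {}")
  case True then show ?thesis by auto
next
  case False
  \<comment> \<open>Coefficient families are functions on the whole lattice. Prescribing 0 off
    \<open>K\<close> and the closed unit disc on \<open>K\<close> gives a compact product that
    contains the unit sphere.\<close>
  define S where "S k = (if k \<in> K then cball 0 1 else {0 :: complex})" for k
  define X where "X = PiE UNIV S"
  have "compact (S k)" for k by (simp add: S_def)
  then have "compactin (product_topology (\<lambda>_. euclidean) UNIV) X"
    unfolding X_def compactin_PiE by (simp add: compactin_euclidean_iff)
  then have cX: "compact X" by (simp add: euclidean_product_topology)
  define N where "N c = (\<Sum>k\<in>K. (cmod (c k))\<^sup>2)" for c :: "int \<times> int \<Rightarrow> complex"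
  define Q where "Q c = (LINT x|M. \<sigma> x * (cmod (tp K c x))\<^sup>2)" for c
  have coord: "continuous_on A (\<lambda>c :: int \<times> int \<Rightarrow> complex. c k)" for A k
    by (rule continuous_on_subset[OF continuous_on_product_coordinates]) simp
  have cN: "continuous_on UNIV N" unfolding N_def[abs_def] by (intro continuous_intros coord)
  have Q: "Q c = Re (\<Sum>k\<in>K. \<Sum>l\<in>K. (c k * cnj (c l)) * fc (\<lambda>x. of_real (\<sigma> x)) (l - k))" for c
  proof -
    have L: "L2 (\<lambda>x. complex_of_real (\<sigma> x))" by (intro L2_continuous continuous_intros \<sigma>)
    have "complex_of_real (Q c) = (LINT x|M. of_real (\<sigma> x) * (tp K c x * cnj (tp K c x)))"
      unfolding Q_def integral_complex_of_real[symmetric] by (simp only: of_real_mult complex_norm_square)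
    then show ?thesis unfolding integral_tp_square[OF L] by (metis Re_complex_of_real)
  qed
  have cQ: "continuous_on A Q" for A
  proof -
    have "continuous_on A (\<lambda>c. Re (\<Sum>k\<in>K. \<Sum>l\<in>K. (c k * cnj (c l)) * fc (\<lambda>x. of_real (\<sigma> x)) (l - k)))"
      by (intro continuous_intros coord)
    then show ?thesis by (simp only: Q[symmetric])
  qed
  have Qpos: "Q c > 0" if "k \<in> K" "c k \<noteq> 0" for c k
  proof (rule ccontr)
    assume "\<not> Q c > 0"
    moreover have "Q c \<ge> 0" unfolding Q_def using \<sigma>(3) by (intro Bochner_Integration.integral_nonneg) simp
    ultimately have "Q c = 0" by simp
    then have z: "\<sigma> x * (cmod (tp K c x))\<^sup>2 = 0" for x
    proof -
      have c: "continuous_on UNIV (\<lambda>x. \<sigma> x * (cmod (tp K c x))\<^sup>2)"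
        by (intro continuous_intros \<sigma>(1) smooth_continuous[OF smooth_tp])
      have "periodic (\<lambda>x. (cmod (tp K c x))\<^sup>2)"
        by (rule periodic_comp[OF periodic_tp, of "\<lambda>z. (cmod z)\<^sup>2"])
      from periodic_mult[OF \<sigma>(2) this]
      have p: "periodic (\<lambda>x. \<sigma> x * (cmod (tp K c x))\<^sup>2)" .
      show ?thesis
        by (rule integral_zero_imp_zero[OF c p, of x]) (use \<open>Q c = 0\<close> \<sigma>(3) in \<open>simp_all add: Q_def\<close>)
    qed
    have "open {x. 0 < \<sigma> x}" by (intro open_Collect_less continuous_on_const \<sigma>)
    moreover have "{x. 0 < \<sigma> x} \<noteq> {}" using \<sigma>(4) by auto
    moreover have "tp K c x = 0" if "x \<in> {x. 0 < \<sigma> x}" for x using z[of x] that by simp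
    ultimately have "c k = 0" by (rule tp_zero_on_open[OF K _ _ _ that(1)])
    then show False using that by simp
  qed
  define Y where "Y = X \<inter> {c. N c = 1}"
  have "closed {c. N c = 1}" by (intro closed_Collect_eq cN continuous_on_const)
  then have cY: "compact Y" unfolding Y_def by (rule compact_Int_closed[OF cX])
  obtain k0 where k0: "k0 \<in> K" using False by blast
  have "N (\<lambda>k. if k = k0 then 1 else 0) = (\<Sum>k\<in>K. if k = k0 then 1 else 0)"
    unfolding N_def by (intro sum.cong) auto
  then have "(\<lambda>k. if k = k0 then 1 else 0) \<in> Y"
    unfolding Y_def X_def S_def using k0 K by (auto simp: sum.delta)
  then have "Y \<noteq> {}" by blast
  then obtain m where m: "m \<in> Y" "\<And>c. c \<in> Y \<Longrightarrow> Q m \<le> Q c"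
    using continuous_attains_inf[OF cY _ cQ] by blast
  have "\<exists>k\<in>K. m k \<noteq> 0"
  proof (rule ccontr)
    assume "\<not> (\<exists>k\<in>K. m k \<noteq> 0)"
    then have "N m = 0" unfolding N_def by simp
    then show False using m(1) by (simp add: Y_def)
  qed
  then have Qm: "Q m > 0" using Qpos by blast
  have "N c \<le> (1 / Q m) * Q c" for c
  proof (cases "N c = 0")
    case True
    have "Q c \<ge> 0" unfolding Q_def using \<sigma>(3) by (intro Bochner_Integration.integral_nonneg) simp
    then show ?thesis using True Qm by simp
  next
    case nz: False
    have N0: "N c > 0" using nz unfolding N_def by (simp add: order_less_le sum_nonneg)
    define s where "s = sqrt (N c)"
    have s: "s > 0" "s\<^sup>2 = N c" using N0 by (auto simp: s_def)
    define d where "d k = (if k \<in> K then c k / of_real s else 0)" for k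
    have nd: "(cmod (d k))\<^sup>2 = (cmod (c k))\<^sup>2 / N c" if "k \<in> K" for k
      using that s by (simp add: d_def norm_divide power_divide)
    have Nd: "N d = 1"
    proof -
      have "N d = (\<Sum>k\<in>K. (cmod (c k))\<^sup>2 / N c)" unfolding N_def[of d] by (intro sum.cong refl nd)
      also have "\<dots> = N c / N c" by (simp only: N_def sum_divide_distrib)
      finally show ?thesis using N0 by simp
    qed
    have "cmod (d k) \<le> 1" if "k \<in> K" for k
    proof -
      have "(cmod (d k))\<^sup>2 \<le> N d" unfolding N_def by (rule member_le_sum[OF that _ K]) simp
      then show ?thesis using Nd power2_le_imp_le[of "cmod (d k)" 1] by simp
    qed
    then have "d \<in> Y" using Nd unfolding Y_def X_def S_def by (auto simp: d_def)
    from m(2)[OF this] have "Q m \<le> Q d" .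
    also have "Q d = Q c / N c"
    proof -
      have "tp K d x = tp K c x / of_real s" for x
        by (simp add: tp_def d_def sum_divide_distrib)
      then have "\<sigma> x * (cmod (tp K d x))\<^sup>2 = (\<sigma> x * (cmod (tp K c x))\<^sup>2) / N c" for x
        using s by (simp add: norm_divide power_divide)
      then show ?thesis unfolding Q_def by simp
    qed
    finally show ?thesis using N0 Qm by (simp add: field_simps)
  qed
  then have "0 \<le> 1 / Q m \<and> (\<forall>c. (\<Sum>k\<in>K. (cmod (c k))\<^sup>2) \<le> 1 / Q m * (LINT x|M. \<sigma> x * (cmod (tp K c x))\<^sup>2))"
    using Qm by (simp add: N_def Q_def)
  then show ?thesis by (rule exI)
qed

text \<open>For bounded \<open>R\<close> the symbol is elliptic outside a fixed finite set of
  frequencies, so the source bounds the rest \<open>r\<close> of \<open>w\<close>. Where \<sigma> is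
  not 0 the polynomial part is \<open>- r\<close>, hence small there, and
  \<open>trig_lower_bound\<close> makes it small everywhere.\<close>

theorem low_frequency:
  fixes \<sigma> :: "real \<times> real \<Rightarrow> real"
  assumes \<sigma>: "continuous_on UNIV \<sigma>" "periodic \<sigma>" "\<And>x. 0 \<le> \<sigma> x" "\<And>x. \<sigma> x \<le> 1" "\<exists>x. \<sigma> x > 0" and R1: "0 \<le> R1"
  shows "\<exists>C\<ge>0. \<forall>R w F1 F2 G. 0 < R \<longrightarrow> R \<le> R1 \<longrightarrow> L2 w \<longrightarrow> L2 F1 \<longrightarrow> L2 F2 \<longrightarrow> L2 G \<longrightarrow>
     (\<forall>x. \<sigma> x \<noteq> 0 \<longrightarrow> w x = 0) \<longrightarrow> helmholtz R w F1 F2 G \<longrightarrow>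
     nrm w \<le> C * (nrm F1 + nrm F2 + nrm G)"
proof -
  \<comment> \<open>Beyond twice \<open>R1\<close> the symbol is at least half the squared length of
    the frequency; the added 1 makes that square at least the length itself, which is what one
    derivative of the source requires.\<close>
  define K where "K = {k. norm (fr k) \<le> 2 * R1 + 1}"
  have K: "finite K" unfolding K_def by (rule finite_fr_ball)
  obtain C0 where C0: "C0 \<ge> 0" "\<And>c. (\<Sum>k\<in>K. (cmod (c k))\<^sup>2) \<le> C0 * (LINT x|M. \<sigma> x * (cmod (tp K c x))\<^sup>2)"
    using trig_lower_bound[OF K \<sigma>(1,2,3,5)] by blast
  have "nrm w \<le> 12 * (C0 + 1) * (nrm F1 + nrm F2 + nrm G)"
    if R: "0 < R" "R \<le> R1" and L: "L2 w" "L2 F1" "L2 F2" "L2 G"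
      and w0: "\<And>x. \<sigma> x \<noteq> 0 \<Longrightarrow> w x = 0" and eq: "helmholtz R w F1 F2 G" for R w F1 F2 G
  proof -
    define p where "p = tp K (fc w)"
    define r where "r x = w x - p x" for x
    have Lr: "L2 r" unfolding r_def[abs_def] p_def by (intro L2_diff L L2_tp)
    have fcr: "fc r k = (if k \<in> K then 0 else fc w k)" for k
      unfolding r_def[abs_def] p_def using K by (simp add: fc_diff L L2_tp fc_tp)
    have nr: "nrm r \<le> 12 * nrm F1 + 12 * nrm F2 + 12 * nrm G"
    proof (rule nrm_le_fc3[OF Lr L(2,3,4)])
      fix k
      define x where "x = cmod (fc F1 k)"
      define y where "y = cmod (fc F2 k)"
      define z where "z = cmod (fc G k)"
      define n where "n = norm (fr k)"
      have xyz: "x \<ge> 0" "y \<ge> 0" "z \<ge> 0" "n \<ge> 0" by (auto simp: x_def y_def z_def n_def)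
      have "(cmod (fc r k))\<^sup>2 \<le> 12 * x\<^sup>2 + 12 * y\<^sup>2 + 12 * z\<^sup>2"
      proof (cases "k \<in> K")
        case True then show ?thesis by (simp add: fcr)
      next
        case False
        then have n: "n > 2 * R1 + 1" by (simp add: K_def n_def)
        have "R * R \<le> (n / 2) * (n / 2)" using n R R1 by (intro mult_mono) auto
        then have "R * R * 4 \<le> n * n" by simp
        then have "n * n / 2 \<le> n\<^sup>2 - R\<^sup>2" using zero_le_square[of R] unfolding power2_eq_square by argo
        moreover have "n * 1 \<le> n * n" using n R1 by (intro mult_left_mono) auto
        ultimately have low: "n / 2 \<le> \<bar>n\<^sup>2 - R\<^sup>2\<bar>" by linarith
        have f: "\<bar>fst (fr k)\<bar> \<le> n" "\<bar>snd (fr k)\<bar> \<le> n"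
          using norm_fst_le[of "fst (fr k)" "snd (fr k)"] norm_snd_le[of "snd (fr k)" "fst (fr k)"] by (auto simp: n_def)
        have "n / 2 * cmod (fc w k) \<le> \<bar>n\<^sup>2 - R\<^sup>2\<bar> * cmod (fc w k)" by (intro mult_right_mono low) simp
        also have "\<dots> = cmod (of_real ((norm (fr k))\<^sup>2 - R\<^sup>2) * fc w k)" unfolding norm_mult norm_of_real n_def ..
        also have "\<dots> = cmod (\<i> * of_real (fst (fr k)) * fc F1 k + \<i> * of_real (snd (fr k)) * fc F2 k + fc G k)"
          using eq[unfolded helmholtz_def, rule_format, of k] by simp
        also have "\<dots> \<le> \<bar>fst (fr k)\<bar> * x + \<bar>snd (fr k)\<bar> * y + z"
          using norm_triangle_ineq[of "\<i> * of_real (fst (fr k)) * fc F1 k + \<i> * of_real (snd (fr k)) * fc F2 k" "fc G k"]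
            norm_triangle_ineq[of "\<i> * of_real (fst (fr k)) * fc F1 k" "\<i> * of_real (snd (fr k)) * fc F2 k"]
          by (simp add: norm_mult x_def y_def z_def)
        also have "\<dots> \<le> n * x + n * y + n * z"
          using f xyz n R1 mult_right_mono[of 1 n z] by (intro add_mono mult_right_mono) auto
        finally have "n * cmod (fc w k) \<le> n * (2 * (x + y + z))" by (simp add: algebra_simps)
        then have "cmod (fc w k) \<le> 2 * (x + y + z)" using n R1 by (subst (asm) mult_le_cancel_left_pos) auto
        then have "(cmod (fc w k))\<^sup>2 \<le> (2 * (x + y + z))\<^sup>2" by (intro power_mono) auto
        also have "\<dots> \<le> 12 * x\<^sup>2 + 12 * y\<^sup>2 + 12 * z\<^sup>2"
          using zero_le_power2[of "x - y"] zero_le_power2[of "x - z"] zero_le_power2[of "y - z"]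
          by (simp add: power2_eq_square algebra_simps)
        finally show ?thesis using False by (simp add: fcr)
      qed
      then show "(cmod (fc r k))\<^sup>2 \<le> 12 * (cmod (fc F1 k))\<^sup>2 + 12 * (cmod (fc F2 k))\<^sup>2 + 12 * (cmod (fc G k))\<^sup>2"
        by (simp add: x_def y_def z_def)
    qed
    \<comment> \<open>On {\<sigma> \<noteq> 0} the function \<open>w\<close> vanishes, so
      \<open>p\<close> and \<open>r\<close> have equal modulus there.\<close>
    have np: "(LINT x|M. \<sigma> x * (cmod (p x))\<^sup>2) \<le> nrm r"
      unfolding nrm_def
    proof (rule integral_mono)
      show "integrable M (\<lambda>x. \<sigma> x * (cmod (p x))\<^sup>2)"
        unfolding p_def by (intro integrable_smooth continuous_intros \<sigma> smooth_continuous[OF smooth_tp])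
      show "integrable M (\<lambda>x. (cmod (r x))\<^sup>2)" by (rule L2_integrable[OF Lr])
      show "\<sigma> x * (cmod (p x))\<^sup>2 \<le> (cmod (r x))\<^sup>2" for x
      proof (cases "\<sigma> x = 0")
        case False
        then have "cmod (r x) = cmod (p x)" using w0 by (simp add: r_def)
        then show ?thesis using \<sigma>(4)[of x] mult_right_mono[of "\<sigma> x" 1 "(cmod (p x))\<^sup>2"] by simp
      qed simp
    qed
    have "nrm w = (\<Sum>k\<in>K. (cmod (fc w k))\<^sup>2) + nrm r"
      using nrm_diff_tp[OF L(1) K, of "fc w"] by (simp add: r_def[abs_def] p_def)
    also have "(\<Sum>k\<in>K. (cmod (fc w k))\<^sup>2) \<le> C0 * nrm r"
      using C0(2)[of "fc w"] mult_left_mono[OF np C0(1)] by (simp add: p_def)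
    also have "C0 * nrm r + nrm r = (C0 + 1) * nrm r" by (simp add: algebra_simps)
    also have "\<dots> \<le> (C0 + 1) * (12 * nrm F1 + 12 * nrm F2 + 12 * nrm G)"
      using C0(1) by (intro mult_left_mono nr) simp
    finally show ?thesis by (simp add: algebra_simps)
  qed
  then show ?thesis using C0(1) by (intro exI[of _ "12 * (C0 + 1)"]) auto
qed

subsection \<open>Transfer to the billiard\<close>

lemma flat_torus_borel [measurable]: "flat_torus a b \<in> sets borel"
  using compact_imp_closed[OF compact_torus] by simp

text \<open>The integral over the torus is an image measure of the half-open cell, which agrees
  almost everywhere with \<open>cell\<close>. Measurability is assumed upstairs; the section
  \<open>proj_inv\<close> brings it down.\<close>

lemma
  fixes h :: "complex \<times> complex \<Rightarrow> 'c :: {banach, second_countable_topology}"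
  assumes S: "S \<subseteq> flat_torus a b" and m: "(\<lambda>p. indicator S (proj p) *\<^sub>R h (proj p)) \<in> borel_measurable borel"
  shows set_integral_torus: "(LINT x:S|torus_measure a b. h x) = area *\<^sub>R (LINT p|M. indicator S (proj p) *\<^sub>R h (proj p))"
    and set_integrable_torus: "set_integrable (torus_measure a b) S h \<longleftrightarrow> integrable M (\<lambda>p. indicator S (proj p) *\<^sub>R h (proj p))"
    and set_measurable_torus: "set_borel_measurable (torus_measure a b) S h"
proof -
  define g where "g p = indicator S (proj p) *\<^sub>R h (proj p)" for p
  define f where "f z = indicator S z *\<^sub>R h z" for z
  let ?B = "{0..<2 * pi * a} \<times> {0..<2 * pi * b}"
  have [measurable]: "g \<in> borel_measurable borel" using m by (simp add: g_def[abs_def])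
  have "f = (\<lambda>z. indicator (flat_torus a b) z *\<^sub>R g (proj_inv z))"
    using S by (auto simp: f_def g_def proj_proj_inv indicator_def fun_eq_iff)
  then have fm [measurable]: "f \<in> borel_measurable borel" by simp
  have B [measurable]: "?B \<in> sets borel"
    by (intro borel_Times) auto
  have pm: "proj \<in> measurable (restrict_space lborel ?B) borel"
    by (intro measurable_restrict_space1) simp
  have ae: "AE p in lborel. indicator ?B p *\<^sub>R f (proj p) = indicator cell p *\<^sub>R g p"
    using AE_cell_interior
  proof eventually_elim
    case (elim p)
    have "?B \<subseteq> cell" by (auto simp: cell_def cbox_Pair_eq)
    then show ?case using elim by (auto simp: indicator_def f_def g_def)
  qed
  have "(LINT x:S|torus_measure a b. h x) = (LINT p|restrict_space lborel ?B. f (proj p))"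
    unfolding set_lebesgue_integral_def torus_measure_def f_def[symmetric]
    by (rule integral_distr[OF pm]) simp
  also have "\<dots> = (LINT p|lborel. indicator ?B p *\<^sub>R f (proj p))"
    by (rule integral_restrict_space) simp
  also have "\<dots> = (LINT p|lborel. indicator cell p *\<^sub>R g p)"
    using ae by (intro integral_cong_AE) simp_all
  also have "\<dots> = area *\<^sub>R (LINT p|M. g p)"
    using area_pos by (simp add: integral_M)
  finally show "(LINT x:S|torus_measure a b. h x) = area *\<^sub>R (LINT p|M. indicator S (proj p) *\<^sub>R h (proj p))"
    by (simp add: g_def)
  have "set_integrable (torus_measure a b) S h \<longleftrightarrow> integrable (restrict_space lborel ?B) (\<lambda>p. f (proj p))"
    unfolding set_integrable_def torus_measure_def f_def[symmetric]
    by (rule integrable_distr_eq[OF pm]) simp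
  also have "\<dots> \<longleftrightarrow> integrable lborel (\<lambda>p. indicator ?B p *\<^sub>R f (proj p))"
    by (rule integrable_restrict_space) simp
  also have "\<dots> \<longleftrightarrow> integrable lborel (\<lambda>p. indicator cell p *\<^sub>R g p)"
    using ae by (intro integrable_cong_AE) simp_all
  also have "\<dots> \<longleftrightarrow> integrable M g" by (simp add: integrable_M)
  finally show "set_integrable (torus_measure a b) S h \<longleftrightarrow> integrable M (\<lambda>p. indicator S (proj p) *\<^sub>R h (proj p))"
    by (simp add: g_def[abs_def])
  show "set_borel_measurable (torus_measure a b) S h"
    using fm by (simp add: set_borel_measurable_def torus_measure_def f_def[abs_def])
qed

text \<open>The components of the covering are multiples of the characters \<open>e (1, 0)\<close>
  and \<open>e (0, 1)\<close>, and a linear functional of them is smooth. This supplies smooth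
  cut-offs on the torus.\<close>

lemma smooth_polynomial_proj: "real_polynomial_function g \<Longrightarrow> smooth (\<lambda>p. g (proj p))"
proof (induction rule: real_polynomial_function.induct)
  case (linear L)
  have A: "bounded_linear (\<lambda>z. L (of_real a * z, 0 :: complex))"
    by (rule bounded_linear_compose[OF linear bounded_linear_Pair[OF bounded_linear_mult_right bounded_linear_zero]])
  have B: "bounded_linear (\<lambda>z. L (0 :: complex, of_real b * z))"
    by (rule bounded_linear_compose[OF linear bounded_linear_Pair[OF bounded_linear_zero bounded_linear_mult_right]])
  have "L (proj p) = L (of_real a * e (1, 0) p, 0) + L (0, of_real b * e (0, 1) p)" for p
  proof -
    have "proj p = (of_real a * e (1, 0) p, 0) + (0, of_real b * e (0, 1) p)"
      by (simp add: torus_proj_def e_def fr_def inner_prod_def)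
    then show ?thesis by (simp only: linear_add[OF bounded_linear.linear[OF linear]])
  qed
  moreover have "smooth (\<lambda>p. L (of_real a * e (1, 0) p, 0) + L (0, of_real b * e (0, 1) p))"
    by (intro smooth_add smooth_linear[OF A smooth_e] smooth_linear[OF B smooth_e])
  ultimately show ?case by presburger
next
  case (add f g) then show ?case by (intro smooth_add)
next
  case (mult f g) then show ?case by (intro smooth_mult)
qed (rule smooth_const)

text \<open>Lift to the plane after extension by 0 over the obstacle. The extension is only an L2
  function; no regularity across the boundary is used.\<close>

definition pull :: "(complex \<times> complex) set \<Rightarrow> (complex \<times> complex \<Rightarrow> complex) \<Rightarrow> real \<times> real \<Rightarrow> complex" where
  "pull S u p = indicator S (proj p) * u (proj p)"

lemma pull_eq: "pull S u p = indicator S (proj p) *\<^sub>R u (proj p)"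
  by (simp add: pull_def indicator_def)

lemma pull_measurable:
  assumes "set_borel_measurable (torus_measure a b) S u"
  shows "pull S u \<in> borel_measurable borel"
proof -
  have "(\<lambda>z. indicator S z *\<^sub>R u z) \<in> borel_measurable borel"
    using assms by (simp add: set_borel_measurable_def torus_measure_def)
  from measurable_compose[OF measurable_proj this] show ?thesis by (simp add: pull_eq[abs_def])
qed

lemma cmod_pull_sq: "(cmod (pull S u p))\<^sup>2 = indicator S (proj p) *\<^sub>R (cmod (u (proj p)))\<^sup>2"
  by (simp add: pull_def indicator_def)

lemma L2_on_imp_L2:
  assumes S: "S \<subseteq> flat_torus a b" and u: "L2_on a b S u"
  shows "L2 (pull S u)"
proof -
  have m [measurable]: "pull S u \<in> borel_measurable borel" using u pull_measurable by (simp add: L2_on_def)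
  have "(\<lambda>p. (cmod (pull S u p))\<^sup>2) \<in> borel_measurable borel" by measurable
  then have "integrable M (\<lambda>p. (cmod (pull S u p))\<^sup>2)"
    using u set_integrable_torus[OF S, of "\<lambda>x. (cmod (u x))\<^sup>2"] by (simp add: L2_on_def cmod_pull_sq)
  with m show ?thesis by (simp add: L2_def)
qed

lemma L2_imp_L2_on:
  assumes S: "S \<subseteq> flat_torus a b" and u: "L2 (pull S u)"
  shows "L2_on a b S u"
proof -
  have m [measurable]: "pull S u \<in> borel_measurable borel" using u by (simp add: L2_def)
  have "(\<lambda>p. (cmod (pull S u p))\<^sup>2) \<in> borel_measurable borel" by measurable
  then have "set_integrable (torus_measure a b) S (\<lambda>x. (cmod (u x))\<^sup>2)"
    using u set_integrable_torus[OF S, of "\<lambda>x. (cmod (u x))\<^sup>2"] by (simp add: L2_def cmod_pull_sq)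
  moreover have "set_borel_measurable (torus_measure a b) S u"
    by (rule set_measurable_torus[OF S]) (use m in \<open>simp add: pull_eq[abs_def]\<close>)
  ultimately show ?thesis by (simp add: L2_on_def)
qed

lemma set_integral_nrm:
  assumes "S \<subseteq> flat_torus a b" "pull S u \<in> borel_measurable borel"
  shows "(LINT x:S|torus_measure a b. (cmod (u x))\<^sup>2) = area * nrm (pull S u)"
proof -
  have [measurable]: "pull S u \<in> borel_measurable borel" by fact
  have "(\<lambda>p. (cmod (pull S u p))\<^sup>2) \<in> borel_measurable borel" by measurable
  then show ?thesis
    using set_integral_torus[OF assms(1), of "\<lambda>x. (cmod (u x))\<^sup>2"] by (simp add: nrm_def cmod_pull_sq)
qed

lemma set_integral_pull_mult:
  assumes S: "S \<subseteq> flat_torus a b" and u: "pull S u \<in> borel_measurable borel" and f: "f \<in> borel_measurable borel"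
    and h: "\<And>p. h (proj p) = f p"
  shows "(LINT x:S|torus_measure a b. u x * h x) = area * (LINT p|M. pull S u p * f p)"
proof -
  have eq: "indicator S (proj p) *\<^sub>R (u (proj p) * h (proj p)) = pull S u p * f p" for p
    by (simp add: pull_eq h)
  have "(\<lambda>p. pull S u p * f p) \<in> borel_measurable borel" using u f by simp
  then have "(LINT x:S|torus_measure a b. u x * h x) = area *\<^sub>R (LINT p|M. pull S u p * f p)"
    using set_integral_torus[OF S, of "\<lambda>x. u x * h x"] by (simp only: eq)
  then show ?thesis by (simp add: scaleR_conv_of_real)
qed

abbreviation "x_dir \<equiv> (1, 0) :: real \<times> real"
abbreviation "y_dir \<equiv> (0, 1) :: real \<times> real"

lemma torus_d_proj:
  assumes "smooth (\<phi> \<circ> proj)"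
  shows "torus_d1 a \<phi> (proj p) = D x_dir (\<phi> \<circ> proj) p" "torus_d2 b \<phi> (proj p) = D y_dir (\<phi> \<circ> proj) p"
proof -
  have "(\<lambda>t. \<phi> (fst (proj p) * cis (t / a), snd (proj p))) = (\<lambda>t. (\<phi> \<circ> proj) (p + t *\<^sub>R x_dir))"
    by (simp add: torus_proj_def fun_eq_iff add_divide_distrib cis_mult mult.assoc)
  then show "torus_d1 a \<phi> (proj p) = D x_dir (\<phi> \<circ> proj) p"
    unfolding torus_d1_def
    using vector_derivative_at[OF has_vector_derivative_line[OF assms, of p x_dir 0 UNIV]]
    by (simp add: zero_prod_def[symmetric])
  have "(\<lambda>t. \<phi> (fst (proj p), snd (proj p) * cis (t / b))) = (\<lambda>t. (\<phi> \<circ> proj) (p + t *\<^sub>R y_dir))"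
    by (simp add: torus_proj_def fun_eq_iff add_divide_distrib cis_mult mult.assoc)
  then show "torus_d2 b \<phi> (proj p) = D y_dir (\<phi> \<circ> proj) p"
    unfolding torus_d2_def
    using vector_derivative_at[OF has_vector_derivative_line[OF assms, of p y_dir 0 UNIV]]
    by (simp add: zero_prod_def[symmetric])
qed

lemma periodic_comp_proj: "periodic (\<lambda>p. \<phi> (proj p))"
  by (simp add: periodic_def)

text \<open>The inverse of lifting on periodic functions; on other functions it depends on the
  choice of the section.\<close>

definition push :: "(real \<times> real \<Rightarrow> complex) \<Rightarrow> complex \<times> complex \<Rightarrow> complex" where
  "push f z = f (proj_inv z)"

lemma push_proj: "periodic f \<Longrightarrow> push f \<circ> proj = f"
  by (simp add: push_def fun_eq_iff periodic_proj_inv)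

lemma push_proj': "periodic f \<Longrightarrow> push f (proj p) = f p"
  by (simp add: push_def periodic_proj_inv)

end

section \<open>Weak eigenfunctions on the billiard\<close>

locale billiard_domain = torus +
  fixes Q S :: "(complex \<times> complex) set"
  assumes Q: "openin (top_of_set (flat_torus a b)) Q" and S_def: "S = flat_torus a b - Q"
begin

lemma S_sub: "S \<subseteq> flat_torus a b" by (simp add: S_def)

lemma closed_S: "closed S"
proof -
  obtain W where "open W" "Q = flat_torus a b \<inter> W" using Q by (auto simp: openin_open)
  then have "S = flat_torus a b - W" by (auto simp: S_def)
  then show ?thesis using \<open>open W\<close> compact_imp_closed[OF compact_torus] by (simp add: closed_Diff)
qed

lemma open_lift: "open (proj -` Q)"
proof -
  have "proj -` Q = - (proj -` S)" using proj_in_torus by (auto simp: S_def)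
  moreover have "closed (proj -` S)" by (rule closed_vimage[OF closed_S continuous_proj])
  ultimately show ?thesis by (simp only: open_Compl)
qed

lemma S_iff: "proj p \<in> S \<longleftrightarrow> p \<notin> proj -` Q"
  using proj_in_torus by (auto simp: S_def)

text \<open>Lifts of test functions. They vanish near the closed obstacle and so lie in the form
  domain of both boundary conditions.\<close>

definition admissible :: "(real \<times> real \<Rightarrow> complex) \<Rightarrow> bool" where
  "admissible f \<longleftrightarrow> smooth f \<and> periodic f \<and> test_function a b S (push f)"

lemma admissible_zero:
  assumes "admissible f" "p \<in> proj -` Q" shows "f p = 0"
proof (rule ccontr)
  assume "f p \<noteq> 0"
  then have "proj p \<in> {x \<in> flat_torus a b. push f x \<noteq> 0}"
    using assms proj_in_torus by (simp add: admissible_def push_proj')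
  also have "\<dots> \<subseteq> closure {x \<in> flat_torus a b. push f x \<noteq> 0}" by (rule closure_subset)
  also have "\<dots> \<subseteq> S"
    using assms interior_of_subset[of "top_of_set (flat_torus a b)" S]
    by (auto simp: admissible_def test_function_def)
  finally show False using assms(2) S_iff by blast
qed

lemma pull_push:
  assumes "periodic f" "\<And>p. p \<in> proj -` Q \<Longrightarrow> f p = 0" shows "pull S (push f) = f"
proof
  fix p
  show "pull S (push f) p = f p"
    using assms(2)[of p] S_iff[of p] push_proj'[OF assms(1), of p]
    by (cases "proj p \<in> Q") (simp_all add: pull_def)
qed

lemma admissible_derivative_pull:
  assumes "admissible f"
  shows "pull S (torus_d1 a (push f)) = D x_dir f" "pull S (torus_d2 b (push f)) = D y_dir f"
proof -
  have f: "smooth f" "periodic f" using assms by (auto simp: admissible_def)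
  have D0: "D v f p = 0" if "p \<in> proj -` Q" for v p
    by (rule D_zero_open[OF open_lift that, where c=0]) (rule admissible_zero[OF assms])
  have "torus_d1 a (push f) (proj p) = D x_dir f p" "torus_d2 b (push f) (proj p) = D y_dir f p" for p
    using torus_d_proj[of "push f" p] f by (simp_all add: push_proj)
  then show "pull S (torus_d1 a (push f)) = D x_dir f" "pull S (torus_d2 b (push f)) = D y_dir f"
    using D0 S_iff by (auto simp: pull_def indicator_def fun_eq_iff)
qed

text \<open>Extended by 0 the function is smooth on the whole torus, where integration by parts has
  no boundary term.\<close>

lemma admissible_H1_grad:
  assumes "admissible f"
  shows "H1_grad a b S (push f) (torus_d1 a (push f)) (torus_d2 b (push f))"
proof -
  have f: "smooth f" "periodic f" using assms by (auto simp: admissible_def)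
  have p0: "pull S (push f) = f" by (rule pull_push[OF f(2) admissible_zero[OF assms]])
  note pd = admissible_derivative_pull[OF assms]
  have meas: "g \<in> borel_measurable borel" if "smooth g" for g :: "real \<times> real \<Rightarrow> complex"
    by (rule borel_measurable_continuous_onI[OF smooth_continuous[OF that]])
  have ibp: "(LINT p|M. f p * D v g p) = - (LINT p|M. D v f p * g p)" if g: "smooth g" "periodic g" for g v
  proof -
    have "(LINT p|M. D v (\<lambda>x. f x * g x) p) = 0"
      by (rule integral_D[OF smooth_mult[OF f(1) g(1)] periodic_mult[OF f(2) g(2)]])
    moreover have "integrable M (\<lambda>p. D v f p * g p)" "integrable M (\<lambda>p. f p * D v g p)"
      by (intro integrable_smooth smooth_continuous smooth_mult smooth_D f g)+
    ultimately show ?thesis by (simp add: D_mult f g add_eq_0_iff)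
  qed
  show ?thesis
    unfolding H1_grad_def
  proof (intro conjI allI impI)
    show "L2_on a b S (push f)" by (rule L2_imp_L2_on[OF S_sub]) (simp add: p0 L2_smooth f)
    show "L2_on a b S (torus_d1 a (push f))" "L2_on a b S (torus_d2 b (push f))"
      by (rule L2_imp_L2_on[OF S_sub], simp add: pd L2_smooth smooth_D f)+
    fix \<phi> assume "test_function a b S \<phi>"
    then have g: "smooth (\<phi> \<circ> proj)" by (simp add: test_function_def)
    have pg: "periodic (\<phi> \<circ> proj)" using periodic_comp_proj[of \<phi>] by (simp add: comp_def)
    have l: "(LINT x:S|torus_measure a b. push f x * h x) = area * (LINT p|M. f p * k p)"
      if "\<And>p. h (proj p) = k p" "smooth k" for h k
      using set_integral_pull_mult[where h=h and f=k and u="push f" and S=S, OF S_sub _ meas[OF that(2)] that(1)] meas[OF f(1)] by (simp add: p0)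
    have r1: "(LINT x:S|torus_measure a b. torus_d1 a (push f) x * \<phi> x) = area * (LINT p|M. D x_dir f p * (\<phi> \<circ> proj) p)"
      using set_integral_pull_mult[OF S_sub _ _, of "torus_d1 a (push f)" "\<phi> \<circ> proj" \<phi>] meas[OF g] meas[OF smooth_D[OF f(1)]]
      by (simp add: pd)
    have r2: "(LINT x:S|torus_measure a b. torus_d2 b (push f) x * \<phi> x) = area * (LINT p|M. D y_dir f p * (\<phi> \<circ> proj) p)"
      using set_integral_pull_mult[OF S_sub _ _, of "torus_d2 b (push f)" "\<phi> \<circ> proj" \<phi>] meas[OF g] meas[OF smooth_D[OF f(1)]]
      by (simp add: pd)
    show "(LINT x:S|torus_measure a b. push f x * torus_d1 a \<phi> x) = - (LINT x:S|torus_measure a b. torus_d1 a (push f) x * \<phi> x)"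
      unfolding r1 l[OF torus_d_proj(1)[OF g] smooth_D[OF g]] ibp[OF g pg] by simp
    show "(LINT x:S|torus_measure a b. push f x * torus_d2 b \<phi> x) = - (LINT x:S|torus_measure a b. torus_d2 b (push f) x * \<phi> x)"
      unfolding r2 l[OF torus_d_proj(2)[OF g] smooth_D[OF g]] ibp[OF g pg] by simp
  qed
qed

lemma admissible_form_domain:
  assumes "admissible f"
  shows "form_domain_grad bc a b S (push f) (torus_d1 a (push f)) (torus_d2 b (push f))"
proof (cases bc)
  case Neumann then show ?thesis using admissible_H1_grad[OF assms] by simp
next
  case Dirichlet
  have "test_function a b S (push f)" using assms by (simp add: admissible_def)
  then have "H10_grad a b S (push f) (torus_d1 a (push f)) (torus_d2 b (push f))"
    unfolding H10_grad_def using admissible_H1_grad[OF assms]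
    \<comment> \<open>A test function approximates itself, by the constant sequence.\<close>
    by (auto intro!: exI[of _ "\<lambda>n. push f"])
  then show ?thesis using Dirichlet by simp
qed

lemma admissible_cnj:
  assumes "admissible f" shows "admissible (\<lambda>x. cnj (f x))"
proof -
  have f: "smooth f" "periodic f" "test_function a b S (push f)" using assms by (auto simp: admissible_def)
  have s: "smooth (\<lambda>x. cnj (f x))" by (rule smooth_linear[OF bounded_linear_cnj f(1)])
  have p: "periodic (\<lambda>x. cnj (f x))" by (rule periodic_comp[OF f(2)])
  have "{x \<in> flat_torus a b. push (\<lambda>x. cnj (f x)) x \<noteq> 0} = {x \<in> flat_torus a b. push f x \<noteq> 0}"
    by (simp add: push_def)
  then show ?thesis using s p f(3) unfolding admissible_def test_function_def by (simp add: push_proj p)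
qed

text \<open>Testing the weak equation with \<open>f\<close> and the weak gradient with the derivatives of \<open>f\<close> moves the whole
  Laplacian onto \<open>f\<close>; the boundary condition enters only through the form domain.\<close>

lemma weak_helmholtz:
  assumes lap: "has_laplacian bc a b S u Lu" and eig: "AE x\<in>S in torus_measure a b. Lu x = - of_real \<mu> * u x"
    and f: "admissible f" "admissible (D x_dir f)" "admissible (D y_dir f)"
  shows "(LINT p|M. pull S u p * (D x_dir (D x_dir f) p + D y_dir (D y_dir f) p)) = - of_real \<mu> * (LINT p|M. pull S u p * f p)"
    and "L2 (pull S u)"
proof -
  have LLu: "L2_on a b S Lu" using lap by (simp add: has_laplacian_def)
  obtain g1 g2 where fd: "form_domain_grad bc a b S u g1 g2"
    and weak: "\<forall>v k1 k2. form_domain_grad bc a b S v k1 k2 \<longrightarrow>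
        (LINT x:S|torus_measure a b. g1 x * cnj (k1 x) + g2 x * cnj (k2 x)) = - (LINT x:S|torus_measure a b. Lu x * cnj (v x))"
    using lap unfolding has_laplacian_def by (elim conjE exE) (rule that; assumption)
  have "H1_grad a b S u g1 g2" using fd by (cases bc) (auto simp: H10_grad_def)
  then have L: "L2_on a b S u" "L2_on a b S g1" "L2_on a b S g2"
    and grad: "\<And>\<phi>. test_function a b S \<phi> \<Longrightarrow>
        (LINT x:S|torus_measure a b. u x * torus_d1 a \<phi> x) = - (LINT x:S|torus_measure a b. g1 x * \<phi> x)"
      "\<And>\<phi>. test_function a b S \<phi> \<Longrightarrow>
        (LINT x:S|torus_measure a b. u x * torus_d2 b \<phi> x) = - (LINT x:S|torus_measure a b. g2 x * \<phi> x)"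
    by (auto simp: H1_grad_def)
  have PL: "L2 (pull S u)" "L2 (pull S g1)" "L2 (pull S g2)" "L2 (pull S Lu)"
    using L LLu L2_on_imp_L2[OF S_sub] by auto
  note pm = PL[THEN L2_measurable]
  show "L2 (pull S u)" by (rule PL)
  have sp: "smooth g \<and> periodic g" if "admissible g" for g using that by (simp add: admissible_def)
  have meas: "g \<in> borel_measurable borel" if "smooth g" for g :: "real \<times> real \<Rightarrow> complex"
    by (rule borel_measurable_continuous_onI[OF smooth_continuous[OF that]])
  have grad': "(LINT p|M. pull S u p * D x_dir g p) = - (LINT p|M. pull S g1 p * g p)"
    "(LINT p|M. pull S u p * D y_dir g p) = - (LINT p|M. pull S g2 p * g p)" if g: "admissible g" for g
  proof -
    have t: "test_function a b S (push g)" and s: "smooth (push g \<circ> proj)" and gp: "periodic g" "smooth g" "push g \<circ> proj = g"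
      using g sp[OF g] by (auto simp: admissible_def push_proj)
    have h: "torus_d1 a (push g) (proj p) = D x_dir g p" "torus_d2 b (push g) (proj p) = D y_dir g p" for p
      using torus_d_proj[OF s] gp by auto
    have "of_real area * (LINT p|M. pull S u p * D x_dir g p) = - (of_real area * (LINT p|M. pull S g1 p * g p))"
      using grad(1)[OF t] set_integral_pull_mult[where h="torus_d1 a (push g)" and f="D x_dir g", OF S_sub pm(1) meas[OF smooth_D[OF gp(2)]] h(1)]
        set_integral_pull_mult[where h="push g" and f=g, OF S_sub pm(2) meas[OF gp(2)] push_proj'[OF gp(1)]] by simp
    then have "of_real area * (LINT p|M. pull S u p * D x_dir g p) = of_real area * - (LINT p|M. pull S g1 p * g p)" by simp
    then show "(LINT p|M. pull S u p * D x_dir g p) = - (LINT p|M. pull S g1 p * g p)"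
      using area_pos unfolding mult_cancel_left by simp
    have "of_real area * (LINT p|M. pull S u p * D y_dir g p) = - (of_real area * (LINT p|M. pull S g2 p * g p))"
      using grad(2)[OF t] set_integral_pull_mult[where h="torus_d2 b (push g)" and f="D y_dir g", OF S_sub pm(1) meas[OF smooth_D[OF gp(2)]] h(2)]
        set_integral_pull_mult[where h="push g" and f=g, OF S_sub pm(3) meas[OF gp(2)] push_proj'[OF gp(1)]] by simp
    then have "of_real area * (LINT p|M. pull S u p * D y_dir g p) = of_real area * - (LINT p|M. pull S g2 p * g p)" by simp
    then show "(LINT p|M. pull S u p * D y_dir g p) = - (LINT p|M. pull S g2 p * g p)"
      using area_pos unfolding mult_cancel_left by simp
  qed
  \<comment> \<open>The form is sesquilinear, so the conjugate is inserted as test function to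
    obtain a pairing that is linear in \<open>f\<close>.\<close>
  define fb where "fb x = cnj (f x)" for x
  have fb: "admissible fb" unfolding fb_def[abs_def] by (rule admissible_cnj[OF f(1)])
  have sf: "smooth f" "periodic f" using sp[OF f(1)] by auto
  have sfb: "smooth fb" "periodic fb" using sp[OF fb] by auto
  have Dfb: "D v fb p = cnj (D v f p)" for v p
    unfolding fb_def[abs_def] by (rule D_linear[OF bounded_linear_cnj sf(1)])
  have "(LINT x:S|torus_measure a b. g1 x * cnj (torus_d1 a (push fb) x) + g2 x * cnj (torus_d2 b (push fb) x)) =
      - (LINT x:S|torus_measure a b. Lu x * cnj (push fb x))"
    using weak admissible_form_domain[OF fb] by blast
  moreover have "(LINT x:S|torus_measure a b. g1 x * cnj (torus_d1 a (push fb) x) + g2 x * cnj (torus_d2 b (push fb) x)) =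
      of_real area * (LINT p|M. pull S g1 p * D x_dir f p + pull S g2 p * D y_dir f p)"
  proof -
    have d: "torus_d1 a (push fb) (proj p) = cnj (D x_dir f p)" "torus_d2 b (push fb) (proj p) = cnj (D y_dir f p)" for p
      using torus_d_proj[of "push fb" p] sfb by (simp_all add: push_proj Dfb)
    have eq: "indicator S (proj p) *\<^sub>R (g1 (proj p) * cnj (torus_d1 a (push fb) (proj p)) + g2 (proj p) * cnj (torus_d2 b (push fb) (proj p)))
        = pull S g1 p * D x_dir f p + pull S g2 p * D y_dir f p" for p
      by (simp add: d pull_eq scaleR_add_right)
    have "(\<lambda>p. pull S g1 p * D x_dir f p + pull S g2 p * D y_dir f p) \<in> borel_measurable borel"
      using pm meas[OF smooth_D[OF sf(1)]] by simp
    then show ?thesis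
      using set_integral_torus[OF S_sub, of "\<lambda>x. g1 x * cnj (torus_d1 a (push fb) x) + g2 x * cnj (torus_d2 b (push fb) x)"]
      by (simp only: eq scaleR_conv_of_real[of area])
  qed
  moreover have "(LINT x:S|torus_measure a b. Lu x * cnj (push fb x)) = of_real area * (LINT p|M. pull S Lu p * f p)"
    using set_integral_pull_mult[OF S_sub pm(4) meas[OF sf(1)], of "\<lambda>x. cnj (push fb x)"] sfb
    by (simp add: push_proj') (simp add: fb_def)
  ultimately have "of_real area * (LINT p|M. pull S g1 p * D x_dir f p + pull S g2 p * D y_dir f p) = of_real area * - (LINT p|M. pull S Lu p * f p)"
    by simp
  then have "(LINT p|M. pull S g1 p * D x_dir f p + pull S g2 p * D y_dir f p) = - (LINT p|M. pull S Lu p * f p)"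
    using area_pos unfolding mult_cancel_left by simp
  \<comment> \<open>The eigenvalue equation is given almost everywhere on the torus; it is carried
    through the image measure to the cell and then to \<open>M\<close>.\<close>
  moreover have "(LINT p|M. pull S Lu p * f p) = (LINT p|M. - of_real \<mu> * (pull S u p * f p))"
  proof (rule integral_cong_AE)
    have "AE z in torus_measure a b. z \<in> S \<longrightarrow> Lu z = - of_real \<mu> * u z" using eig by simp
    then have "AE p in restrict_space lborel ({0..<2 * pi * a} \<times> {0..<2 * pi * b}). proj p \<in> S \<longrightarrow> Lu (proj p) = - of_real \<mu> * u (proj p)"
      unfolding torus_measure_def by (rule AE_distrD[rotated]) (intro measurable_restrict_space1, simp)
    then have "AE p in lborel. p \<in> {0..<2 * pi * a} \<times> {0..<2 * pi * b} \<longrightarrow> proj p \<in> S \<longrightarrow> Lu (proj p) = - of_real \<mu> * u (proj p)"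
      by (subst (asm) AE_restrict_space_iff) (auto intro!: borel_Times)
    then have "AE p in M. proj p \<in> S \<longrightarrow> Lu (proj p) = - of_real \<mu> * u (proj p)"
      using AE_cell_interior by (intro AE_M_I) auto
    then show "AE p in M. pull S Lu p * f p = - of_real \<mu> * (pull S u p * f p)"
      by eventually_elim (auto simp: pull_def indicator_def)
  qed (use pm meas[OF sf(1)] in simp_all)
  moreover have "integrable M (\<lambda>p. pull S g1 p * D x_dir f p)" "integrable M (\<lambda>p. pull S g2 p * D y_dir f p)"
    "integrable M (\<lambda>p. pull S u p * D x_dir (D x_dir f) p)" "integrable M (\<lambda>p. pull S u p * D y_dir (D y_dir f) p)"
    by (intro integrable_L2_mult PL L2_smooth smooth_D sf)+
  ultimately show "(LINT p|M. pull S u p * (D x_dir (D x_dir f) p + D y_dir (D y_dir f) p)) = - of_real \<mu> * (LINT p|M. pull S u p * f p)"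
    using grad'(1)[OF f(2)] grad'(2)[OF f(3)] by (simp add: distrib_left) (simp add: algebra_simps)
qed

end

text \<open>\<open>P\<close> separates the closure of the obstacle from the part of the billiard outside \<open>V\<close>; the cut-offs are
  functions of \<open>P\<close>.\<close>

locale separated_billiard = billiard_domain +
  fixes V :: "(complex \<times> complex) set" and P :: "complex \<times> complex \<Rightarrow> real"
  assumes Q_nonempty: "Q \<noteq> {}" and S_nonempty: "S \<noteq> {}" and V: "openin (top_of_set S) V"
    and P: "real_polynomial_function P"
    and P_low: "\<And>z. z \<in> flat_torus a b \<Longrightarrow> z \<in> closure Q \<Longrightarrow> P z < 1 / 4"
    and P_high: "\<And>z. z \<in> S \<Longrightarrow> z \<notin> V \<Longrightarrow> P z > 3 / 4"
begin

text \<open>The thresholds 1/4 < 2/5 < 3/5 < 7/10 < 3/4 in \<open>P\<close> are nested. Here the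
  cut-off rises between 2/5 and 3/5, off the closed obstacle, where \<open>P\<close> is below 1/4.
  The weight \<open>cutoff\<close> is still 1 up to 3/5, hence on the support of the derivatives of
  \<eta>, and it reaches 0 at 7/10, before \<open>P\<close> exceeds 3/4 outside
  \<open>V\<close>.\<close>

definition \<eta> :: "real \<times> real \<Rightarrow> real" where "\<eta> p = step (5 * (P (proj p) - 2 / 5))"

definition cutoff :: "real \<times> real \<Rightarrow> real" where "cutoff p = step (10 * (7 / 10 - P (proj p)))"

lemma smooth_P: "smooth (\<lambda>p. P (proj p))" by (rule smooth_polynomial_proj[OF P])

lemma smooth_eta: "smooth \<eta>"
  unfolding \<eta>_def[abs_def]
  by (intro smooth_compose_real[OF smooth_step] smooth_mult smooth_diff smooth_const smooth_P)

lemma smooth_cutoff: "smooth cutoff"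
  unfolding cutoff_def[abs_def]
  by (intro smooth_compose_real[OF smooth_step] smooth_mult smooth_diff smooth_const smooth_P)

lemma eta_0: "P (proj p) \<le> 2 / 5 \<Longrightarrow> \<eta> p = 0" unfolding \<eta>_def by (rule step_0) simp
lemma eta_1: "P (proj p) \<ge> 3 / 5 \<Longrightarrow> \<eta> p = 1" unfolding \<eta>_def by (rule step_1) simp
lemma cutoff_0: "P (proj p) \<ge> 7 / 10 \<Longrightarrow> cutoff p = 0" unfolding cutoff_def by (rule step_0) simp
lemma cutoff_1: "P (proj p) \<le> 3 / 5 \<Longrightarrow> cutoff p = 1" unfolding cutoff_def by (rule step_1) simp

lemma periodic_eta: "periodic \<eta>" unfolding \<eta>_def[abs_def] periodic_def by simp
lemma periodic_cutoff: "periodic cutoff" unfolding cutoff_def[abs_def] periodic_def by simp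

definition Z :: "(complex \<times> complex) set" where "Z = {z. P z \<ge> 2 / 5}"

lemma continuous_P: "continuous_on A P"
  using continuous_on_polymonial_function[of P A] P real_polynomial_function_eq by blast

lemma closed_Z: "closed Z" unfolding Z_def by (intro closed_Collect_le continuous_on_const continuous_P)

text \<open>The margin between 1/4 and 2/5 keeps even the closure of the support off the closed
  obstacle; {P \<ge> 2/5} is a closed set containing it.\<close>

lemma admissibleI:
  assumes "smooth f" "periodic f" "\<And>p. P (proj p) < 2 / 5 \<Longrightarrow> f p = 0"
  shows "admissible f"
proof -
  let ?T = "flat_torus a b"
  have cT: "closed ?T" using compact_imp_closed[OF compact_torus] .
  have "{x \<in> ?T. push f x \<noteq> 0} \<subseteq> ?T \<inter> Z"
  proof
    fix x assume "x \<in> {x \<in> ?T. push f x \<noteq> 0}"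
    then have x: "x \<in> ?T" "f (proj_inv x) \<noteq> 0" by (auto simp: push_def)
    then have "P x \<ge> 2 / 5" using assms(3)[of "proj_inv x"] proj_proj_inv[of x] by fastforce
    then show "x \<in> ?T \<inter> Z" using x by (simp add: Z_def)
  qed
  then have "closure {x \<in> ?T. push f x \<noteq> 0} \<subseteq> ?T \<inter> Z"
    by (rule closure_minimal) (intro closed_Int cT closed_Z)
  also have "\<dots> \<subseteq> ?T - closure Q"
    using P_low by (force simp: Z_def)
  also have "\<dots> \<subseteq> (top_of_set ?T) interior_of S"
  proof (rule interior_of_maximal)
    show "?T - closure Q \<subseteq> S" using closure_subset by (auto simp: S_def)
    show "openin (top_of_set ?T) (?T - closure Q)"
      by (metis Diff_eq closed_closure openin_open_Int open_Compl)
  qed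
  finally show ?thesis using assms(1,2) by (simp add: admissible_def test_function_def push_proj)
qed

definition \<eta>c :: "real \<times> real \<Rightarrow> complex" where "\<eta>c p = of_real (\<eta> p)"

lemma eta_c: "smooth \<eta>c" "periodic \<eta>c"
  unfolding \<eta>c_def[abs_def] by (intro smooth_of_real smooth_eta periodic_comp[OF periodic_eta])+

lemma open_P_less: "open {p. P (proj p) < c}"
  by (intro open_Collect_less continuous_on_const smooth_continuous[OF smooth_P])

lemma open_P_greater: "open {p. c < P (proj p)}"
  by (intro open_Collect_less continuous_on_const smooth_continuous[OF smooth_P])

lemma D_zero_low:
  assumes "\<And>p. P (proj p) < 2 / 5 \<Longrightarrow> f p = 0" "P (proj p) < 2 / 5"
  shows "D v f p = 0"
  by (rule D_zero_open[OF open_P_less[of "2/5"], where c=0]) (use assms in auto)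

lemma D_eta_high:
  assumes "P (proj p) > 3 / 5" shows "D v \<eta>c p = 0"
  by (rule D_zero_open[OF open_P_greater[of "3/5"], where c=1]) (use assms eta_1 in \<open>auto simp: \<eta>c_def\<close>)

lemma D_D_eta_high:
  assumes "P (proj p) > 3 / 5" shows "D v (D v \<eta>c) p = 0"
  by (rule D_zero_open[OF open_P_greater[of "3/5"], where c=0]) (use assms D_eta_high in auto)

lemma D_D_eta_e:
  "D v (D v (\<lambda>x. \<eta>c x * e k x)) p = D v (D v \<eta>c) p * e k p + 2 * \<i> * of_real (fr k \<bullet> v) * (D v \<eta>c p * e k p)
     - of_real ((fr k \<bullet> v)\<^sup>2) * (\<eta>c p * e k p)"
proof -
  let ?s = "\<i> * of_real (fr k \<bullet> v)"
  have 1: "D v (\<lambda>x. \<eta>c x * e k x) = (\<lambda>x. D v \<eta>c x * e k x + ?s * (\<eta>c x * e k x))"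
    by (rule ext) (simp add: D_mult eta_c smooth_e D_e mult_ac)
  have s: "smooth (\<lambda>x. D v \<eta>c x * e k x)" "smooth (\<lambda>x. \<eta>c x * e k x)"
    by (intro smooth_mult smooth_D eta_c smooth_e)+
  have 2: "D v (\<lambda>x. ?s * (\<eta>c x * e k x)) p = ?s * D v (\<lambda>x. \<eta>c x * e k x) p"
    by (rule D_linear[OF bounded_linear_mult_right s(2)])
  have "D v (D v (\<lambda>x. \<eta>c x * e k x)) p = D v (\<lambda>x. D v \<eta>c x * e k x) p + ?s * D v (\<lambda>x. \<eta>c x * e k x) p"
    unfolding 1 by (subst D_add[OF s(1) smooth_mult[OF smooth_const s(2)]]) (simp add: 2 1)
  also have "D v (\<lambda>x. D v \<eta>c x * e k x) p = D v (D v \<eta>c) p * e k p + D v \<eta>c p * (?s * e k p)"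
    by (simp add: D_mult smooth_D eta_c smooth_e D_e)
  finally show ?thesis by (simp add: 1 algebra_simps power2_eq_square)
qed

text \<open>Testing with \<eta> times \<open>e (- k)\<close> yields the Fourier coefficient of
  \<eta> U at once. The cross term 2 grad \<eta> . grad U is read as 2 div (U grad \<eta>) - 2 U
  \<Delta>\<eta>, which removes all derivatives of U and explains why U \<Delta>\<eta> appears in
  the source with a positive sign.\<close>

lemma cutoff_helmholtz:
  assumes lap: "has_laplacian bc a b S u Lu" and eig: "AE x\<in>S in torus_measure a b. Lu x = - of_real (R\<^sup>2) * u x"
  defines "U \<equiv> pull S u"
  shows "L2 U"
    and "helmholtz R (\<lambda>p. \<eta>c p * U p) (\<lambda>p. - 2 * (D x_dir \<eta>c p * U p)) (\<lambda>p. - 2 * (D y_dir \<eta>c p * U p))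
      (\<lambda>p. (D x_dir (D x_dir \<eta>c) p + D y_dir (D y_dir \<eta>c) p) * U p)"
proof -
  have adm: "admissible (\<lambda>x. \<eta>c x * e k x)" "admissible (D v (\<lambda>x. \<eta>c x * e k x))" for k v
  proof -
    have s: "smooth (\<lambda>x. \<eta>c x * e k x)" "periodic (\<lambda>x. \<eta>c x * e k x)"
      by (intro smooth_mult periodic_mult eta_c smooth_e periodic_e)+
    have z: "\<eta>c p * e k p = 0" if "P (proj p) < 2 / 5" for p
      using eta_0[of p] that by (simp add: \<eta>c_def)
    show "admissible (\<lambda>x. \<eta>c x * e k x)" by (rule admissibleI[OF s z])
    show "admissible (D v (\<lambda>x. \<eta>c x * e k x))"
      by (rule admissibleI[OF smooth_D[OF s(1)] periodic_D[OF s] D_zero_low[OF z]])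
  qed
  show L: "L2 U" unfolding U_def by (rule weak_helmholtz(2)[OF lap eig adm(1) adm(2) adm(2)])
  have LU: "L2 (\<lambda>p. g p * U p)" if g: "smooth g" "periodic g" for g
  proof -
    obtain B where B: "\<And>x. cmod (g x) \<le> B" using smooth_bounded[OF g] by blast
    show ?thesis
      by (rule L2_mult_bounded(1)[OF L borel_measurable_continuous_onI[OF smooth_continuous[OF g(1)]] B])
  qed
  define g where "g v = D v \<eta>c" for v
  define gg where "gg v = D v (D v \<eta>c)" for v
  have sg: "smooth (g v)" "periodic (g v)" "smooth (gg v)" "periodic (gg v)" for v
    unfolding g_def gg_def by (intro smooth_D periodic_D eta_c)+
  have key: "of_real ((norm (fr k))\<^sup>2 - R\<^sup>2) * fc (\<lambda>p. \<eta>c p * U p) k =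
      fc (\<lambda>p. gg x_dir p * U p) k + fc (\<lambda>p. gg y_dir p * U p) k
      - 2 * \<i> * of_real (fst (fr k)) * fc (\<lambda>p. g x_dir p * U p) k - 2 * \<i> * of_real (snd (fr k)) * fc (\<lambda>p. g y_dir p * U p) k" for k
  proof -
    let ?e = "e (- k)"
    have i: "integrable M (\<lambda>p. (h p * U p) * ?e p)" if "smooth h" "periodic h" for h
      by (rule integrable_L2_mult[OF LU[OF that] L2_e])
    have pt: "U p * (D x_dir (D x_dir (\<lambda>x. \<eta>c x * ?e x)) p + D y_dir (D y_dir (\<lambda>x. \<eta>c x * ?e x)) p) =
        (gg x_dir p * U p) * ?e p + (gg y_dir p * U p) * ?e p
        - 2 * \<i> * of_real (fst (fr k)) * ((g x_dir p * U p) * ?e p) - 2 * \<i> * of_real (snd (fr k)) * ((g y_dir p * U p) * ?e p)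
        - of_real ((norm (fr k))\<^sup>2) * ((\<eta>c p * U p) * ?e p)" for p
    proof -
      have n: "(norm (fr k))\<^sup>2 = (fst (fr k))\<^sup>2 + (snd (fr k))\<^sup>2"
        by (cases "fr k") (simp add: norm_Pair)
      show ?thesis unfolding D_D_eta_e n
        by (simp add: g_def gg_def fr_uminus inner_prod_def algebra_simps)
    qed
    have "- of_real (R\<^sup>2) * fc (\<lambda>p. \<eta>c p * U p) k =
        (LINT p|M. U p * (D x_dir (D x_dir (\<lambda>x. \<eta>c x * ?e x)) p + D y_dir (D y_dir (\<lambda>x. \<eta>c x * ?e x)) p))"
      unfolding fc_def using weak_helmholtz(1)[OF lap eig adm(1)[of "-k"] adm(2) adm(2)]
      by (simp add: U_def mult_ac)
    also have "\<dots> = fc (\<lambda>p. gg x_dir p * U p) k + fc (\<lambda>p. gg y_dir p * U p) k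
        - 2 * \<i> * of_real (fst (fr k)) * fc (\<lambda>p. g x_dir p * U p) k - 2 * \<i> * of_real (snd (fr k)) * fc (\<lambda>p. g y_dir p * U p) k
        - of_real ((norm (fr k))\<^sup>2) * fc (\<lambda>p. \<eta>c p * U p) k"
      unfolding pt fc_def using i[OF sg(1,2)] i[OF sg(3,4)] i[OF eta_c] by simp
    finally show ?thesis by (simp add: algebra_simps)
  qed
  show "helmholtz R (\<lambda>p. \<eta>c p * U p) (\<lambda>p. - 2 * (D x_dir \<eta>c p * U p)) (\<lambda>p. - 2 * (D y_dir \<eta>c p * U p))
      (\<lambda>p. (D x_dir (D x_dir \<eta>c) p + D y_dir (D y_dir \<eta>c) p) * U p)"
    unfolding helmholtz_def
  proof
    fix k
    have "fc (\<lambda>p. (gg x_dir p + gg y_dir p) * U p) k = fc (\<lambda>p. gg x_dir p * U p) k + fc (\<lambda>p. gg y_dir p * U p) k"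
      unfolding distrib_right by (rule fc_add) (rule LU sg)+
    then show "of_real ((norm (fr k))\<^sup>2 - R\<^sup>2) * fc (\<lambda>p. \<eta>c p * U p) k =
        \<i> * of_real (fst (fr k)) * fc (\<lambda>p. - 2 * (D x_dir \<eta>c p * U p)) k + \<i> * of_real (snd (fr k)) * fc (\<lambda>p. - 2 * (D y_dir \<eta>c p * U p)) k
        + fc (\<lambda>p. (D x_dir (D x_dir \<eta>c) p + D y_dir (D y_dir \<eta>c) p) * U p) k"
      unfolding key fc_cmult by (simp add: g_def gg_def)
  qed
qed

lemma observed: "observed_torus a b cutoff"
proof
  show "smooth cutoff" "periodic cutoff" by (rule smooth_cutoff, rule periodic_cutoff)
  show "0 \<le> cutoff x" "cutoff x \<le> 1" for x using step_range by (simp_all add: cutoff_def)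
  obtain z where z: "z \<in> Q" using Q_nonempty by blast
  have zT: "z \<in> flat_torus a b" using z openin_imp_subset[OF Q] by blast
  have "P z < 1 / 4" using P_low[OF zT] z closure_subset by blast
  then have "cutoff (proj_inv z) = 1" using proj_proj_inv[OF zT] by (intro cutoff_1) simp
  then show "\<exists>x. cutoff x = 1" by blast
qed

lemma all_frequencies:
  "\<exists>C\<ge>0. \<forall>R w F1 F2 G. 0 < R \<longrightarrow> L2 w \<longrightarrow> L2 F1 \<longrightarrow> L2 F2 \<longrightarrow> L2 G \<longrightarrow>
     (\<forall>x. cutoff x \<noteq> 1 \<longrightarrow> F1 x = 0 \<and> F2 x = 0) \<longrightarrow> (\<forall>p. proj p \<in> Q \<longrightarrow> w p = 0) \<longrightarrow> helmholtz R w F1 F2 G \<longrightarrow>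
     nrm w \<le> C * (nrm (\<lambda>x. of_real (cutoff x) * w x) + nrm F1 + nrm F2 + nrm G)"
proof -
  interpret obs: observed_torus a b cutoff by (rule observed)
  obtain R0 C1 where hi: "1 \<le> R0" "0 \<le> C1" "\<forall>R w F1 F2 G. R0 \<le> R \<longrightarrow> L2 w \<longrightarrow> L2 F1 \<longrightarrow> L2 F2 \<longrightarrow> L2 G \<longrightarrow>
     (\<forall>x. cutoff x \<noteq> 1 \<longrightarrow> F1 x = 0 \<and> F2 x = 0) \<longrightarrow> helmholtz R w F1 F2 G \<longrightarrow>
     nrm w \<le> C1 * (nrm (\<lambda>x. of_real (cutoff x) * w x) + nrm F1 + nrm F2 + nrm G)"
    using obs.high_frequency by (elim exE conjE) (rule that; assumption)
  \<comment> \<open>Positive exactly on the lift of the obstacle, where \<open>w\<close> vanishes: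
    the obstacle itself is the region of observation at low frequency. The minimum keeps the weight
    at most 1.\<close>
  define \<sigma> where "\<sigma> p = min 1 (infdist (proj p) S)" for p
  have c\<sigma>: "continuous_on UNIV \<sigma>" unfolding \<sigma>_def[abs_def]
    by (intro continuous_on_min continuous_on_const continuous_on_infdist continuous_proj)
  have p\<sigma>: "periodic \<sigma>" by (simp add: periodic_def \<sigma>_def)
  have r\<sigma>: "0 \<le> \<sigma> p" "\<sigma> p \<le> 1" for p using infdist_nonneg by (auto simp: \<sigma>_def)
  have \<sigma>Q: "proj p \<in> Q" if "\<sigma> p \<noteq> 0" for p
  proof (rule ccontr)
    assume "proj p \<notin> Q"
    then have "proj p \<in> S" using proj_in_torus by (simp add: S_def)
    then show False using that by (simp add: \<sigma>_def)
  qed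
  obtain z where z: "z \<in> Q" using Q_nonempty by blast
  have zT: "z \<in> flat_torus a b" using z openin_imp_subset[OF Q] by blast
  have "infdist z S > 0"
    using in_closed_iff_infdist_zero[OF closed_S S_nonempty, of z] z infdist_nonneg[of z S] by (auto simp: S_def)
  then have "\<sigma> (proj_inv z) > 0" by (simp add: \<sigma>_def proj_proj_inv[OF zT])
  then have ex: "\<exists>p. \<sigma> p > 0" by blast
  have R0: "0 \<le> R0" using hi(1) by simp
  obtain C2 where lo: "C2 \<ge> 0" "\<forall>R w F1 F2 G. 0 < R \<longrightarrow> R \<le> R0 \<longrightarrow> L2 w \<longrightarrow> L2 F1 \<longrightarrow> L2 F2 \<longrightarrow> L2 G \<longrightarrow>
     (\<forall>x. \<sigma> x \<noteq> 0 \<longrightarrow> w x = 0) \<longrightarrow> helmholtz R w F1 F2 G \<longrightarrow>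
     nrm w \<le> C2 * (nrm F1 + nrm F2 + nrm G)"
    using low_frequency[OF c\<sigma> p\<sigma> r\<sigma> ex R0] by (elim exE conjE) (rule that; assumption)
  have "nrm w \<le> (C1 + C2) * (nrm (\<lambda>x. of_real (cutoff x) * w x) + nrm F1 + nrm F2 + nrm G)"
    if R: "0 < R" and L: "L2 w" "L2 F1" "L2 F2" "L2 G"
      and F: "\<forall>x. cutoff x \<noteq> 1 \<longrightarrow> F1 x = 0 \<and> F2 x = 0" and wQ: "\<forall>p. proj p \<in> Q \<longrightarrow> w p = 0"
      and eq: "helmholtz R w F1 F2 G" for R w F1 F2 G
  proof (cases "R0 \<le> R")
    case True
    have "nrm w \<le> C1 * (nrm (\<lambda>x. of_real (cutoff x) * w x) + nrm F1 + nrm F2 + nrm G)"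
      by (rule hi(3)[rule_format, OF True L F[rule_format] eq])
    also have "\<dots> \<le> (C1 + C2) * (nrm (\<lambda>x. of_real (cutoff x) * w x) + nrm F1 + nrm F2 + nrm G)"
      using lo(1) by (intro mult_right_mono add_nonneg_nonneg) auto
    finally show ?thesis .
  next
    case False
    have "\<forall>x. \<sigma> x \<noteq> 0 \<longrightarrow> w x = 0" using \<sigma>Q wQ by blast
    then have "nrm w \<le> C2 * (nrm F1 + nrm F2 + nrm G)"
      using lo(2) R False L eq by (meson linear)
    also have "\<dots> \<le> (C1 + C2) * (nrm (\<lambda>x. of_real (cutoff x) * w x) + nrm F1 + nrm F2 + nrm G)"
      using lo(1) hi(2) by (intro mult_mono add_nonneg_nonneg) auto
    finally show ?thesis .
  qed
  note main = this
  have "0 \<le> C1 + C2" using hi(2) lo(1) by simp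
  then show ?thesis
    by (intro exI[of _ "C1 + C2"] conjI allI impI, assumption, intro main) assumption+
qed

lemma borel_V: "V \<in> sets borel"
proof -
  obtain W where "open W" "V = S \<inter> W" using V by (auto simp: openin_open)
  then show ?thesis using closed_S by auto
qed

text \<open>The function is the sum of \<eta> U, controlled by \<open>all_frequencies\<close>, and
  (1 - \<eta>) U, supported over \<open>V\<close>. All source terms and the weighted term are
  supported over \<open>V\<close> as well, so each is at most a constant times the restriction of U
  to \<open>V\<close>.\<close>

lemma observability:
  "\<exists>C\<ge>0. \<forall>R bc u Lu. 0 < R \<longrightarrow> has_laplacian bc a b S u Lu \<longrightarrow>
     (AE x\<in>S in torus_measure a b. Lu x = - of_real (R\<^sup>2) * u x) \<longrightarrow>
     (LINT x:S|torus_measure a b. (cmod (u x))\<^sup>2) \<le> C * (LINT x:V|torus_measure a b. (cmod (u x))\<^sup>2)"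
proof -
  obtain C where C: "C \<ge> 0" "\<forall>R w F1 F2 G. 0 < R \<longrightarrow> L2 w \<longrightarrow> L2 F1 \<longrightarrow> L2 F2 \<longrightarrow> L2 G \<longrightarrow>
     (\<forall>x. cutoff x \<noteq> 1 \<longrightarrow> F1 x = 0 \<and> F2 x = 0) \<longrightarrow> (\<forall>p. proj p \<in> Q \<longrightarrow> w p = 0) \<longrightarrow> helmholtz R w F1 F2 G \<longrightarrow>
     nrm w \<le> C * (nrm (\<lambda>x. of_real (cutoff x) * w x) + nrm F1 + nrm F2 + nrm G)"
    using all_frequencies by (elim exE conjE) (rule that; assumption)
  have VS: "V \<subseteq> S" using openin_imp_subset[OF V] .
  define gx where "gx = D x_dir \<eta>c"
  define gy where "gy = D y_dir \<eta>c"
  define gl where "gl p = D x_dir (D x_dir \<eta>c) p + D y_dir (D y_dir \<eta>c) p" for p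
  have sg: "smooth gx" "periodic gx" "smooth gy" "periodic gy" "smooth (D x_dir (D x_dir \<eta>c))" "smooth (D y_dir (D y_dir \<eta>c))"
     "periodic (D x_dir (D x_dir \<eta>c))" "periodic (D y_dir (D y_dir \<eta>c))"
    unfolding gx_def gy_def by (intro smooth_D periodic_D eta_c)+
  have sl: "smooth gl" unfolding gl_def[abs_def] by (intro smooth_add sg)
  have pl: "periodic gl" using sg(7,8) unfolding gl_def[abs_def] periodic_def by (intro allI impI arg_cong2[where f="(+)"]) blast+
  obtain B1 where B1: "\<And>x. cmod (gx x) \<le> B1" using smooth_bounded[OF sg(1,2)] by blast
  obtain B2 where B2: "\<And>x. cmod (gy x) \<le> B2" using smooth_bounded[OF sg(3,4)] by blast
  obtain B3 where B3: "\<And>x. cmod (gl x) \<le> B3" using smooth_bounded[OF sl pl] by blast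
  \<comment> \<open>U is split into two parts, each counted twice in the squared norm. The factors 4
    are the squares of the 2 in the divergence part of the source.\<close>
  define C' where "C' = 2 + 2 * C * (1 + 4 * B1\<^sup>2 + 4 * B2\<^sup>2 + B3\<^sup>2)"
  have "(LINT x:S|torus_measure a b. (cmod (u x))\<^sup>2) \<le> C' * (LINT x:V|torus_measure a b. (cmod (u x))\<^sup>2)"
    if R: "0 < R" and lap: "has_laplacian bc a b S u Lu" and eig: "AE x\<in>S in torus_measure a b. Lu x = - of_real (R\<^sup>2) * u x"
    for R bc u Lu
  proof -
    define U where "U = pull S u"
    note ch = cutoff_helmholtz[OF lap eig, folded U_def]
    have L: "L2 U" by (rule ch(1))
    define UV where "UV = pull V u"
    have UV: "UV p = indicator V (proj p) * U p" for p
      using VS by (auto simp: UV_def U_def pull_def indicator_def)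
    have mUV: "UV \<in> borel_measurable borel"
    proof -
      have "(\<lambda>p. indicator V (proj p) :: complex) \<in> borel_measurable borel"
        by (rule measurable_compose[OF measurable_proj borel_measurable_indicator[OF borel_V]])
      then show ?thesis unfolding UV[THEN ext] using L2_measurable[OF L] by simp
    qed
    have LUV: "L2 UV"
      by (rule L2_nrm_mono(1)[OF L mUV, of 1]) (simp add: UV norm_mult indicator_def)
    \<comment> \<open>A point outside \<open>V\<close> where U is not 0 lies over \<open>S\<close>,
      so \<open>P\<close> exceeds 3/4 there and \<open>g\<close> vanishes.\<close>
    have near: "cmod (g p * U p) \<le> B * cmod (UV p)" if "cmod (g p) \<le> B" "P (proj p) > 7 / 10 \<Longrightarrow> g p = 0" for g p B
    proof (cases "proj p \<in> V \<or> U p = 0 \<or> g p = 0")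
      case True
      moreover have "B \<ge> 0" using that(1) norm_ge_zero[of "g p"] by linarith
      ultimately show ?thesis using mult_right_mono[OF that(1) norm_ge_zero[of "U p"]]
        by (auto simp: UV norm_mult)
    next
      case False
      then have "proj p \<in> S" by (auto simp: U_def pull_def indicator_def split: if_splits)
      then have "P (proj p) > 7 / 10" using P_high[of "proj p"] False by auto
      then show ?thesis using that(2) False by blast
    qed
    have bound: "L2 (\<lambda>p. g p * U p) \<and> nrm (\<lambda>p. g p * U p) \<le> B\<^sup>2 * nrm UV"
      if g: "smooth g" "\<And>p. cmod (g p) \<le> B" "\<And>p. P (proj p) > 7 / 10 \<Longrightarrow> g p = 0" for g B
    proof -
      have m: "(\<lambda>p. g p * U p) \<in> borel_measurable borel"
        using borel_measurable_continuous_onI[OF smooth_continuous[OF g(1)]] L2_measurable[OF L] by simp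
      show ?thesis
        using L2_nrm_mono[OF LUV m] near[of g _ B] g(2,3) by blast
    qed
    have hx: "gx p = 0" "gy p = 0" "gl p = 0" if "P (proj p) > 3 / 5" for p
      using D_eta_high[OF that] D_D_eta_high[OF that] by (auto simp: gx_def gy_def gl_def)
    have bx: "L2 (\<lambda>p. gx p * U p)" "nrm (\<lambda>p. gx p * U p) \<le> B1\<^sup>2 * nrm UV"
      using bound[OF sg(1) B1] hx(1) by auto
    have by': "L2 (\<lambda>p. gy p * U p)" "nrm (\<lambda>p. gy p * U p) \<le> B2\<^sup>2 * nrm UV"
      using bound[OF sg(3) B2] hx(2) by auto
    have bl: "L2 (\<lambda>p. gl p * U p)" "nrm (\<lambda>p. gl p * U p) \<le> B3\<^sup>2 * nrm UV"
      using bound[OF sl B3] hx(3) by auto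
    define w where "w p = \<eta>c p * U p" for p
    have range01: "0 \<le> \<eta> p" "\<eta> p \<le> 1" "0 \<le> cutoff p" "cutoff p \<le> 1" for p
      using step_range by (simp_all add: \<eta>_def cutoff_def)
    have Lw: "L2 w" unfolding w_def[abs_def]
      by (rule L2_mult_bounded(1)[OF L borel_measurable_continuous_onI[OF smooth_continuous[OF eta_c(1)]], of 1])
        (use range01 in \<open>simp add: \<eta>c_def\<close>)
    have nw: "nrm w \<le> C * (nrm (\<lambda>x. of_real (cutoff x) * w x) + nrm (\<lambda>p. - 2 * (gx p * U p)) + nrm (\<lambda>p. - 2 * (gy p * U p)) + nrm (\<lambda>p. gl p * U p))"
    proof (rule C(2)[rule_format, OF R Lw])
      show "L2 (\<lambda>p. - 2 * (gx p * U p))" "L2 (\<lambda>p. - 2 * (gy p * U p))" "L2 (\<lambda>p. gl p * U p)"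
        by (intro L2_cmult bx by' bl)+
      show "helmholtz R w (\<lambda>p. - 2 * (gx p * U p)) (\<lambda>p. - 2 * (gy p * U p)) (\<lambda>p. gl p * U p)"
        using ch(2) by (simp add: w_def[abs_def] gx_def gy_def gl_def)
      show "- 2 * (gx p * U p) = 0 \<and> - 2 * (gy p * U p) = 0" if "cutoff p \<noteq> 1" for p
      proof -
        have "P (proj p) > 3 / 5" using cutoff_1[of p] that by linarith
        then show ?thesis using hx by simp
      qed
      show "w p = 0" if "proj p \<in> Q" for p
        using that by (simp add: w_def U_def pull_def S_def)
    qed
    have ncw: "nrm (\<lambda>x. of_real (cutoff x) * w x) \<le> 1\<^sup>2 * nrm UV"
    proof -
      have "smooth (\<lambda>x. complex_of_real (cutoff x) * \<eta>c x)" by (intro smooth_mult smooth_of_real smooth_cutoff eta_c)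
      moreover have "cmod (complex_of_real (cutoff x) * \<eta>c x) \<le> 1" for x
        using range01[of x] by (simp add: norm_mult \<eta>c_def mult_le_one)
      moreover have "complex_of_real (cutoff x) * \<eta>c x = 0" if "P (proj x) > 7 / 10" for x
        using cutoff_0[of x] that by simp
      ultimately have "nrm (\<lambda>p. (complex_of_real (cutoff p) * \<eta>c p) * U p) \<le> 1\<^sup>2 * nrm UV"
        using bound by blast
      then show ?thesis by (simp add: w_def mult.assoc)
    qed
    have n2: "nrm (\<lambda>p. - 2 * (gx p * U p)) \<le> 4 * (B1\<^sup>2 * nrm UV)" "nrm (\<lambda>p. - 2 * (gy p * U p)) \<le> 4 * (B2\<^sup>2 * nrm UV)"
      unfolding nrm_cmult using bx(2) by'(2) by simp_all
    have "nrm w \<le> C * (1\<^sup>2 * nrm UV + 4 * (B1\<^sup>2 * nrm UV) + 4 * (B2\<^sup>2 * nrm UV) + B3\<^sup>2 * nrm UV)"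
      by (rule order_trans[OF nw]) (intro mult_left_mono add_mono ncw n2 bl C(1))
    then have nw': "nrm w \<le> C * (1 + 4 * B1\<^sup>2 + 4 * B2\<^sup>2 + B3\<^sup>2) * nrm UV" by (simp add: algebra_simps)
    \<comment> \<open>This part vanishes where \<open>P\<close> is at least 3/5, so it sees U over
      \<open>V\<close> only.\<close>
    define r where "r p = (1 - \<eta>c p) * U p" for p
    have nr: "L2 r" "nrm r \<le> 1\<^sup>2 * nrm UV"
    proof -
      have "smooth (\<lambda>p. 1 - \<eta>c p)" by (intro smooth_diff smooth_const eta_c)
      moreover have "cmod (1 - \<eta>c p) \<le> 1" for p
      proof -
        have "1 - \<eta>c p = of_real (1 - \<eta> p)" by (simp add: \<eta>c_def)
        then show ?thesis using range01[of p] by (simp only: norm_of_real)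
      qed
      moreover have "1 - \<eta>c p = 0" if "P (proj p) > 7 / 10" for p
        using eta_1[of p] that by (simp add: \<eta>c_def)
      ultimately show "L2 r" "nrm r \<le> 1\<^sup>2 * nrm UV"
        unfolding r_def[abs_def] using bound by blast+
    qed
    have "(\<lambda>p. r p + w p) = U" by (auto simp: r_def w_def algebra_simps)
    then have "nrm U \<le> 2 * nrm r + 2 * nrm w" using nrm_add_le[OF nr(1) Lw] by simp
    also have "\<dots> \<le> C' * nrm UV" using nr(2) nw' unfolding C'_def by (simp add: algebra_simps)
    finally have "nrm U \<le> C' * nrm UV" .
    then have "area * nrm U \<le> C' * (area * nrm UV)" using area_pos by (simp add: mult.left_commute)
    moreover have "(LINT x:S|torus_measure a b. (cmod (u x))\<^sup>2) = area * nrm U"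
      unfolding U_def by (rule set_integral_nrm[OF S_sub]) (use L2_measurable[OF L] in \<open>simp add: U_def\<close>)
    moreover have "(LINT x:V|torus_measure a b. (cmod (u x))\<^sup>2) = area * nrm UV"
      unfolding UV_def by (rule set_integral_nrm[OF order_trans[OF VS S_sub]]) (use mUV in \<open>simp add: UV_def\<close>)
    ultimately show ?thesis by simp
  qed
  note main = this
  have nonneg: "0 \<le> C'" using C(1) by (auto simp: C'_def intro!: add_nonneg_nonneg mult_nonneg_nonneg)
  show ?thesis by (intro exI[of _ C'] conjI[OF nonneg] allI impI, rule main) assumption+
qed

end

theorem theorem3:
  fixes a b :: real and Q S V :: "(complex \<times> complex) set" and bc :: boundary_condition
  assumes "a > 0" and "b > 0"
    and "sinai_obstacle a b Q"
    and "S = flat_torus a b - Q"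
    and "openin (top_of_set S) V"
    and "(top_of_set (flat_torus a b)) frontier_of Q \<subseteq> V"
  shows "\<exists>C::real. C > 0 \<and>
    (\<forall>(h::real) (E::real) u Lu.
       h > 0 \<longrightarrow> \<bar>E - 1\<bar> < 1 / 2 \<longrightarrow>
       has_laplacian bc a b S u Lu \<longrightarrow>
       (AE x\<in>S in torus_measure a b. - (of_real (h\<^sup>2) * Lu x) = of_real E * u x) \<longrightarrow>
       (LINT x:V|torus_measure a b. (cmod (u x))\<^sup>2)
         \<ge> 1 / C * (LINT x:S|torus_measure a b. (cmod (u x))\<^sup>2))"
proof (cases "S = {}")
  \<comment> \<open>The obstacle fills the torus; \<open>V\<close> is empty as well and both
    integrals are 0.\<close>
  case True
  then have "V = {}" using openin_imp_subset[OF assms(5)] by simp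
  then show ?thesis using True by (intro exI[of _ 1]) (simp add: set_lebesgue_integral_def)
next
  case False
  let ?T = "flat_torus a b"
  have obstacle: "Q \<noteq> {}" "openin (top_of_set ?T) Q" using assms(3) by (auto simp: sinai_obstacle_def)
  interpret billiard_domain a b Q S by unfold_locales (use assms obstacle in auto)
  have closedT: "closed ?T" using compact_imp_closed[OF compact_torus] .
  have QT: "Q \<subseteq> ?T" using openin_imp_subset[OF obstacle(2)] .
  have clT: "closure Q \<subseteq> ?T" by (rule closure_minimal[OF QT closedT])
  have cSV: "closed (S - V)"
  proof -
    obtain W where "open W" "V = S \<inter> W" using assms(5) by (auto simp: openin_open)
    then have "S - V = S - W" by auto
    then show ?thesis using \<open>open W\<close> closed_S by (simp add: closed_Diff)
  qed
  \<comment> \<open>A point of the closure of \<open>Q\<close> that lies in \<open>S\<close> is a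
    frontier point of \<open>Q\<close>, hence in \<open>V\<close>.\<close>
  have disj: "closure Q \<inter> (S - V) = {}"
  proof (rule ccontr)
    assume "closure Q \<inter> (S - V) \<noteq> {}"
    then obtain z where z: "z \<in> closure Q" "z \<in> S" "z \<notin> V" by blast
    have "z \<in> (top_of_set ?T) closure_of Q"
      using z(1) clT QT by (simp add: closure_of_subtopology Int_absorb1 subset_iff)
    moreover have "z \<notin> (top_of_set ?T) interior_of Q"
      using z(2) interior_of_subset[of "top_of_set ?T" Q] by (auto simp: S_def)
    ultimately have "z \<in> (top_of_set ?T) frontier_of Q" by (simp add: frontier_of_def)
    then show False using assms(6) z(3) by blast
  qed
  \<comment> \<open>A continuous separation by the values 0 and 1 is replaced by a polynomial in the
    ambient coordinates, whose lift is smooth. The error 1/4 leaves the gap from 1/4 to 3/4.\<close>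
  obtain f :: "complex \<times> complex \<Rightarrow> real" where f: "continuous_on UNIV f" "\<And>x. f x \<in> closed_segment 0 1"
      "\<And>x. x \<in> closure Q \<Longrightarrow> f x = 0" "\<And>x. x \<in> S - V \<Longrightarrow> f x = 1"
    using Urysohn[OF closed_closure cSV disj, of 0 1] by blast
  obtain P where P: "real_polynomial_function P" "\<And>x. x \<in> ?T \<Longrightarrow> \<bar>f x - P x\<bar> < 1 / 4"
    using Stone_Weierstrass_real_polynomial_function[OF compact_torus continuous_on_subset[OF f(1)], of "1/4"] by auto
  interpret separated_billiard a b Q S V P
  proof
    show "P z < 1 / 4" if "z \<in> ?T" "z \<in> closure Q" for z using P(2)[OF that(1)] f(3)[OF that(2)] by simp
    show "P z > 3 / 4" if "z \<in> S" "z \<notin> V" for z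
    proof -
      have "z \<in> ?T" using that(1) S_sub by blast
      then have "\<bar>1 - P z\<bar> < 1 / 4" using P(2)[of z] f(4)[of z] that by simp
      then show ?thesis by linarith
    qed
  qed (use obstacle False assms(5) P(1) in auto)
  obtain C where C: "C \<ge> 0" "\<forall>R bc u Lu. 0 < R \<longrightarrow> has_laplacian bc a b S u Lu \<longrightarrow>
     (AE x\<in>S in torus_measure a b. Lu x = - of_real (R\<^sup>2) * u x) \<longrightarrow>
     (LINT x:S|torus_measure a b. (cmod (u x))\<^sup>2) \<le> C * (LINT x:V|torus_measure a b. (cmod (u x))\<^sup>2)"
    using observability by (elim exE conjE) (rule that; assumption)
  have "1 / (C + 1) * (LINT x:S|torus_measure a b. (cmod (u x))\<^sup>2) \<le> (LINT x:V|torus_measure a b. (cmod (u x))\<^sup>2)"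
    if h: "h > 0" and E: "\<bar>E - 1\<bar> < 1 / 2" and lap: "has_laplacian bc a b S u Lu"
      and eq: "AE x\<in>S in torus_measure a b. - (of_real (h\<^sup>2) * Lu x) = of_real E * u x" for h E :: real and u Lu
  proof -
    have Epos: "E > 0" using E by linarith
    \<comment> \<open>\<open>E\<close> and \<open>h\<close> enter only through this quotient. As
      \<open>h\<close> may be large, \<open>R\<close> may be any positive number, which is why small
      \<open>R\<close> had to be covered too.\<close>
    define R where "R = sqrt E / h"
    have R: "R > 0" "R\<^sup>2 = E / h\<^sup>2" using Epos h by (auto simp: R_def power_divide)
    have eig: "AE x\<in>S in torus_measure a b. Lu x = - of_real (R\<^sup>2) * u x"
      using eq
    proof eventually_elim
      case (elim x)
      show ?case
      proof
        assume "x \<in> S"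
        then have "- (of_real (h\<^sup>2) * Lu x) = of_real E * u x" using elim by blast
        then have "of_real (h\<^sup>2) * Lu x = - (of_real E * u x)" by (metis minus_minus)
        then show "Lu x = - of_real (R\<^sup>2) * u x"
          using h unfolding R(2) by (simp add: field_simps)
      qed
    qed
    have le: "(LINT x:S|torus_measure a b. (cmod (u x))\<^sup>2) \<le> C * (LINT x:V|torus_measure a b. (cmod (u x))\<^sup>2)"
      by (rule C(2)[rule_format, OF R(1) lap eig])
    have "0 \<le> (LINT x:V|torus_measure a b. (cmod (u x))\<^sup>2)"
      unfolding set_lebesgue_integral_def by (intro Bochner_Integration.integral_nonneg) simp
    then have "(LINT x:S|torus_measure a b. (cmod (u x))\<^sup>2) \<le> (C + 1) * (LINT x:V|torus_measure a b. (cmod (u x))\<^sup>2)"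
      using le by (simp add: algebra_simps)
    then show ?thesis using C(1) by (simp add: pos_divide_le_eq mult.commute)
  qed
  note main = this
  have pos: "C + 1 > 0" using C(1) by simp
  show ?thesis by (intro exI[of _ "C + 1"] conjI[OF pos] allI impI, rule main) assumption+
qed

end
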